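(* Let $\rho$ be a density matrix, let $(X_1,\Phi_1),(X_2,\Phi_2),\dots$ be i.i.d. with values in $\mathbb{R}\times[0,\pi]$ and probability density $p_\rho$, and let $N(n)$ be a sequence of positive integers with $N(n)\to\infty$ as $n\to\infty$. Let $\hat\rho^{(N,n)}$ be the pattern function projection estimator of dimension $N=N(n)$ based on $(X_1,\Phi_1),\dots,(X_n,\Phi_n)$. If $N(n)=o(n^{3/7})$, then $\mathbb{E}\big(\|\hat\rho^{(N,n)}-\rho\|_2^2\big)\to 0$ as $n\to\infty$. If $N(n)=o(n^{3/10})$, then $\mathbb{E}\big(\|\hat\rho^{(N,n)}-\rho\|_1\big)\to 0$ as $n\to\infty$.
   Context: For $k\ge 0$ let $\psi_k(x)=H_k(x)e^{-x^2/2}$, where $H_k$ is the Hermite polynomial of degree $k$ (for the weight $e^{-x^2}$) normalized so that $\int_{\mathbb{R}}\psi_k^2=1$; $\{\psi_k\}_{k\ge0}$ is an orthonormal basis of $L_2(\mathbb{R})$. A density matrix is an infinite complex matrix $\rho=[\rho_{j,k}]_{j,k\ge 0}$ representing (in the basis $\{\psi_k\}$) a positive semidefinite self-adjoint operator on $L_2(\mathbb{R})$ with $\mathrm{Tr}\,\rho=1$. To $\rho$ is associated the probability density on $\mathbb{R}\times[0,\pi]$ (with respect to $dx\,d\phi$) $$p_\rho(x,\phi)=\frac1\pi\sum_{j,k=0}^\infty\rho_{j,k}\,\psi_k(x)\psi_j(x)e^{-i(j-k)\phi}.$$ Pattern functions: for $j\ge k\ge0$, $f_{k,j}(x)=\frac{d}{dx}\big(\psi_k(x)\varphi_j(x)\big)$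 and $f_{j,k}=f_{k,j}$, where $\varphi_j$ is the unbounded real solution of $-\frac12\varphi''+\frac12x^2\varphi=(j+\tfrac12)\varphi$ having parity opposite to that of $\psi_j$ and normalized by the Wronskian condition $\psi_j\varphi_j'-\psi_j'\varphi_j=2$. These are bounded real functions. Put $F_{k,j}(x,\phi)=f_{k,j}(x)e^{-i(j-k)\phi}$; with this normalization $\int_0^\pi\int_{\mathbb{R}}F_{k,j}(x,\phi)\,p_\rho(x,\phi)\,dx\,d\phi=\rho_{k,j}$ for every density matrix $\rho$. The pattern function projection estimator of dimension $N$ is the matrix with entries $\hat\rho^{(N,n)}_{k,j}=\frac1n\sum_{\ell=1}^nF_{k,j}(X_\ell,\Phi_\ell)$ for $0\le k,j\le N-1$ and $\hat\rho^{(N,n)}_{k,j}=0$ if $k\ge N$ or $j\ge N$. Norms: for a self-adjoint trace class operator (matrix) $A$, $\|A\|_1=\mathrm{Tr}(|A|)$ and $\|A\|_2=[\mathrm{Tr}(|A|^2)]^{1/2}=\big[\sum_{j,k}|A_{k,j}|^2\big]^{1/2}$. *)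

theory Defs
  imports "HOL-Probability.Probability" "HOL-Library.Landau_Symbols"
    "HOL-Computational_Algebra.Polynomial"
begin

text \<open>Hermite polynomials for the weight \<open>exp (- x\<^sup>2)\<close> (leading coefficient \<open>2 ^ k\<close>), not yet
  normalized; see \<open>hermite_rodrigues\<close> for the agreement with Rodrigues' formula.\<close>

primrec hermite :: "nat \<Rightarrow> real poly" where
  "hermite 0 = 1"
| "hermite (Suc k) = [:0, 2:] * hermite k - pderiv (hermite k)"

lemma hermite_rodrigues:
  "(deriv ^^ k) (\<lambda>t::real. exp (- t\<^sup>2)) = (\<lambda>x. (- 1) ^ k * poly (hermite k) x * exp (- x\<^sup>2))"
proof (induction k)
  case 0
  show ?case by simp
next
  case (Suc k)
  have "deriv (\<lambda>x. (- 1) ^ k * poly (hermite k) x * exp (- x\<^sup>2)) x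
      = (- 1) ^ Suc k * poly (hermite (Suc k)) x * exp (- x\<^sup>2)" for x :: real
    by (rule DERIV_imp_deriv) (auto intro!: derivative_eq_intros simp: algebra_simps)
  then show ?case
    unfolding funpow.simps comp_def Suc.IH by (intro ext)
qed

definition psi :: "nat \<Rightarrow> real \<Rightarrow> real" where
  "psi k x = poly (hermite k) x * exp (- x\<^sup>2 / 2)
     / sqrt (LINT y|lborel. (poly (hermite k) y * exp (- y\<^sup>2 / 2))\<^sup>2)"

definition second_solution :: "nat \<Rightarrow> (real \<Rightarrow> real) \<Rightarrow> bool" where
  "second_solution j g \<longleftrightarrow>
     (\<forall>x. g differentiable (at x)) \<and> (\<forall>x. deriv g differentiable (at x)) \<and>
     (\<forall>x. - (1 / 2) * deriv (deriv g) x + (1 / 2) * x\<^sup>2 * g x = (real j + 1 / 2) * g x) \<and>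
     \<not> bounded (range g) \<and>
     (\<forall>x. g (- x) = (- 1) ^ Suc j * g x) \<and>
     (\<forall>x. psi j x * deriv g x - deriv (psi j) x * g x = 2)"

definition phi :: "nat \<Rightarrow> real \<Rightarrow> real" where
  "phi j = (THE g. second_solution j g)"

definition pattern_fun :: "nat \<Rightarrow> nat \<Rightarrow> real \<Rightarrow> real" where
  "pattern_fun k j =
     (if k \<le> j then deriv (\<lambda>x. psi k x * phi j x) else deriv (\<lambda>x. psi j x * phi k x))"

definition pattern_F :: "nat \<Rightarrow> nat \<Rightarrow> real \<times> real \<Rightarrow> complex" where
  "pattern_F k j = (\<lambda>(x, \<theta>). of_real (pattern_fun k j x) * cis (- (real j - real k) * \<theta>))"

text \<open>Operators on \<open>L\<^sub>2(\<real>)\<close> are represented by their matrices in the orthonormal basis \<open>psi\<close>,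
  that is, as operators on the sequence space \<open>\<ell>\<^sub>2\<close> of coordinate vectors.\<close>

definition ell2 :: "(nat \<Rightarrow> complex) set" where
  "ell2 = {v. summable (\<lambda>k. (cmod (v k))\<^sup>2)}"

definition ell2_norm :: "(nat \<Rightarrow> complex) \<Rightarrow> real" where
  "ell2_norm v = sqrt (\<Sum>k. (cmod (v k))\<^sup>2)"

definition ell2_inner :: "(nat \<Rightarrow> complex) \<Rightarrow> (nat \<Rightarrow> complex) \<Rightarrow> complex" where
  "ell2_inner u v = (\<Sum>k. cnj (u k) * v k)"

definition mat_app :: "(nat \<Rightarrow> nat \<Rightarrow> complex) \<Rightarrow> (nat \<Rightarrow> complex) \<Rightarrow> nat \<Rightarrow> complex" where
  "mat_app A v = (\<lambda>j. \<Sum>k. A j k * v k)"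

definition mat_mult ::
    "(nat \<Rightarrow> nat \<Rightarrow> complex) \<Rightarrow> (nat \<Rightarrow> nat \<Rightarrow> complex) \<Rightarrow> nat \<Rightarrow> nat \<Rightarrow> complex" where
  "mat_mult A B = (\<lambda>j k. \<Sum>l. A j l * B l k)"

definition mat_adj :: "(nat \<Rightarrow> nat \<Rightarrow> complex) \<Rightarrow> nat \<Rightarrow> nat \<Rightarrow> complex" where
  "mat_adj A = (\<lambda>j k. cnj (A k j))"

definition bounded_mat :: "(nat \<Rightarrow> nat \<Rightarrow> complex) \<Rightarrow> bool" where
  "bounded_mat A \<longleftrightarrow>
     (\<forall>v\<in>ell2. (\<forall>j. summable (\<lambda>k. A j k * v k)) \<and> mat_app A v \<in> ell2) \<and>
     (\<exists>C. \<forall>v\<in>ell2. ell2_norm (mat_app A v) \<le> C * ell2_norm v)"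

definition psd_mat :: "(nat \<Rightarrow> nat \<Rightarrow> complex) \<Rightarrow> bool" where
  "psd_mat A \<longleftrightarrow> bounded_mat A \<and> mat_adj A = A \<and>
     (\<forall>v\<in>ell2. 0 \<le> Re (ell2_inner v (mat_app A v)))"

definition density_matrix :: "(nat \<Rightarrow> nat \<Rightarrow> complex) \<Rightarrow> bool" where
  "density_matrix \<rho> \<longleftrightarrow> psd_mat \<rho> \<and> (\<lambda>k. \<rho> k k) sums 1"

text \<open>The operator \<open>|A| = (A\<^sup>* A)\<^sup>1\<^sup>/\<^sup>2\<close>, meaningful for bounded \<open>A\<close>.\<close>

definition mat_abs :: "(nat \<Rightarrow> nat \<Rightarrow> complex) \<Rightarrow> nat \<Rightarrow> nat \<Rightarrow> complex" where
  "mat_abs A = (THE P. psd_mat P \<and> mat_mult P P = mat_mult (mat_adj A) A)"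

text \<open>Both norms take values in the extended nonnegative reals, so that a divergent sum has the
  value \<open>\<infinity>\<close>. For the Hilbert--Schmidt norm it is the square of the norm that is defined.\<close>

definition trace_norm :: "(nat \<Rightarrow> nat \<Rightarrow> complex) \<Rightarrow> ennreal" where
  "trace_norm A = (\<Sum>k. ennreal (Re (mat_abs A k k)))"

definition hs_norm_sq :: "(nat \<Rightarrow> nat \<Rightarrow> complex) \<Rightarrow> ennreal" where
  "hs_norm_sq A = (\<Sum>j. \<Sum>k. ennreal ((cmod (A j k))\<^sup>2))"

definition obs_space :: "(real \<times> real) measure" where
  "obs_space = restrict_space lborel (UNIV \<times> {0..pi})"

definition density_partial :: "(nat \<Rightarrow> nat \<Rightarrow> complex) \<Rightarrow> nat \<Rightarrow> real \<times> real \<Rightarrow> complex" where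
  "density_partial \<rho> m = (\<lambda>(x, \<theta>). of_real (1 / pi) *
     (\<Sum>j<m. \<Sum>k<m. \<rho> j k * of_real (psi k x * psi j x) * cis (- (real j - real k) * \<theta>)))"

text \<open>\<open>homodyne_density \<rho> p\<close>: the function \<open>p\<close> is a version of the density \<open>p\<^sub>\<rho>\<close> given by the double
  series. For a general density matrix the series does not converge absolutely at every point; its
  square partial sums converge in \<open>L\<^sub>1\<close>, which determines \<open>p\<close> almost everywhere.\<close>

definition homodyne_density ::
    "(nat \<Rightarrow> nat \<Rightarrow> complex) \<Rightarrow> (real \<times> real \<Rightarrow> real) \<Rightarrow> bool" where
  "homodyne_density \<rho> p \<longleftrightarrow> p \<in> borel_measurable obs_space \<and>
     (\<lambda>m. \<integral>\<^sup>+ z. ennreal (cmod (density_partial \<rho> m z - of_real (p z))) \<partial>obs_space) \<longlonglongrightarrow> 0"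

text \<open>The observations used by the estimator are \<open>z 0, \<dots>, z (n - 1)\<close>.\<close>

definition pattern_estimator ::
    "nat \<Rightarrow> nat \<Rightarrow> (nat \<Rightarrow> real \<times> real) \<Rightarrow> nat \<Rightarrow> nat \<Rightarrow> complex" where
  "pattern_estimator N n z = (\<lambda>k j.
     if k < N \<and> j < N then of_real (1 / real n) * (\<Sum>l<n. pattern_F k j (z l)) else 0)"

end

theory Submission
  imports Defs
begin

text \<open>Write \<open>E = 2j + 1\<close>, \<open>u = \<psi>\<^sub>j\<close>, \<open>v = \<phi>\<^sub>j\<close>. The estimator is unbiased on its block, so everything
  rests on a bound for \<open>\<Sum> f\<^bsub>k,j\<^esub>(x)\<^sup>2\<close> that is uniform in \<open>x\<close>. No asymptotics of Hermite functions is
  needed. For a solution \<open>w\<close> of the oscillator equation the energy \<open>w'\<^sup>2 + (E - x\<^sup>2) w\<^sup>2\<close> decreases on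
  \<open>x \<ge> 0\<close>, and its value at \<open>0\<close> is of order \<open>\<surd>E\<close> for both \<open>u\<close> and \<open>v\<close>. By the ladder relations
  \<open>2 \<Sum>\<^bsub>i\<le>j\<^esub> \<psi>\<^sub>i\<^sup>2 = u'\<^sup>2 + (E + 1 - x\<^sup>2) u\<^sup>2\<close>, with a similar formula for \<open>\<Sum> \<psi>\<^sub>i'\<^sup>2\<close>. For
  \<open>x\<^sup>2 \<le> E\<close> this bounds \<open>\<Sum>\<^bsub>k\<le>j\<^esub> f\<^bsub>k,j\<^esub>\<^sup>2\<close> by a multiple of \<open>E\<^bsup>5/4\<^esup>\<close>. For \<open>x\<^sup>2 \<ge> E\<close> the same formulas
  compare the sums with \<open>u\<^sup>2\<close> and \<open>u'\<^sup>2\<close>, and \<open>u v' - u' v = 2\<close> bounds \<open>u v'\<close> and \<open>u' v\<close> as soon as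
  \<open>v v' \<ge> 0\<close>; as long as \<open>v v' < 0\<close> all quantities decrease from their values at \<open>x = \<surd>E\<close>. Hence the
  variance of the estimator is \<open>O(N\<^bsup>9/4\<^esup> / n)\<close> in the squared Hilbert--Schmidt norm.

  For the trace norm, \<open>-M \<le> A \<le> M\<close> implies \<open>\<parallel>A\<parallel>\<^sub>1 \<le> Tr M\<close>. The error on the block satisfies
  \<open>\<plusminus>R \<le> (t + R\<^sup>2 / t) / 2\<close>, which costs a factor \<open>\<surd>N\<close> against the Hilbert--Schmidt norm, and the
  truncation error of \<open>\<rho>\<close> is treated in the same way.\<close>

subsection \<open>Functions of Gaussian growth\<close>

text \<open>The two hypotheses on N say N^(7/3) = o(n) and N^(10/3) = o(n). The energy argument
  yields 9/4 < 7/3, which leaves room for a crude treatment of the turning point; the trace norm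
  then needs 9/4 + 1 = 13/4 < 10/3. The energy of \<open>phi j\<close> at 0 is not computed: the
  Wronskian makes its product with the energy of \<open>psi j\<close> equal to 4 E, so a lower bound
  for the Hermite function is what bounds the second solution from above. Three notions cannot be
  evaluated directly and shape the rest. \<open>phi\<close> is a definite description: an explicit
  construction gives existence together with the growth bounds for later boundary terms, parity and
  the Wronskian give uniqueness. \<open>mat_abs\<close> is another one: the root is the limit of the
  absolute values of finite sections, which converge because the absolute value is nonexpansive in
  the Hilbert--Schmidt norm, and uniqueness must also exclude competitors not known in advance to be
  Hilbert--Schmidt. Finally the density is only an L1 limit of its partial sums, so unbiasedness
  needs bounded pattern functions.\<close>

definition growth :: "real \<Rightarrow> (real \<Rightarrow> real) \<Rightarrow> bool" where
  "growth c f \<longleftrightarrow> (\<exists>C n. \<forall>x. \<bar>f x\<bar> \<le> C * (1 + x\<^sup>2) ^ n * exp (c * x\<^sup>2))"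

lemma growthE:
  assumes "growth c f"
  obtains C n where "0 \<le> C" "\<And>x. \<bar>f x\<bar> \<le> C * (1 + x\<^sup>2) ^ n * exp (c * x\<^sup>2)"
proof -
  obtain C n where C: "\<And>x. \<bar>f x\<bar> \<le> C * (1 + x\<^sup>2) ^ n * exp (c * x\<^sup>2)"
    using assms unfolding growth_def by blast
  have "0 \<le> \<bar>f 0\<bar>" by simp
  also have "\<dots> \<le> C" using C[of 0] by simp
  finally show ?thesis using C that by blast
qed

text \<open>Exponents add and polynomial factors are absorbed. With -1/2 for \<open>psi\<close> and
  1/2 for \<open>phi\<close>, a pattern function gets exponent 0, and its product with two Hermite
  functions gets -1; a negative exponent settles integrability and boundary terms at once.\<close>

lemma growth_mult:
  assumes "growth c f" "growth d g"
  shows "growth (c + d) (\<lambda>x. f x * g x)"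
proof -
  obtain C n where C: "0 \<le> C" "\<And>x. \<bar>f x\<bar> \<le> C * (1 + x\<^sup>2) ^ n * exp (c * x\<^sup>2)"
    using growthE[OF assms(1)] by blast
  obtain D m where D: "0 \<le> D" "\<And>x. \<bar>g x\<bar> \<le> D * (1 + x\<^sup>2) ^ m * exp (d * x\<^sup>2)"
    using growthE[OF assms(2)] by blast
  have "\<bar>f x * g x\<bar> \<le> (C * D) * (1 + x\<^sup>2) ^ (n + m) * exp ((c + d) * x\<^sup>2)" for x
  proof -
    have "\<bar>f x * g x\<bar> \<le> (C * (1 + x\<^sup>2) ^ n * exp (c * x\<^sup>2)) * (D * (1 + x\<^sup>2) ^ m * exp (d * x\<^sup>2))"
      unfolding abs_mult using C D by (intro mult_mono) auto
    also have "\<dots> = (C * D) * (1 + x\<^sup>2) ^ (n + m) * exp ((c + d) * x\<^sup>2)"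
      by (simp add: power_add exp_add algebra_simps)
    finally show ?thesis .
  qed
  then show ?thesis unfolding growth_def by blast
qed

lemma growth_add:
  assumes "growth c f" "growth c g"
  shows "growth c (\<lambda>x. f x + g x)"
proof -
  obtain C n where C: "0 \<le> C" "\<And>x. \<bar>f x\<bar> \<le> C * (1 + x\<^sup>2) ^ n * exp (c * x\<^sup>2)"
    using growthE[OF assms(1)] by blast
  obtain D m where D: "0 \<le> D" "\<And>x. \<bar>g x\<bar> \<le> D * (1 + x\<^sup>2) ^ m * exp (c * x\<^sup>2)"
    using growthE[OF assms(2)] by blast
  have "\<bar>f x + g x\<bar> \<le> (C + D) * (1 + x\<^sup>2) ^ (n + m) * exp (c * x\<^sup>2)" for x
  proof -
    have "(1 + x\<^sup>2) ^ n \<le> (1 + x\<^sup>2) ^ (n + m)" "(1 + x\<^sup>2) ^ m \<le> (1 + x\<^sup>2) ^ (n + m)"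
      by (intro power_increasing; simp)+
    then have "C * (1 + x\<^sup>2) ^ n * exp (c * x\<^sup>2) \<le> C * (1 + x\<^sup>2) ^ (n + m) * exp (c * x\<^sup>2)"
      "D * (1 + x\<^sup>2) ^ m * exp (c * x\<^sup>2) \<le> D * (1 + x\<^sup>2) ^ (n + m) * exp (c * x\<^sup>2)"
      using C D by (intro mult_right_mono mult_left_mono; simp)+
    then show ?thesis using C(2)[of x] D(2)[of x] by (simp add: algebra_simps)
  qed
  then show ?thesis unfolding growth_def by blast
qed

lemma growth_const: "growth 0 (\<lambda>x. k)"
  unfolding growth_def by (intro exI[of _ "\<bar>k\<bar>"] exI[of _ 0]) simp

lemma growth_ident: "growth 0 (\<lambda>x. x)"
proof -
  have "\<bar>x\<bar> \<le> 1 * (1 + x\<^sup>2) ^ 1 * exp (0 * x\<^sup>2)" for x :: real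
  proof -
    have "0 \<le> (\<bar>x\<bar> - 1)\<^sup>2" by simp
    then have "2 * \<bar>x\<bar> \<le> 1 + x\<^sup>2" by (simp add: power2_eq_square algebra_simps)
    then show ?thesis using abs_ge_zero[of x] by simp
  qed
  then show ?thesis unfolding growth_def by blast
qed

lemma growth_cmult: "growth c f \<Longrightarrow> growth c (\<lambda>x. k * f x)"
  using growth_mult[OF growth_const, of c f k] by simp

lemma growth_xmult: "growth c f \<Longrightarrow> growth c (\<lambda>x. x * f x)"
  using growth_mult[OF growth_ident, of c f] by simp

lemma growth_diff: "growth c f \<Longrightarrow> growth c g \<Longrightarrow> growth c (\<lambda>x. f x - g x)"
  using growth_add[of c f "\<lambda>x. (-1) * g x"] growth_cmult[of c g "-1"] by simp

lemma growth_decay: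
  assumes "growth c f" "c < 0"
  obtains B where "\<And>x. \<bar>f x\<bar> \<le> B * inverse (1 + x\<^sup>2)"
proof -
  obtain C n where C: "0 \<le> C" "\<And>x. \<bar>f x\<bar> \<le> C * (1 + x\<^sup>2) ^ n * exp (c * x\<^sup>2)"
    using growthE[OF assms(1)] by blast
  \<comment> \<open>From y^(n+1) / (n+1)! <= exp y at y = -c (1 + x^2). Taking one power more than n
    leaves the integrable factor 1 / (1 + x^2); \<open>exp (- c)\<close> accounts for the 1 in
    y.\<close>
  define K where "K = fact (Suc n) * exp (- c) / (- c) ^ Suc n"
  have "\<bar>f x\<bar> \<le> (C * K) * inverse (1 + x\<^sup>2)" for x
  proof -
    have pos: "0 < 1 + x\<^sup>2" by (simp add: add_pos_nonneg)
    have "(- c * (1 + x\<^sup>2)) ^ Suc n / fact (Suc n) \<le> exp (- c * (1 + x\<^sup>2))"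
    proof -
      have z: "0 \<le> - c * (1 + x\<^sup>2)" using assms(2) pos by (intro mult_nonneg_nonneg) auto
      have "(\<Sum>i\<in>{Suc n}. (- c * (1 + x\<^sup>2)) ^ i /\<^sub>R fact i) \<le> exp (- c * (1 + x\<^sup>2))"
        unfolding exp_def using z
        by (intro sum_le_suminf summable_exp_generic) auto
      then show ?thesis by (simp add: divide_inverse_commute)
    qed
    then have "(- c) ^ Suc n * (1 + x\<^sup>2) ^ Suc n \<le> fact (Suc n) * exp (- c) * exp (- c * x\<^sup>2)"
      by (simp only: power_mult_distrib pos_divide_le_eq fact_gt_zero) (simp add: algebra_simps flip: exp_add)
    moreover have "0 < (- c) ^ Suc n" using assms(2) by (intro zero_less_power) simp
    ultimately have "(1 + x\<^sup>2) ^ Suc n \<le> K * exp (- c * x\<^sup>2)"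
      unfolding K_def times_divide_eq_left by (subst pos_le_divide_eq) (simp_all only: mult.commute)
    then have "(1 + x\<^sup>2) ^ Suc n * exp (c * x\<^sup>2) \<le> K * exp (- c * x\<^sup>2) * exp (c * x\<^sup>2)"
      by (intro mult_right_mono) auto
    then have "(1 + x\<^sup>2) ^ n * exp (c * x\<^sup>2) * (1 + x\<^sup>2) \<le> K"
      by (simp add: mult.assoc algebra_simps flip: exp_add)
    then have "(1 + x\<^sup>2) ^ n * exp (c * x\<^sup>2) \<le> K * inverse (1 + x\<^sup>2)"
      using pos by (simp add: field_simps)
    then have "C * ((1 + x\<^sup>2) ^ n * exp (c * x\<^sup>2)) \<le> C * (K * inverse (1 + x\<^sup>2))"
      using C(1) by (rule mult_left_mono)
    then show ?thesis using C(2)[of x] by (simp add: mult.assoc)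
  qed
  then show ?thesis using that by blast
qed

lemma integrable_inverse_1_plus_sq: "integrable lborel (\<lambda>x::real. inverse (1 + x\<^sup>2))"
  using integrable_inverse_1_plus_square
  by (simp add: set_integrable_def einterval_def)

lemma growth_tendsto_0:
  assumes "growth c f" "c < 0"
  shows "(f \<longlongrightarrow> 0) at_top" "(f \<longlongrightarrow> 0) at_bot"
proof -
  obtain B where B: "\<And>x. \<bar>f x\<bar> \<le> B * inverse (1 + x\<^sup>2)"
    using growth_decay[OF assms] by blast
  have "((\<lambda>x::real. B * inverse (1 + x\<^sup>2)) \<longlongrightarrow> B * 0) at_top"
    by (intro tendsto_intros tendsto_inverse_0_at_top filterlim_tendsto_add_at_top[OF tendsto_const]
        filterlim_pow_at_top filterlim_ident) auto
  then have "((\<lambda>x::real. B * inverse (1 + x\<^sup>2)) \<longlongrightarrow> 0) at_top" by simp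
  then show "(f \<longlongrightarrow> 0) at_top"
    by (rule Lim_null_comparison[rotated]) (use B in simp)
  have "((\<lambda>x::real. B * inverse (1 + x\<^sup>2)) \<longlongrightarrow> B * 0) at_bot"
    by (intro tendsto_intros tendsto_inverse_0_at_top filterlim_tendsto_add_at_top[OF tendsto_const]
        filterlim_pow_at_bot_even filterlim_ident) auto
  then have "((\<lambda>x::real. B * inverse (1 + x\<^sup>2)) \<longlongrightarrow> 0) at_bot" by simp
  then show "(f \<longlongrightarrow> 0) at_bot"
    by (rule Lim_null_comparison[rotated]) (use B in simp)
qed

lemma growth_integrable:
  assumes "growth c f" "c < 0" "continuous_on UNIV f"
  shows "integrable lborel f"
proof -
  obtain B where B: "\<And>x. \<bar>f x\<bar> \<le> B * inverse (1 + x\<^sup>2)"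
    using growth_decay[OF assms(1,2)] by blast
  show ?thesis
  proof (rule Bochner_Integration.integrable_bound)
    show "integrable lborel (\<lambda>x. B * inverse (1 + x\<^sup>2))"
      using integrable_inverse_1_plus_sq by simp
    show "f \<in> borel_measurable lborel"
      using assms(3) by (simp add: borel_measurable_continuous_onI)
    show "AE x in lborel. norm (f x) \<le> norm (B * inverse (1 + x\<^sup>2))"
      using B by (intro AE_I2) (metis abs_ge_self order_trans real_norm_def)
  qed
qed

text \<open>Takes the place of integration by parts: the norm recursion and the biorthogonality
  relations are each read off from a function that vanishes at both ends of the line.\<close>

lemma integral_deriv_eq_0:
  fixes F f :: "real \<Rightarrow> real"
  assumes D: "\<And>x. (F has_real_derivative f x) (at x)"
    and c: "continuous_on UNIV f" and i: "integrable lborel f"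
    and t: "(F \<longlongrightarrow> 0) at_top" "(F \<longlongrightarrow> 0) at_bot"
  shows "(LINT x|lborel. f x) = 0"
proof -
  have "(LBINT x=-\<infinity>..\<infinity>. f x) = 0 - 0"
  proof (rule interval_integral_FTC_integrable)
    show "set_integrable lborel (einterval (-\<infinity>) \<infinity>) f"
      using i by (simp add: set_integrable_def)
    show "((F \<circ> real_of_ereal) \<longlongrightarrow> 0) (at_right (-\<infinity>))"
      using t(2) by (simp add: ereal_tendsto_simps)
    show "((F \<circ> real_of_ereal) \<longlongrightarrow> 0) (at_left \<infinity>)"
      using t(1) by (simp add: ereal_tendsto_simps)
  qed (use D c in \<open>auto simp: has_real_derivative_iff_has_vector_derivative[symmetric]
      continuous_on_eq_continuous_at\<close>)
  then show ?thesis
    by (simp add: interval_lebesgue_integral_def set_lebesgue_integral_def)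
qed

subsection \<open>Hermite functions\<close>

definition herm :: "nat \<Rightarrow> real \<Rightarrow> real" where
  "herm k x = poly (hermite k) x * exp (- x\<^sup>2 / 2)"

lemma pderiv_hermite_Suc: "pderiv (hermite (Suc k)) = smult (2 * real (Suc k)) (hermite k)"
proof (induction k)
  case 0
  show ?case by (simp add: pderiv_mult pderiv_pCons one_pCons)
next
  case (Suc k)
  have "pderiv (hermite (Suc (Suc k))) =
      smult 2 (hermite (Suc k)) + [:0, 2:] * pderiv (hermite (Suc k)) - pderiv (pderiv (hermite (Suc k)))"
    unfolding hermite.simps(2)[of "Suc k"] pderiv_diff pderiv_mult
    by (simp add: pderiv_pCons del: hermite.simps)
  also have "pderiv (hermite (Suc k)) = smult (2 * real (Suc k)) (hermite k)" by (rule Suc)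
  also have "smult 2 (hermite (Suc k)) + [:0, 2:] * smult (2 * real (Suc k)) (hermite k)
      - pderiv (smult (2 * real (Suc k)) (hermite k))
      = smult 2 (hermite (Suc k)) + smult (2 * real (Suc k)) (hermite (Suc k))"
    unfolding hermite.simps(2)[of k] by (simp add: pderiv_smult smult_diff_right)
  also have "\<dots> = smult (2 * real (Suc (Suc k))) (hermite (Suc k))"
    unfolding smult_add_left[symmetric] by (rule arg_cong2[where f = smult]) simp_all
  finally show ?case .
qed

lemma herm_deriv: "(herm k has_real_derivative x * herm k x - herm (Suc k) x) (at x)"
  unfolding herm_def[abs_def]
  by (auto intro!: derivative_eq_intros simp: algebra_simps)

lemma herm_deriv_Suc:
  "(herm (Suc k) has_real_derivative 2 * real (Suc k) * herm k x - x * herm (Suc k) x) (at x)"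
  unfolding herm_def[abs_def] using pderiv_hermite_Suc[of k]
  by (auto intro!: derivative_eq_intros simp: algebra_simps simp del: hermite.simps)

lemma herm_rec: "herm (Suc (Suc k)) x = 2 * x * herm (Suc k) x - 2 * real (Suc k) * herm k x"
  using DERIV_unique[OF herm_deriv[of "Suc k" x] herm_deriv_Suc[of k x]] by simp

lemma herm_continuous: "continuous_on S (herm k)"
  by (rule DERIV_continuous_on) (rule has_field_derivative_at_within[OF herm_deriv])

lemma herm_growth: "growth (- 1 / 2) (herm k)"
proof (induction k rule: less_induct)
  case (less k)
  have g0: "growth (- 1 / 2) (herm 0)"
    unfolding growth_def herm_def by (intro exI[of _ 1] exI[of _ 0]) simp
  consider "k = 0" | "k = 1" | j where "k = Suc (Suc j)"
    by (metis One_nat_def not0_implies_Suc)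
  then show ?case
  proof cases
    case 2
    have "herm k = (\<lambda>x. 2 * (x * herm 0 x))"
      by (rule ext) (simp add: 2 herm_def one_pCons pderiv_1)
    then show ?thesis using growth_cmult[OF growth_xmult[OF g0]] by simp
  next
    case (3 j)
    have "herm k = (\<lambda>x. 2 * (x * herm (Suc j) x) - (2 * real (Suc j)) * herm j x)"
      by (rule ext) (simp add: 3 herm_rec)
    then show ?thesis
      using growth_diff[OF growth_cmult[OF growth_xmult[OF less[of "Suc j"]]] growth_cmult[OF less[of j]]] 3
      by simp
  qed (use g0 in simp)
qed

text \<open>By the two forms of the derivative, \<open>herm k x * herm (Suc k) x\<close> is an
  antiderivative of \<open>2 * real (Suc k) * (herm k x)\<^sup>2 - (herm (Suc k) x)\<^sup>2\<close>;
  hence each step multiplies the square norm by 2 (k + 1).\<close>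

lemma herm_norm: "(LINT x|lborel. (herm k x)\<^sup>2) = sqrt pi * 2 ^ k * fact k"
proof (induction k)
  case 0
  have "has_bochner_integral lborel (\<lambda>x. exp (- x\<^sup>2)) (sqrt pi / 2 + sqrt pi / 2)"
    using has_bochner_integral_even_function[OF gaussian_moment_0] by simp
  then have "(LINT x|lborel. exp (- x\<^sup>2)) = sqrt pi"
    using has_bochner_integral_integral_eq by fastforce
  moreover have "(herm 0 x)\<^sup>2 = exp (- x\<^sup>2)" for x
    by (simp add: herm_def power2_eq_square flip: exp_add)
  ultimately show ?case by simp
next
  case (Suc k)
  have g: "growth (- 1 / 2 + - 1 / 2) (\<lambda>x. herm i x * herm j x)" for i j
    by (rule growth_mult[OF herm_growth herm_growth])
  have int: "integrable lborel (\<lambda>x. herm i x * herm j x)" for i j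
    by (rule growth_integrable[OF g]) (auto intro!: continuous_intros herm_continuous)
  have "(LINT x|lborel. 2 * real (Suc k) * (herm k x * herm k x) - herm (Suc k) x * herm (Suc k) x) = 0"
  proof (rule integral_deriv_eq_0[where F = "\<lambda>x. herm k x * herm (Suc k) x"])
    show "((\<lambda>x. herm k x * herm (Suc k) x) has_real_derivative
        2 * real (Suc k) * (herm k x * herm k x) - herm (Suc k) x * herm (Suc k) x) (at x)" for x
      by (rule derivative_eq_intros herm_deriv herm_deriv_Suc refl)+ (simp add: algebra_simps)
    show "continuous_on UNIV (\<lambda>x. 2 * real (Suc k) * (herm k x * herm k x) - herm (Suc k) x * herm (Suc k) x)"
      by (intro continuous_intros herm_continuous)
  qed (use int growth_tendsto_0[OF g] in auto)
  then have "(LINT x|lborel. herm (Suc k) x * herm (Suc k) x) = 2 * real (Suc k) * (LINT x|lborel. herm k x * herm k x)"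
    using int by (subst (asm) Bochner_Integration.integral_diff) auto
  then show ?case using Suc by (simp add: power2_eq_square)
qed

lemma psi_eq: "psi k x = herm k x / sqrt (sqrt pi * 2 ^ k * fact k)"
  unfolding psi_def herm_norm[symmetric] by (simp add: herm_def)

definition ladder :: "nat \<Rightarrow> real" where "ladder k = sqrt (2 * real (Suc k))"

lemma ladder_pos: "0 < ladder k" by (simp add: ladder_def)

lemma ladder_sq: "ladder k * ladder k = 2 * real k + 2" by (simp add: ladder_def)

lemma herm_norm_Suc: "sqrt (sqrt pi * 2 ^ Suc k * fact (Suc k)) = ladder k * sqrt (sqrt pi * 2 ^ k * fact k)"
  unfolding ladder_def by (simp only: fact_Suc power_Suc flip: real_sqrt_mult) (simp add: algebra_simps)

text \<open>The derivative in its raising form; \<open>dpsi_Suc\<close> is the lowering form.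
  Together they map the pair (\<open>psi\<close>, \<open>dpsi\<close>) at k linearly to the pair at
  k + 1, which turns the induction steps for the sums below into polynomial identities.\<close>

definition dpsi :: "nat \<Rightarrow> real \<Rightarrow> real" where
  "dpsi k x = x * psi k x - ladder k * psi (Suc k) x"

lemma psi_deriv: "(psi k has_real_derivative dpsi k x) (at x)"
proof -
  have "((\<lambda>x. herm k x / sqrt (sqrt pi * 2 ^ k * fact k)) has_real_derivative
      (x * herm k x - herm (Suc k) x) / sqrt (sqrt pi * 2 ^ k * fact k)) (at x)"
    by (rule DERIV_cdivide[OF herm_deriv])
  moreover have "(x * herm k x - herm (Suc k) x) / sqrt (sqrt pi * 2 ^ k * fact k) = dpsi k x"
    unfolding dpsi_def psi_eq herm_norm_Suc using ladder_pos[of k] by (simp add: field_simps)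
  ultimately show ?thesis by (simp add: psi_eq[abs_def])
qed

lemma dpsi_Suc: "dpsi (Suc k) x = ladder k * psi k x - x * psi (Suc k) x"
proof -
  have "(psi (Suc k) has_real_derivative (2 * real (Suc k) * herm k x - x * herm (Suc k) x)
      / sqrt (sqrt pi * 2 ^ Suc k * fact (Suc k))) (at x)"
    unfolding psi_eq[abs_def] by (rule DERIV_cdivide[OF herm_deriv_Suc])
  from DERIV_unique[OF this psi_deriv] have "dpsi (Suc k) x = (ladder k * ladder k * herm k x - x * herm (Suc k) x)
      / (ladder k * sqrt (sqrt pi * 2 ^ k * fact k))"
    unfolding herm_norm_Suc ladder_sq by (simp add: algebra_simps)
  also have "\<dots> = ladder k * psi k x - x * psi (Suc k) x"
    unfolding psi_eq herm_norm_Suc using ladder_pos[of k] by (simp add: field_simps)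
  finally show ?thesis .
qed

lemma dpsi_0: "dpsi 0 x = - x * psi 0 x"
proof -
  have "ladder 0 * psi (Suc 0) x = 2 * x * psi 0 x"
  proof -
    have "herm (Suc 0) x = 2 * x * herm 0 x" by (simp add: herm_def one_pCons)
    then show ?thesis unfolding psi_eq herm_norm_Suc using ladder_pos[of 0] by (simp add: field_simps)
  qed
  then show ?thesis by (simp add: dpsi_def)
qed

lemma dpsi_deriv: "(dpsi k has_real_derivative (x\<^sup>2 - (2 * real k + 1)) * psi k x) (at x)"
proof -
  have "((\<lambda>x. x * psi k x - ladder k * psi (Suc k) x) has_real_derivative
     psi k x + x * dpsi k x - ladder k * dpsi (Suc k) x) (at x)"
    by (rule derivative_eq_intros psi_deriv refl)+ (simp add: algebra_simps)
  moreover have "psi k x + x * dpsi k x - ladder k * dpsi (Suc k) x = (x\<^sup>2 - (2 * real k + 1)) * psi k x"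
  proof -
    have "psi k x + x * dpsi k x - ladder k * dpsi (Suc k) x = psi k x + x\<^sup>2 * psi k x - (ladder k * ladder k) * psi k x"
      unfolding dpsi_Suc dpsi_def[of k] by (simp add: algebra_simps power2_eq_square)
    then show ?thesis unfolding ladder_sq by (simp add: algebra_simps)
  qed
  ultimately show ?thesis by (simp add: dpsi_def[abs_def])
qed

lemma psi_continuous: "continuous_on S (psi k)"
  by (rule DERIV_continuous_on) (rule has_field_derivative_at_within[OF psi_deriv])

lemma dpsi_continuous: "continuous_on S (dpsi k)"
  by (rule DERIV_continuous_on) (rule has_field_derivative_at_within[OF dpsi_deriv])

lemma psi_growth: "growth (- 1 / 2) (psi k)"
proof -
  have "psi k = (\<lambda>x. inverse (sqrt (sqrt pi * 2 ^ k * fact k)) * herm k x)"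
    by (rule ext) (simp only: psi_eq divide_inverse mult.commute)
  then show ?thesis using growth_cmult[OF herm_growth] by metis
qed

lemma dpsi_growth: "growth (- 1 / 2) (dpsi k)"
  unfolding dpsi_def[abs_def] by (intro growth_diff growth_xmult growth_cmult psi_growth)

lemma psi_minus: "psi k (- x) = (- 1) ^ k * psi k x"
proof (induction k arbitrary: x rule: less_induct)
  case (less k)
  consider "k = 0" | j where "k = Suc j" using not0_implies_Suc by blast
  then show ?case
  proof cases
    case 1
    then show ?thesis by (simp add: psi_eq herm_def)
  next
    case (2 j)
    have "((\<lambda>x. psi j (- x)) has_real_derivative dpsi j (- x) * (- 1)) (at x)"
      by (rule DERIV_chain2[OF psi_deriv]) (auto intro!: derivative_eq_intros)
    moreover have "(\<lambda>x. psi j (- x)) = (\<lambda>x. (- 1) ^ j * psi j x)" using less 2 by auto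
    moreover have "((\<lambda>x. (- 1) ^ j * psi j x) has_real_derivative (- 1) ^ j * dpsi j x) (at x)"
      by (rule DERIV_cmult[OF psi_deriv])
    ultimately have "dpsi j (- x) * (- 1) = (- 1) ^ j * dpsi j x"
      using DERIV_unique by metis
    then have "ladder j * psi (Suc j) (- x) = ladder j * ((- 1) ^ Suc j * psi (Suc j) x)"
      using less[of j x] 2 unfolding dpsi_def by (simp add: algebra_simps)
    then have "psi (Suc j) (- x) = (- 1) ^ Suc j * psi (Suc j) x"
      using ladder_pos[of j] by (metis less_irrefl mult_left_cancel)
    then show ?thesis using 2 by simp
  qed
qed

lemma dpsi_minus: "dpsi k (- x) = (- 1) ^ Suc k * dpsi k x"
  unfolding dpsi_def psi_minus by (simp add: algebra_simps)

lemma psi_integral_sq: "(LINT x|lborel. (psi k x)\<^sup>2) = 1"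
  unfolding psi_eq power_divide using herm_norm[of k] by simp

text \<open>The Christoffel-Darboux kernel on the diagonal. Once the ladder relations have removed
  \<open>dpsi\<close>, the induction step is an identity between quadratic forms in
  \<open>psi k x\<close> and \<open>psi (Suc k) x\<close>.\<close>

lemma sum_psi_sq:
  "2 * (\<Sum>i\<le>k. (psi i x)\<^sup>2) = (2 * real k + 2 - x\<^sup>2) * (psi k x)\<^sup>2 + (dpsi k x)\<^sup>2"
proof (induction k)
  case 0
  show ?case by (simp add: dpsi_0 power2_eq_square algebra_simps)
next
  case (Suc k)
  have "2 * (\<Sum>i\<le>Suc k. (psi i x)\<^sup>2)
      = (ladder k * ladder k - x\<^sup>2) * (psi k x)\<^sup>2 + (x * psi k x - ladder k * psi (Suc k) x)\<^sup>2 + 2 * (psi (Suc k) x)\<^sup>2"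
    using Suc unfolding ladder_sq dpsi_def by simp
  also have "\<dots> = (ladder k * ladder k + 2 - x\<^sup>2) * (psi (Suc k) x)\<^sup>2 + (ladder k * psi k x - x * psi (Suc k) x)\<^sup>2"
    by (simp add: power2_eq_square algebra_simps)
  finally show ?case unfolding ladder_sq dpsi_Suc by (simp add: algebra_simps)
qed

text \<open>This is \<open>sum_psi_sq\<close> differentiated twice, since by the oscillator equation
  the second derivative of psi_i^2 is 2 psi_i'^2 - 2 (2 i + 1 - x^2) psi_i^2. The weighted sum stays
  on the right because it is easy to bound: through E - x^2 inside the turning point, and by 0
  outside.\<close>

lemma sum_dpsi_sq:
  "2 * (\<Sum>i\<le>k. (dpsi i x)\<^sup>2) = (dpsi k x)\<^sup>2 - 2 * x * psi k x * dpsi k x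
     + (x\<^sup>2 - (2 * real k + 2)) * (psi k x)\<^sup>2 + 2 * (\<Sum>i\<le>k. (2 * real i + 1 - x\<^sup>2) * (psi i x)\<^sup>2)"
proof (induction k)
  case 0
  show ?case by (simp add: dpsi_0 power2_eq_square algebra_simps)
next
  case (Suc k)
  let ?S = "2 * (\<Sum>i\<le>k. (2 * real i + 1 - x\<^sup>2) * (psi i x)\<^sup>2)"
  have "2 * (\<Sum>i\<le>Suc k. (dpsi i x)\<^sup>2) = (x * psi k x - ladder k * psi (Suc k) x)\<^sup>2
      - 2 * x * psi k x * (x * psi k x - ladder k * psi (Suc k) x)
      + (x\<^sup>2 - ladder k * ladder k) * (psi k x)\<^sup>2 + ?S + 2 * (ladder k * psi k x - x * psi (Suc k) x)\<^sup>2"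
    using Suc unfolding ladder_sq dpsi_def[of k, symmetric] dpsi_Suc[symmetric] by simp
  also have "\<dots> = (ladder k * psi k x - x * psi (Suc k) x)\<^sup>2
      - 2 * x * psi (Suc k) x * (ladder k * psi k x - x * psi (Suc k) x)
      + (x\<^sup>2 - (ladder k * ladder k + 2)) * (psi (Suc k) x)\<^sup>2 + ?S
      + 2 * (ladder k * ladder k + 1 - x\<^sup>2) * (psi (Suc k) x)\<^sup>2"
    by (simp add: power2_eq_square algebra_simps)
  finally show ?case unfolding ladder_sq dpsi_Suc by (simp add: algebra_simps)
qed

subsection \<open>The energy of a solution\<close>

definition oscillator :: "real \<Rightarrow> (real \<Rightarrow> real) \<Rightarrow> (real \<Rightarrow> real) \<Rightarrow> bool" where
  "oscillator E u v \<longleftrightarrow> (\<forall>x. (u has_real_derivative v x) (at x)) \<and>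
     (\<forall>x. (v has_real_derivative (x\<^sup>2 - E) * u x) (at x))"

lemma oscillatorD:
  assumes "oscillator E u v"
  shows "(u has_real_derivative v x) (at x)" "(v has_real_derivative (x\<^sup>2 - E) * u x) (at x)"
  using assms unfolding oscillator_def by auto

lemma oscillator_psi: "oscillator (2 * real k + 1) (psi k) (dpsi k)"
  unfolding oscillator_def using psi_deriv dpsi_deriv by auto

lemma energy_le:
  assumes o: "oscillator E u v" and xy: "0 \<le> x" "x \<le> y"
  shows "(v y)\<^sup>2 + (E - y\<^sup>2) * (u y)\<^sup>2 \<le> (v x)\<^sup>2 + (E - x\<^sup>2) * (u x)\<^sup>2"
proof (rule DERIV_nonpos_imp_nonincreasing[OF xy(2)])
  fix z assume z: "x \<le> z" "z \<le> y"
  have "((\<lambda>z. (v z)\<^sup>2 + (E - z\<^sup>2) * (u z)\<^sup>2) has_real_derivative - (2 * z * (u z)\<^sup>2)) (at z)"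
    by (rule derivative_eq_intros oscillatorD[OF o] refl)+ (simp add: power2_eq_square algebra_simps)
  moreover have "- (2 * z * (u z)\<^sup>2) \<le> 0" using z xy by simp
  ultimately show "\<exists>D. ((\<lambda>z. (v z)\<^sup>2 + (E - z\<^sup>2) * (u z)\<^sup>2) has_real_derivative D) (at z) \<and> D \<le> 0"
    by blast
qed

lemma oscillator_reflect:
  assumes "oscillator E u v"
  shows "oscillator E (\<lambda>x. u (- x)) (\<lambda>x. - v (- x))"
  unfolding oscillator_def
proof (intro conjI allI)
  fix x
  have m: "((\<lambda>x. - x) has_real_derivative - 1) (at x)" by (auto intro!: derivative_eq_intros)
  show "((\<lambda>x. u (- x)) has_real_derivative - v (- x)) (at x)"
    using DERIV_chain2[OF oscillatorD(1)[OF assms] m] by simp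
  have "((\<lambda>x. v (- x)) has_real_derivative ((- x)\<^sup>2 - E) * u (- x) * (- 1)) (at x)"
    by (rule DERIV_chain2[OF oscillatorD(2)[OF assms] m])
  then show "((\<lambda>x. - v (- x)) has_real_derivative (x\<^sup>2 - E) * u (- x)) (at x)"
    using DERIV_minus by fastforce
qed

text \<open>Gronwall's argument: M bounds 1 + z^2 - E in absolute value on [0, x], so q' = 2 u v (1
  + z^2 - E) is at most M q, and q exp (- M z) cannot rise above its initial value 0.\<close>

lemma oscillator_zero_aux:
  assumes o: "oscillator E u v" and "u 0 = 0" "v 0 = 0" and x: "0 \<le> x"
  shows "u x = 0"
proof -
  define M where "M = 1 + x\<^sup>2 + \<bar>E\<bar>"
  define q where "q = (\<lambda>z. (u z)\<^sup>2 + (v z)\<^sup>2)"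
  have "q x * exp (- M * x) \<le> q 0 * exp (- M * 0)"
  proof (rule DERIV_nonpos_imp_nonincreasing[OF x])
    fix z assume z: "0 \<le> z" "z \<le> x"
    let ?D = "(2 * u z * v z * (1 + z\<^sup>2 - E) - M * q z) * exp (- M * z)"
    have "((\<lambda>z. q z * exp (- M * z)) has_real_derivative ?D) (at z)"
      unfolding q_def
      by (rule derivative_eq_intros oscillatorD[OF o] refl)+ (simp add: power2_eq_square algebra_simps)
    moreover have "?D \<le> 0"
    proof -
      have "z\<^sup>2 \<le> x\<^sup>2" using z by (intro power_mono) auto
      then have b: "\<bar>1 + z\<^sup>2 - E\<bar> \<le> M" unfolding M_def by (intro abs_leI) (use abs_ge_self[of E] abs_ge_minus_self[of E] zero_le_power2[of x] zero_le_power2[of z] in linarith)+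
      have "2 * \<bar>u z\<bar> * \<bar>v z\<bar> \<le> q z"
        unfolding q_def using sum_squares_bound[of "\<bar>u z\<bar>" "\<bar>v z\<bar>"] by simp
      then have "2 * \<bar>u z\<bar> * \<bar>v z\<bar> * \<bar>1 + z\<^sup>2 - E\<bar> \<le> q z * M"
        using b by (intro mult_mono) (auto simp: q_def)
      moreover have "2 * u z * v z * (1 + z\<^sup>2 - E) \<le> 2 * \<bar>u z\<bar> * \<bar>v z\<bar> * \<bar>1 + z\<^sup>2 - E\<bar>"
        using abs_ge_self[of "2 * u z * v z * (1 + z\<^sup>2 - E)"] by (simp add: abs_mult)
      ultimately have "2 * u z * v z * (1 + z\<^sup>2 - E) - M * q z \<le> 0"
        unfolding mult.commute[of M] by linarith
      then show ?thesis by (rule mult_nonpos_nonneg) simp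
    qed
    ultimately show "\<exists>D. ((\<lambda>z. q z * exp (- M * z)) has_real_derivative D) (at z) \<and> D \<le> 0" by blast
  qed
  also have "\<dots> = 0" using assms by (simp add: q_def)
  finally have "q x \<le> 0" by (simp add: mult_le_0_iff)
  then show ?thesis unfolding q_def by (simp add: sum_power2_le_zero_iff)
qed

lemma oscillator_zero:
  assumes o: "oscillator E u v" and "u 0 = 0" "v 0 = 0"
  shows "u x = 0"
proof (cases "0 \<le> x")
  case True
  then show ?thesis using oscillator_zero_aux assms by blast
next
  case False
  then show ?thesis using oscillator_zero_aux[OF oscillator_reflect[OF o], of "- x"] assms by simp
qed

subsection \<open>Values at the origin\<close>

lemma psi_two_step: "(2 * real k + 4) * (psi (Suc (Suc k)) 0)\<^sup>2 = (2 * real k + 2) * (psi k 0)\<^sup>2"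
proof -
  have "- (ladder (Suc k) * psi (Suc (Suc k)) 0) = ladder k * psi k 0"
    using dpsi_Suc[of k 0] dpsi_def[of "Suc k" 0] by simp
  then have "(ladder (Suc k) * psi (Suc (Suc k)) 0)\<^sup>2 = (ladder k * psi k 0)\<^sup>2" by (metis power2_minus)
  then show ?thesis
    by (simp add: power_mult_distrib power2_eq_square[of "ladder _"] ladder_sq add.commute)
qed

text \<open>An elementary substitute for the Wallis asymptotics. By the two-step recursion, c_m^2 (4
  m + 1) is nondecreasing and c_m^2 (2 m + 1) is nonincreasing, and both equal 1 / pi at m =
  0.\<close>

lemma psi_even_0:
  defines "c \<equiv> \<lambda>m. (psi (2 * m) 0)\<^sup>2"
  shows "1 / pi \<le> (c m)\<^sup>2 * (4 * real m + 1)" "(c m)\<^sup>2 * (2 * real m + 1) \<le> 1 / pi"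
proof -
  have c0: "(c 0)\<^sup>2 = 1 / pi"
    by (simp add: c_def psi_eq herm_def power_divide)
  have step: "c (Suc m) * (2 * real m + 2) = (2 * real m + 1) * c m" for m
    using psi_two_step[of "2 * m"] unfolding c_def by (simp add: algebra_simps)
  have sq: "(c (Suc m))\<^sup>2 * (2 * real m + 2)\<^sup>2 = (2 * real m + 1)\<^sup>2 * (c m)\<^sup>2" for m
    using arg_cong[OF step, of "\<lambda>t. t\<^sup>2"] by (simp only: power_mult_distrib)
  have "1 / pi \<le> (c m)\<^sup>2 * (4 * real m + 1) \<and> (c m)\<^sup>2 * (2 * real m + 1) \<le> 1 / pi"
  proof (induction m)
    case 0
    show ?case by (simp add: c0)
  next
    case (Suc m)
    let ?p = "(2 * real m + 2)\<^sup>2"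
    have p: "0 < ?p" by simp
    have "(c m)\<^sup>2 * (4 * real m + 1) * ?p \<le> (c m)\<^sup>2 * ((2 * real m + 1)\<^sup>2 * (4 * real (Suc m) + 1))"
      unfolding mult.assoc by (intro mult_left_mono) (simp_all add: power2_eq_square algebra_simps)
    also have "\<dots> = ((2 * real m + 1)\<^sup>2 * (c m)\<^sup>2) * (4 * real (Suc m) + 1)"
      by (simp only: mult_ac)
    also have "\<dots> = (c (Suc m))\<^sup>2 * (4 * real (Suc m) + 1) * ?p"
      unfolding sq[symmetric] by (simp only: mult_ac)
    finally have a: "(c m)\<^sup>2 * (4 * real m + 1) \<le> (c (Suc m))\<^sup>2 * (4 * real (Suc m) + 1)"
      using p by (simp only: mult_le_cancel_right_pos)
    have "(c (Suc m))\<^sup>2 * (2 * real (Suc m) + 1) * ?p = ((c (Suc m))\<^sup>2 * ?p) * (2 * real (Suc m) + 1)"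
      by (simp only: mult_ac)
    also have "\<dots> = (c m)\<^sup>2 * ((2 * real m + 1)\<^sup>2 * (2 * real (Suc m) + 1))"
      unfolding sq by (simp only: mult_ac)
    also have "\<dots> \<le> (c m)\<^sup>2 * (2 * real m + 1) * ?p"
      unfolding mult.assoc by (intro mult_left_mono) (simp_all add: power2_eq_square algebra_simps)
    finally have b: "(c (Suc m))\<^sup>2 * (2 * real (Suc m) + 1) \<le> (c m)\<^sup>2 * (2 * real m + 1)"
      using p by (simp only: mult_le_cancel_right_pos)
    show ?case using a b Suc by linarith
  qed
  then show "1 / pi \<le> (c m)\<^sup>2 * (4 * real m + 1)" "(c m)\<^sup>2 * (2 * real m + 1) \<le> 1 / pi" by auto
qed

lemma psi_odd_0: "odd k \<Longrightarrow> psi k 0 = 0"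
  using psi_minus[of k 0] by simp

lemma dpsi_even_0: "even k \<Longrightarrow> dpsi k 0 = 0"
  using dpsi_minus[of k 0] by simp

text \<open>At 0 parity leaves a single term: E psi_j(0)^2 for even j, while for odd j the lowering
  relation turns psi_j'(0)^2 into 2 j psi_(j-1)(0)^2. The lower bound serves
  \<open>phi_energy_le\<close>, where 1/9 enters through its root 1/3.\<close>

lemma psi_energy_0:
  defines "h \<equiv> \<lambda>j. (dpsi j 0)\<^sup>2 + (2 * real j + 1) * (psi j 0)\<^sup>2"
  shows "(2 * real j + 1) / 9 \<le> (h j)\<^sup>2" "(h j)\<^sup>2 \<le> 2 * real j + 1"
proof -
  have pi4: "pi \<le> 4" and pi2: "2 \<le> pi" using pi_less_4 pi_ge_two by simp_all
  have "(2 * real j + 1) / 9 \<le> (h j)\<^sup>2 \<and> (h j)\<^sup>2 \<le> 2 * real j + 1"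
  proof (cases "even j")
    case True
    then obtain m where m: "j = 2 * m" by blast
    define C where "C = ((psi (2 * m) 0)\<^sup>2)\<^sup>2"
    have C: "1 / pi \<le> C * (4 * real m + 1)" "C * (2 * real m + 1) \<le> 1 / pi"
      using psi_even_0[of m] unfolding C_def by auto
    have h: "(h j)\<^sup>2 = (4 * real m + 1)\<^sup>2 * C"
      unfolding h_def C_def using True m by (simp add: dpsi_even_0 power_mult_distrib)
    have "1 / 9 \<le> 1 / pi" using pi4 by (intro divide_left_mono) auto
    then have "1 / 9 \<le> C * (4 * real m + 1)" using C by linarith
    then have "(4 * real m + 1) * (1 / 9) \<le> (4 * real m + 1) * (C * (4 * real m + 1))"
      by (intro mult_left_mono) auto
    moreover have "(4 * real m + 1) * (C * (4 * real m + 1)) \<le> (4 * real m + 1) * 1"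
    proof (rule mult_left_mono)
      have "0 \<le> C" by (simp add: C_def)
      then have "C * (4 * real m + 1) \<le> 2 * (C * (2 * real m + 1))" by (simp add: algebra_simps)
      also have "\<dots> \<le> 2 * (1 / pi)" using C by simp
      also have "\<dots> \<le> 1" using pi2 by simp
      finally show "C * (4 * real m + 1) \<le> 1" .
    qed simp
    ultimately show ?thesis unfolding h using m by (simp add: power2_eq_square algebra_simps)
  next
    case False
    then obtain m where m: "j = 2 * m + 1" by (elim oddE)
    define C where "C = ((psi (2 * m) 0)\<^sup>2)\<^sup>2"
    have C: "1 / pi \<le> C * (4 * real m + 1)" "C * (2 * real m + 1) \<le> 1 / pi"
      using psi_even_0[of m] unfolding C_def by auto
    have "dpsi j 0 = ladder (2 * m) * psi (2 * m) 0" using dpsi_Suc[of "2 * m" 0] m by simp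
    then have "h j = (4 * real m + 2) * (psi (2 * m) 0)\<^sup>2"
      unfolding h_def using psi_odd_0[OF False]
      by (simp add: power_mult_distrib power2_eq_square[of "ladder _"] ladder_sq)
    then have h: "(h j)\<^sup>2 = (4 * real m + 2)\<^sup>2 * C" unfolding C_def by (simp add: power_mult_distrib)
    have "1 / 4 \<le> 1 / pi" using pi4 by (intro divide_left_mono) auto
    then have c4: "1 / 4 \<le> C * (4 * real m + 1)" using C by linarith
    have "(4 * real m + 3) / 9 * (4 * real m + 1) \<le> (4 * real m + 2)\<^sup>2 * (1 / 4)"
      by (simp add: power2_eq_square field_simps)
    also have "\<dots> \<le> (4 * real m + 2)\<^sup>2 * (C * (4 * real m + 1))"
      using c4 by (intro mult_left_mono) auto
    also have "\<dots> = (4 * real m + 2)\<^sup>2 * C * (4 * real m + 1)" by simp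
    finally have l: "(4 * real m + 3) / 9 \<le> (4 * real m + 2)\<^sup>2 * C"
      by (subst (asm) mult_le_cancel_right_pos) auto
    have "(4 * real m + 2)\<^sup>2 * C = 4 * (2 * real m + 1) * (C * (2 * real m + 1))"
      by (simp add: power2_eq_square algebra_simps)
    also have "\<dots> \<le> 4 * (2 * real m + 1) * (1 / pi)" using C by (intro mult_left_mono) auto
    also have "\<dots> \<le> 4 * (2 * real m + 1) * (1 / 2)" using pi2 by (intro mult_left_mono divide_left_mono) auto
    also have "\<dots> \<le> 4 * real m + 3" by simp
    finally show ?thesis unfolding h using l m by simp
  qed
  then show "(2 * real j + 1) / 9 \<le> (h j)\<^sup>2" "(h j)\<^sup>2 \<le> 2 * real j + 1" by auto
qed

subsection \<open>The second solution\<close>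

text \<open>The constructive counterpart of \<open>second_solution\<close>: the derivative is
  explicit, and the growth bounds travel through the induction because boundary terms need them
  later. Unboundedness is recovered from the Wronskian in
  \<open>wronskian_2_unbounded\<close>.\<close>

definition phi_sol :: "nat \<Rightarrow> (real \<Rightarrow> real) \<Rightarrow> (real \<Rightarrow> real) \<Rightarrow> bool" where
  "phi_sol j u v \<longleftrightarrow> oscillator (2 * real j + 1) u v \<and> (\<forall>x. u (- x) = (- 1) ^ Suc j * u x) \<and>
     (\<forall>x. psi j x * v x - dpsi j x * u x = 2) \<and> growth (1 / 2) u \<and> growth (1 / 2) v"

lemma oscillator_parity:
  assumes o: "oscillator E u v" and p: "\<forall>x. u (- x) = (- 1) ^ k * u x"
  shows "v (- x) = (- 1) ^ Suc k * v x"
proof -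
  have "((\<lambda>x. (- 1) ^ k * u x) has_real_derivative (- 1) ^ k * v x) (at x)"
    by (rule DERIV_cmult[OF oscillatorD(1)[OF o]])
  moreover have "(\<lambda>x. u (- x)) = (\<lambda>x. (- 1) ^ k * u x)" using p by auto
  ultimately have "- v (- x) = (- 1) ^ k * v x"
    using oscillatorD(1)[OF oscillator_reflect[OF o], of x] DERIV_unique by metis
  then show ?thesis by simp
qed

lemma exp_sq_antiderivative:
  obtains G :: "real \<Rightarrow> real" where "\<And>x. (G has_real_derivative exp (x\<^sup>2)) (at x)"
    "\<And>x. G (- x) = - G x" "growth 1 G"
proof -
  have "\<exists>F. \<forall>x::real. (-\<infinity>::ereal) < x \<longrightarrow> x < \<infinity> \<longrightarrow> (F has_vector_derivative exp (x\<^sup>2)) (at x)"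
    by (rule einterval_antiderivative) auto
  then obtain F where F: "\<And>x::real. (F has_real_derivative exp (x\<^sup>2)) (at x)"
    by (auto simp: has_real_derivative_iff_has_vector_derivative)
  \<comment> \<open>The antiderivative F comes with an unknown constant; antisymmetrising singles
    out the integral from 0, which is odd.\<close>
  define G where "G = (\<lambda>x. (F x - F (- x)) / 2)"
  have m: "((\<lambda>x. - x) has_real_derivative - 1) (at x)" for x :: real
    by (auto intro!: derivative_eq_intros)
  have D: "(G has_real_derivative exp (x\<^sup>2)) (at x)" for x
    using DERIV_cdivide[where c = 2, OF DERIV_diff[OF F DERIV_chain2[OF F m]], of x] unfolding G_def by simp
  have odd: "G (- x) = - G x" for x unfolding G_def by (simp add: field_simps)
  have pos: "\<bar>G x\<bar> \<le> x * exp (x\<^sup>2)" if x0: "0 < x" for x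
  proof -
    obtain z where z: "0 < z" "z < x" "G x - G 0 = (x - 0) * exp (z\<^sup>2)"
      using MVT2[OF x0, of G "\<lambda>x. exp (x\<^sup>2)"] D by blast
    have "G 0 = 0" using odd[of 0] by simp
    then have "\<bar>G x\<bar> = x * exp (z\<^sup>2)" using z x0 by (simp add: abs_mult)
    also have "\<dots> \<le> x * exp (x\<^sup>2)" using z x0 by (intro mult_left_mono) (auto intro!: power_mono)
    finally show ?thesis .
  qed
  have b: "\<bar>G x\<bar> \<le> \<bar>x\<bar> * exp (x\<^sup>2)" for x
    using pos[of x] pos[of "- x"] odd[of x] odd[of 0] by (cases x "0::real" rule: linorder_cases) auto
  have "\<bar>G x\<bar> \<le> 1 * (1 + x\<^sup>2) ^ 1 * exp (1 * x\<^sup>2)" for x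
  proof -
    have "0 \<le> (\<bar>x\<bar> - 1)\<^sup>2" by simp
    then have "2 * \<bar>x\<bar> \<le> 1 + x\<^sup>2" by (simp add: power2_eq_square algebra_simps)
    then have "\<bar>x\<bar> \<le> 1 + x\<^sup>2" using abs_ge_zero[of x] by linarith
    then have "\<bar>x\<bar> * exp (x\<^sup>2) \<le> (1 + x\<^sup>2) * exp (x\<^sup>2)" by (intro mult_right_mono) auto
    with b[of x] have "\<bar>G x\<bar> \<le> (1 + x\<^sup>2) * exp (x\<^sup>2)" by (rule order_trans)
    then show ?thesis by simp
  qed
  then have "growth 1 G" unfolding growth_def by blast
  with D odd show ?thesis using that by blast
qed

lemma growth_exp_sq: "growth c (\<lambda>x. exp (c * x\<^sup>2))"
  unfolding growth_def by (intro exI[of _ 1] exI[of _ 0]) simp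

text \<open>The raising step \<open>\<phi>\<^bsub>j+1\<^esub> = (x \<phi>\<^sub>j - \<phi>\<^sub>j') / \<surd>(2j + 2)\<close> preserves the Wronskian with \<open>\<psi>\<^sub>j\<close>, so that all
  second solutions arise from \<open>\<phi>\<^sub>0 = 2 \<surd>\<pi> \<psi>\<^sub>0(x) \<integral>\<^sub>0\<^sup>x exp(t\<^sup>2) dt\<close>.\<close>

lemma phi_sol_exists: "\<exists>u v. phi_sol j u v"
proof (induction j)
  case 0
  obtain G :: "real \<Rightarrow> real" where G: "\<And>x. (G has_real_derivative exp (x\<^sup>2)) (at x)"
    "\<And>x. G (- x) = - G x" "growth 1 G" using exp_sq_antiderivative by blast
  define u where "u = (\<lambda>x. 2 * sqrt pi * (psi 0 x * G x))"
  define v where "v = (\<lambda>x. 2 * sqrt pi * (dpsi 0 x * G x + psi 0 x * exp (x\<^sup>2)))"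
  have "(u has_real_derivative v x) (at x)" for x
    unfolding u_def v_def by (rule derivative_eq_intros psi_deriv G refl)+ simp
  moreover have "(v has_real_derivative (x\<^sup>2 - (2 * real 0 + 1)) * u x) (at x)" for x
    unfolding u_def v_def
    by (rule derivative_eq_intros psi_deriv dpsi_deriv G refl)+ (simp add: dpsi_0 algebra_simps)
  moreover have "u (- x) = (- 1) ^ Suc 0 * u x" for x
    unfolding u_def by (simp add: psi_minus G)
  moreover have "psi 0 x * v x - dpsi 0 x * u x = 2" for x
  proof -
    have "(psi 0 x)\<^sup>2 * exp (x\<^sup>2) = 1 / sqrt pi"
      unfolding psi_eq herm_def by (simp add: power_divide power2_eq_square[of "exp _"] flip: exp_add)
    then show ?thesis unfolding u_def v_def by (simp add: algebra_simps power2_eq_square[of "psi _ _"])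
  qed
  moreover have "growth (1 / 2) u"
    unfolding u_def using growth_cmult[OF growth_mult[OF psi_growth G(3)]] by simp
  moreover have "growth (1 / 2) v"
  proof -
    have "growth (1 / 2) (\<lambda>x. dpsi 0 x * G x)" using growth_mult[OF dpsi_growth G(3)] by simp
    moreover have "growth (1 / 2) (\<lambda>x. psi 0 x * exp (x\<^sup>2))"
      using growth_mult[OF psi_growth[of 0] growth_exp_sq[of 1]] by simp
    ultimately show ?thesis unfolding v_def by (intro growth_cmult growth_add)
  qed
  ultimately show ?case unfolding phi_sol_def oscillator_def by blast
next
  case (Suc j)
  then obtain u v where uv: "phi_sol j u v" by blast
  then have o: "oscillator (2 * real j + 1) u v" and par: "\<forall>x. u (- x) = (- 1) ^ Suc j * u x"
    and W: "\<And>x. psi j x * v x - dpsi j x * u x = 2" and gu: "growth (1 / 2) u" and gv: "growth (1 / 2) v"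
    unfolding phi_sol_def by auto
  define c where "c = ladder j"
  have c: "0 < c" "c * c = 2 * real j + 2" using ladder_pos ladder_sq unfolding c_def by auto
  define u' where "u' = (\<lambda>x. (1 / c) * (x * u x - v x))"
  define v' where "v' = (\<lambda>x. c * u x - x * u' x)"
  have cu: "c * u' x = x * u x - v x" for x using c by (simp add: u'_def)
  have du: "(u' has_real_derivative v' x) (at x)" for x
  proof -
    have "(u' has_real_derivative (1 / c) * (u x + x * v x - (x\<^sup>2 - (2 * real j + 1)) * u x)) (at x)"
      unfolding u'_def by (rule derivative_eq_intros oscillatorD[OF o] refl)+ simp
    moreover have "(1 / c) * (u x + x * v x - (x\<^sup>2 - (2 * real j + 1)) * u x) = v' x"
    proof -
      have "c * v' x = (c * c) * u x - x * (c * u' x)" unfolding v'_def by (simp add: algebra_simps)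
      also have "\<dots> = u x + x * v x - (x\<^sup>2 - (2 * real j + 1)) * u x"
        unfolding c cu by (simp add: algebra_simps power2_eq_square)
      finally show ?thesis using c by (simp add: field_simps)
    qed
    ultimately show ?thesis by simp
  qed
  have dv: "(v' has_real_derivative (x\<^sup>2 - (2 * real (Suc j) + 1)) * u' x) (at x)" for x
  proof -
    have "(v' has_real_derivative c * v x - (u' x + x * v' x)) (at x)"
      unfolding v'_def
      by (rule derivative_eq_intros oscillatorD[OF o] du refl)+ (simp add: v'_def)
    moreover have "c * v x - (u' x + x * v' x) = (x\<^sup>2 - (2 * real (Suc j) + 1)) * u' x"
    proof -
      have v: "v x = x * u x - c * u' x" using cu[of x] by simp
      have "c * v x - (u' x + x * v' x) = - (c * c) * u' x - u' x + x\<^sup>2 * u' x"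
        unfolding v v'_def by (simp add: algebra_simps power2_eq_square)
      then show ?thesis unfolding c by (simp add: algebra_simps)
    qed
    ultimately show ?thesis by simp
  qed
  have "u' (- x) = (- 1) ^ Suc (Suc j) * u' x" for x
    unfolding u'_def using par oscillator_parity[OF o par, of x] by (simp add: algebra_simps)
  moreover have "psi (Suc j) x * v' x - dpsi (Suc j) x * u' x = 2" for x
  proof -
    have cp: "c * psi (Suc j) x = x * psi j x - dpsi j x" unfolding dpsi_def c_def by simp
    have "c * (psi (Suc j) x * v' x - dpsi (Suc j) x * u' x)
        = c * ((c * psi (Suc j) x) * u x - psi j x * (c * u' x))"
      unfolding v'_def dpsi_Suc c_def[symmetric] by (simp add: algebra_simps)
    also have "\<dots> = c * 2" unfolding cp cu using W[of x] by (simp add: algebra_simps)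
    finally show ?thesis using c by simp
  qed
  moreover have gu': "growth (1 / 2) u'"
    unfolding u'_def by (intro growth_cmult growth_diff growth_xmult gu gv)
  moreover have "growth (1 / 2) v'"
    unfolding v'_def by (intro growth_cmult growth_diff growth_xmult gu gu')
  ultimately have "phi_sol (Suc j) u' v'" using du dv unfolding phi_sol_def oscillator_def by blast
  then show ?case by blast
qed

text \<open>As \<open>psi j\<close> and \<open>dpsi j\<close> decay, a bound B on u would make
  \<open>dpsi j x * u x\<close> at most 1 in modulus far out, so the Wronskian forces |v| >= 1
  there. By the mean value theorem u then moves by at least 2 B + 1 over an interval of that
  length.\<close>

lemma wronskian_2_unbounded:
  assumes o: "oscillator E u v" and W: "\<And>x. psi j x * v x - dpsi j x * u x = 2"
  shows "\<not> bounded (range u)"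
proof
  assume "bounded (range u)"
  then obtain B where B: "\<And>x. \<bar>u x\<bar> \<le> B" unfolding bounded_iff by auto
  have "B \<ge> 0" using B[of 0] by simp
  have "\<forall>\<^sub>F x in at_top. \<bar>psi j x\<bar> < 1"
    using order_tendstoD(2)[OF tendsto_rabs[OF growth_tendsto_0(1)[OF psi_growth]], of 1] by simp
  moreover have "\<forall>\<^sub>F x in at_top. \<bar>dpsi j x\<bar> < 1 / (B + 1)"
    using order_tendstoD(2)[OF tendsto_rabs[OF growth_tendsto_0(1)[OF dpsi_growth]], of "1 / (B + 1)"] \<open>B \<ge> 0\<close> by simp
  ultimately have "\<forall>\<^sub>F x in at_top. \<bar>psi j x\<bar> < 1 \<and> \<bar>dpsi j x\<bar> < 1 / (B + 1)" by eventually_elim simp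
  then obtain R where R: "\<And>x. x \<ge> R \<Longrightarrow> \<bar>psi j x\<bar> < 1 \<and> \<bar>dpsi j x\<bar> < 1 / (B + 1)"
    unfolding eventually_at_top_linorder by blast
  have v: "\<bar>v x\<bar> \<ge> 1" if "x \<ge> R" for x
  proof -
    have "\<bar>dpsi j x * u x\<bar> \<le> 1 / (B + 1) * (B + 1)"
      unfolding abs_mult using R[OF that] B[of x] \<open>B \<ge> 0\<close> by (intro mult_mono) auto
    then have "\<bar>dpsi j x * u x\<bar> \<le> 1" using \<open>B \<ge> 0\<close> by simp
    then have "1 \<le> \<bar>psi j x * v x\<bar>" using W[of x] by linarith
    also have "\<dots> \<le> 1 * \<bar>v x\<bar>" unfolding abs_mult using R[OF that] by (intro mult_right_mono) auto
    finally show ?thesis by simp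
  qed
  obtain z where z: "R < z" "z < R + 2 * B + 1" "u (R + 2 * B + 1) - u R = (R + 2 * B + 1 - R) * v z"
    using MVT2[of R "R + 2 * B + 1" u v] oscillatorD(1)[OF o] \<open>B \<ge> 0\<close> by auto
  have "2 * B + 1 \<le> (2 * B + 1) * \<bar>v z\<bar>" using v[of z] z \<open>B \<ge> 0\<close> by simp
  also have "\<dots> = \<bar>u (R + 2 * B + 1) - u R\<bar>" using z \<open>B \<ge> 0\<close> by (simp add: abs_mult)
  also have "\<dots> \<le> 2 * B" using B[of R] B[of "R + 2 * B + 1"] by linarith
  finally show False by simp
qed

lemma deriv_psi: "deriv (psi j) = dpsi j"
  using DERIV_imp_deriv[OF psi_deriv] by blast

lemma second_solution_oscillator:
  assumes "second_solution j g"
  shows "oscillator (2 * real j + 1) g (deriv g)"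
proof -
  have "deriv (deriv g) x = (x\<^sup>2 - (2 * real j + 1)) * g x" for x
    using assms unfolding second_solution_def by (simp add: algebra_simps)
  then show ?thesis
    using assms DERIV_deriv_iff_real_differentiable unfolding second_solution_def oscillator_def by metis
qed

lemma phi_sol_second_solution:
  assumes "phi_sol j u v"
  shows "second_solution j u" "deriv u = v"
proof -
  have o: "oscillator (2 * real j + 1) u v" using assms unfolding phi_sol_def by blast
  show d: "deriv u = v" using DERIV_imp_deriv[OF oscillatorD(1)[OF o]] by blast
  have dd: "deriv v = (\<lambda>x. (x\<^sup>2 - (2 * real j + 1)) * u x)"
    using DERIV_imp_deriv[OF oscillatorD(2)[OF o]] by blast
  have "u differentiable (at x)" "v differentiable (at x)" for x
    using oscillatorD[OF o] real_differentiable_def by blast+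
  moreover have "\<not> bounded (range u)"
    using wronskian_2_unbounded[OF o, of j] assms unfolding phi_sol_def by blast
  ultimately show "second_solution j u"
    using assms unfolding second_solution_def d dd deriv_psi phi_sol_def by (auto simp: algebra_simps)
qed

text \<open>The difference of two solutions has Wronskian 0 with \<open>psi j\<close>. At the origin
  parity kills its value or its derivative, and the vanishing Wronskian kills the other one, so it
  is zero everywhere.\<close>

lemma second_solution_unique:
  assumes f: "second_solution j f" and g: "second_solution j g"
  shows "f = g"
proof
  fix x
  let ?d = "\<lambda>x. f x - g x" and ?e = "\<lambda>x. deriv f x - deriv g x"
  have of: "oscillator (2 * real j + 1) f (deriv f)" and og: "oscillator (2 * real j + 1) g (deriv g)"
    using second_solution_oscillator f g by auto
  have o: "oscillator (2 * real j + 1) ?d ?e"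
    unfolding oscillator_def
    using DERIV_diff[OF oscillatorD(1)[OF of] oscillatorD(1)[OF og]]
      DERIV_diff[OF oscillatorD(2)[OF of] oscillatorD(2)[OF og]] by (auto simp: right_diff_distrib)
  have pf: "\<forall>x. f (- x) = (- 1) ^ Suc j * f x" and pg: "\<forall>x. g (- x) = (- 1) ^ Suc j * g x"
    using f g unfolding second_solution_def by auto
  have "psi j 0 * deriv f 0 - dpsi j 0 * f 0 = 2" "psi j 0 * deriv g 0 - dpsi j 0 * g 0 = 2"
    using f g unfolding second_solution_def deriv_psi by auto
  then have W: "psi j 0 * ?e 0 - dpsi j 0 * ?d 0 = 0" "psi j 0 \<noteq> 0 \<or> dpsi j 0 \<noteq> 0"
    by (auto simp: algebra_simps)
  have "?d 0 = 0 \<and> ?e 0 = 0"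
  proof (cases "even j")
    case True
    then have "?d 0 = 0" using pf[rule_format, of 0] pg[rule_format, of 0] by simp
    then show ?thesis using W dpsi_even_0[OF True] by auto
  next
    case False
    then have "?e 0 = 0"
      using oscillator_parity[OF of pf, of 0] oscillator_parity[OF og pg, of 0] by simp
    then show ?thesis using W psi_odd_0[OF False] by auto
  qed
  then have "?d x = 0" using oscillator_zero[OF o, of x] by simp
  then show "f x = g x" by simp
qed

lemma phi_sol_phi: "phi_sol j (phi j) (deriv (phi j))"
proof -
  obtain u v where uv: "phi_sol j u v" using phi_sol_exists by blast
  then have "phi j = u"
    unfolding phi_def using phi_sol_second_solution(1) second_solution_unique by blast
  then show ?thesis using uv phi_sol_second_solution(2) by blast
qed

subsection \<open>Bounds for the pattern functions\<close>

lemma nonneg_if_decreasing_to_0: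
  fixes f :: "real \<Rightarrow> real"
  assumes D: "\<And>x. a \<le> x \<Longrightarrow> (f has_real_derivative f' x) (at x)" "\<And>x. a \<le> x \<Longrightarrow> f' x \<le> 0"
    and t: "(f \<longlongrightarrow> 0) at_top" and x: "a \<le> x"
  shows "0 \<le> f x"
proof (rule tendsto_upperbound[OF t])
  show "\<forall>\<^sub>F y in at_top. f y \<le> f x"
    using eventually_ge_at_top[of x]
  proof eventually_elim
    fix y assume y: "x \<le> y"
    show "f y \<le> f x"
      by (rule DERIV_nonpos_imp_nonincreasing[OF y]) (use D x in \<open>meson order_trans\<close>)
  qed
qed simp

text \<open>The identity \<open>sum_psi_sq\<close> says that twice the kernel is the energy plus
  psi_j^2, and psi_j^2 is one term of the kernel. In particular the energy of \<open>psi j\<close>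
  dominates psi_j^2 even beyond the turning point, where E - x^2 is negative.\<close>

lemma sum_psi_sq_energy:
  "(\<Sum>i\<le>j. (psi i x)\<^sup>2) \<le> (dpsi j x)\<^sup>2 + (2 * real j + 1 - x\<^sup>2) * (psi j x)\<^sup>2"
  "(psi j x)\<^sup>2 \<le> (dpsi j x)\<^sup>2 + (2 * real j + 1 - x\<^sup>2) * (psi j x)\<^sup>2"
proof -
  have le: "(psi j x)\<^sup>2 \<le> (\<Sum>i\<le>j. (psi i x)\<^sup>2)" by (rule member_le_sum) auto
  then show "(\<Sum>i\<le>j. (psi i x)\<^sup>2) \<le> (dpsi j x)\<^sup>2 + (2 * real j + 1 - x\<^sup>2) * (psi j x)\<^sup>2"
    using sum_psi_sq[of x j] by (simp add: algebra_simps)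
  with le show "(psi j x)\<^sup>2 \<le> (dpsi j x)\<^sup>2 + (2 * real j + 1 - x\<^sup>2) * (psi j x)\<^sup>2"
    by linarith
qed

lemma psi_energy_le:
  assumes "0 \<le> x"
  shows "(dpsi j x)\<^sup>2 + (2 * real j + 1 - x\<^sup>2) * (psi j x)\<^sup>2 \<le> sqrt (2 * real j + 1)"
proof -
  have "(dpsi j x)\<^sup>2 + (2 * real j + 1 - x\<^sup>2) * (psi j x)\<^sup>2 \<le> (dpsi j 0)\<^sup>2 + (2 * real j + 1) * (psi j 0)\<^sup>2"
    using energy_le[OF oscillator_psi, of 0 x j] assms by simp
  also have "\<dots> \<le> sqrt (2 * real j + 1)"
    by (rule real_le_rsqrt) (rule psi_energy_0(2))
  finally show ?thesis .
qed

lemma oscillator_phi: "oscillator (2 * real j + 1) (phi j) (deriv (phi j))"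
  and phi_wronskian: "psi j x * deriv (phi j) x - dpsi j x * phi j x = 2"
  and phi_minus: "phi j (- x) = (- 1) ^ Suc j * phi j x"
  and phi_growth: "growth (1 / 2) (phi j)"
  and dphi_growth: "growth (1 / 2) (deriv (phi j))"
  using phi_sol_phi[of j] unfolding phi_sol_def by blast+

lemma dphi_minus: "deriv (phi j) (- x) = (- 1) ^ j * deriv (phi j) x"
  using oscillator_parity[OF oscillator_phi, of j "Suc j"] phi_minus by simp

text \<open>At 0 parity leaves one term in each energy and one product in the Wronskian, whence h g
  = 4 E. The lower bound h >= sqrt E / 3 then gives g <= 12 sqrt E, and the energy decreases from
  there.\<close>

lemma phi_energy_le:
  assumes "0 \<le> x"
  shows "(deriv (phi j) x)\<^sup>2 + (2 * real j + 1 - x\<^sup>2) * (phi j x)\<^sup>2 \<le> 12 * sqrt (2 * real j + 1)"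
proof -
  define E where "E = 2 * real j + 1"
  define h where "h = (dpsi j 0)\<^sup>2 + E * (psi j 0)\<^sup>2"
  define g where "g = (deriv (phi j) 0)\<^sup>2 + E * (phi j 0)\<^sup>2"
  have E: "1 \<le> E" by (simp add: E_def)
  have hg: "h * g = 4 * E"
  proof (cases "even j")
    case True
    then have z: "dpsi j 0 = 0" "phi j 0 = 0" using dpsi_even_0 phi_minus[of j 0] by auto
    then have "psi j 0 * deriv (phi j) 0 = 2" using phi_wronskian[of j 0] by simp
    then have "(psi j 0 * deriv (phi j) 0)\<^sup>2 = 4" by simp
    then show ?thesis unfolding h_def g_def z by (simp add: power_mult_distrib)
  next
    case False
    then have z: "psi j 0 = 0" "deriv (phi j) 0 = 0" using psi_odd_0 dphi_minus[of j 0] by auto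
    then have "dpsi j 0 * phi j 0 = - 2" using phi_wronskian[of j 0] by simp
    then have "(dpsi j 0 * phi j 0)\<^sup>2 = 4" by simp
    then show ?thesis unfolding h_def g_def z by (simp add: power_mult_distrib)
  qed
  have "sqrt E / 3 \<le> h"
  proof (rule power2_le_imp_le)
    show "(sqrt E / 3)\<^sup>2 \<le> h\<^sup>2"
      using psi_energy_0(1)[of j] E unfolding h_def E_def by (simp add: power_divide)
    show "0 \<le> h" using E unfolding h_def by simp
  qed
  moreover have "0 \<le> g" using E unfolding g_def by simp
  ultimately have "sqrt E / 3 * g \<le> h * g" by (rule mult_right_mono)
  also have "h * g = sqrt E / 3 * (12 * sqrt E)" using hg E by simp
  finally have "g \<le> 12 * sqrt E" using E by (subst (asm) mult_le_cancel_left_pos) auto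
  then show ?thesis
    using energy_le[OF oscillator_phi, of 0 x j] assms unfolding g_def E_def by simp
qed

text \<open>The energy controls phi^2 only through the factor E - x^2, which vanishes at the turning
  point sqrt E = s^2. Up to distance 1 / s from it the factor is at least s; over the remaining
  stretch of length 1 / s the energy bounds phi' by a multiple of s, so phi changes by a bounded
  amount only.\<close>

lemma phi_sq_inner:
  assumes x: "0 \<le> x" "x\<^sup>2 \<le> 2 * real j + 1"
  shows "(phi j x)\<^sup>2 \<le> 48 * sqrt (sqrt (2 * real j + 1))"
proof -
  define s where "s = sqrt (sqrt (2 * real j + 1))"
  have s: "1 \<le> s" "s * s = sqrt (2 * real j + 1)" unfolding s_def by auto
  have s4: "(s * s)\<^sup>2 = 2 * real j + 1" unfolding s(2) by simp
  have e: "(deriv (phi j) y)\<^sup>2 + ((s * s)\<^sup>2 - y\<^sup>2) * (phi j y)\<^sup>2 \<le> 12 * (s * s)" if "0 \<le> y" for y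
    using phi_energy_le[OF that, of j] unfolding s4 unfolding s(2) .
  have xs: "x \<le> s * s" by (rule power2_le_imp_le) (use x s4 s in auto)
  \<comment> \<open>Here (s^2 - z) (s^2 + z) >= (1 / s) s^2 = s for z <= y. The width 1 / s makes
    both estimates immediate; the resulting power E^(1/4) is what produces 9/4 in the end.\<close>
  define y where "y = s * s - 1 / s"
  have y0: "0 \<le> y"
  proof -
    have "1 / s \<le> 1" using s by simp
    moreover have "1 * 1 \<le> s * s" using s by (intro mult_mono) auto
    ultimately show ?thesis unfolding y_def by simp
  qed
  have far: "(phi j z)\<^sup>2 \<le> 12 * s" if "0 \<le> z" "z \<le> y" for z
  proof -
    have "1 / s * (s * s) \<le> (s * s - z) * (s * s + z)"
    proof (rule mult_mono)
      have "0 \<le> 1 / s" using s(1) by simp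
      then show "0 \<le> s * s - z" "1 / s \<le> s * s - z" using that unfolding y_def by linarith+
    qed (use that s(1) in auto)
    also have "\<dots> = (s * s)\<^sup>2 - z\<^sup>2" by (simp add: power2_eq_square algebra_simps)
    also have "1 / s * (s * s) = s" using s(1) by simp
    finally have "s \<le> (s * s)\<^sup>2 - z\<^sup>2" .
    then have "s * (phi j z)\<^sup>2 \<le> ((s * s)\<^sup>2 - z\<^sup>2) * (phi j z)\<^sup>2" by (rule mult_right_mono) simp
    also have "\<dots> \<le> s * (12 * s)" using e[OF that(1)] zero_le_power2[of "deriv (phi j) z"] by linarith
    finally show ?thesis using s by (subst (asm) mult_le_cancel_left_pos) auto
  qed
  show ?thesis
  proof (cases "x \<le> y")
    case True
    then show ?thesis using far[of x] x s unfolding s_def[symmetric] by simp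
  next
    case False
    then obtain z where z: "y < z" "z < x" "phi j x - phi j y = (x - y) * deriv (phi j) z"
      using MVT2[of y x "phi j" "deriv (phi j)"] oscillatorD(1)[OF oscillator_phi] by auto
    have "z\<^sup>2 \<le> (s * s)\<^sup>2" using z y0 xs by (intro power_mono) auto
    then have "0 \<le> ((s * s)\<^sup>2 - z\<^sup>2) * (phi j z)\<^sup>2" by simp
    then have w: "(deriv (phi j) z)\<^sup>2 \<le> 12 * (s * s)" using e[of z] z y0 by linarith
    have "(x - y)\<^sup>2 \<le> (1 / s)\<^sup>2" using False xs unfolding y_def by (intro power_mono) auto
    then have "(x - y)\<^sup>2 * (deriv (phi j) z)\<^sup>2 \<le> (1 / s)\<^sup>2 * (12 * (s * s))"
      using w by (intro mult_mono) auto
    also have "\<dots> = 12" using s by (simp add: power2_eq_square)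
    finally have d: "(phi j x - phi j y)\<^sup>2 \<le> 12" unfolding z(3) by (simp add: power_mult_distrib)
    have "(phi j x)\<^sup>2 \<le> 2 * (phi j y)\<^sup>2 + 2 * (phi j x - phi j y)\<^sup>2"
      using zero_le_power2[of "phi j x - 2 * phi j y"] by (simp add: power2_eq_square algebra_simps)
    also have "\<dots> \<le> 2 * (12 * s) + 2 * 12" using far[of y] y0 d by simp
    also have "\<dots> \<le> 48 * s" using s by simp
    finally show ?thesis unfolding s_def .
  qed
qed

text \<open>The sum of the dpsi_i^2 may be as large as E^(3/2), and multiplying it by the pointwise
  bound on phi^2 would lose too much. Its large part carries the factor E - x^2, which is kept next
  to phi^2 and absorbed by the energy of \<open>phi\<close>; only the part of order E meets the
  bound E^(1/4), giving E^(5/4).\<close>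

lemma pattern_sum_inner:
  fixes j :: nat
  assumes x: "0 \<le> x" "x\<^sup>2 \<le> 2 * real j + 1"
  defines "E \<equiv> 2 * real j + 1"
  shows "(\<Sum>i\<le>j. (psi i x)\<^sup>2) * (deriv (phi j) x)\<^sup>2 + (\<Sum>i\<le>j. (dpsi i x)\<^sup>2) * (phi j x)\<^sup>2
    \<le> 96 * (E * sqrt (sqrt E))"
proof -
  define a where "a = sqrt E"
  have E: "1 \<le> E" and a: "1 \<le> a" "a * a = E" unfolding E_def a_def by auto
  have sa: "1 \<le> sqrt a" using a by simp
  let ?K = "\<Sum>i\<le>j. (psi i x)\<^sup>2" and ?L = "\<Sum>i\<le>j. (dpsi i x)\<^sup>2"
  have q: "0 \<le> E - x\<^sup>2" using x unfolding E_def by simp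
  have H: "(dpsi j x)\<^sup>2 + (E - x\<^sup>2) * (psi j x)\<^sup>2 \<le> a"
    using psi_energy_le[OF x(1), of j] unfolding E_def a_def .
  have K: "?K \<le> a" "(psi j x)\<^sup>2 \<le> a" "0 \<le> ?K"
    using sum_psi_sq_energy[where j=j and x=x] H unfolding E_def by (auto intro: sum_nonneg)
  have d: "(dpsi j x)\<^sup>2 \<le> a" using H q mult_nonneg_nonneg[OF q zero_le_power2[of "psi j x"]] by linarith
  have P: "(deriv (phi j) x)\<^sup>2 + (E - x\<^sup>2) * (phi j x)\<^sup>2 \<le> 12 * a"
    using phi_energy_le[OF x(1), of j] unfolding E_def a_def .
  have w: "(deriv (phi j) x)\<^sup>2 \<le> 12 * a" and v: "(E - x\<^sup>2) * (phi j x)\<^sup>2 \<le> 12 * a"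
    using P mult_nonneg_nonneg[OF q zero_le_power2[of "phi j x"]] zero_le_power2[of "deriv (phi j) x"]
    by linarith+
  have "?K * (deriv (phi j) x)\<^sup>2 \<le> a * (12 * a)" using K w a by (intro mult_mono) auto
  also have "\<dots> = 12 * E" using a by simp
  finally have t1: "?K * (deriv (phi j) x)\<^sup>2 \<le> 12 * E" .
  have xa: "x \<le> a" by (rule power2_le_imp_le) (use x E_def a in \<open>auto simp: power2_eq_square\<close>)
  have cross: "- 2 * x * psi j x * dpsi j x \<le> 2 * E"
  proof -
    have "- 2 * psi j x * dpsi j x \<le> (psi j x)\<^sup>2 + (dpsi j x)\<^sup>2"
      using zero_le_power2[of "psi j x + dpsi j x"] by (simp add: power2_eq_square algebra_simps)
    then have "x * (- 2 * psi j x * dpsi j x) \<le> x * (2 * a)" using K d x by (intro mult_left_mono) auto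
    also have "\<dots> \<le> a * (2 * a)" using xa a by (intro mult_right_mono) auto
    finally show ?thesis using a by (simp add: algebra_simps)
  qed
  have "(\<Sum>i\<le>j. (2 * real i + 1 - x\<^sup>2) * (psi i x)\<^sup>2) \<le> (\<Sum>i\<le>j. (E - x\<^sup>2) * (psi i x)\<^sup>2)"
    unfolding E_def by (intro sum_mono mult_right_mono) auto
  also have "\<dots> = (E - x\<^sup>2) * ?K" by (simp add: sum_distrib_left)
  also have "\<dots> \<le> (E - x\<^sup>2) * a" using K q by (intro mult_left_mono) auto
  finally have S: "(\<Sum>i\<le>j. (2 * real i + 1 - x\<^sup>2) * (psi i x)\<^sup>2) \<le> (E - x\<^sup>2) * a" .
  have "(x\<^sup>2 - (2 * real j + 2)) * (psi j x)\<^sup>2 \<le> 0"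
    using q unfolding E_def by (intro mult_nonpos_nonneg) auto
  then have "2 * ?L \<le> a + 2 * E + 2 * ((E - x\<^sup>2) * a)"
    using sum_dpsi_sq[of x j] d cross S by linarith
  moreover have "a * 1 \<le> a * a" using a by (intro mult_left_mono) auto
  ultimately have L: "?L \<le> 3 / 2 * E + (E - x\<^sup>2) * a" using a by simp
  have v2: "(phi j x)\<^sup>2 \<le> 48 * sqrt a" using phi_sq_inner[OF x] unfolding a_def E_def .
  have "?L * (phi j x)\<^sup>2 \<le> (3 / 2 * E + (E - x\<^sup>2) * a) * (phi j x)\<^sup>2"
    using L by (rule mult_right_mono) simp
  also have "\<dots> = 3 / 2 * E * (phi j x)\<^sup>2 + a * ((E - x\<^sup>2) * (phi j x)\<^sup>2)" by (simp add: algebra_simps)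
  also have "\<dots> \<le> 3 / 2 * E * (48 * sqrt a) + a * (12 * a)"
    using v2 v E a by (intro add_mono mult_left_mono) auto
  also have "\<dots> = 72 * (E * sqrt a) + 12 * E" using a by simp
  finally have t2: "?L * (phi j x)\<^sup>2 \<le> 72 * (E * sqrt a) + 12 * E" .
  have "E * 1 \<le> E * sqrt a" using sa E by (intro mult_left_mono) auto
  then show ?thesis using t1 t2 unfolding a_def by linarith
qed

section \<open>Estimates beyond the turning point\<close>

lemma psi_dpsi_nonpos:
  assumes "2 * real i + 1 \<le> x\<^sup>2" "0 \<le> x"
  shows "psi i x * dpsi i x \<le> 0"
proof -
  \<comment> \<open>Beyond the turning point of \<open>psi i\<close> the product psi_i psi_i' has
    the nonnegative derivative psi_i'^2 + (y^2 - 2 i - 1) psi_i^2, and it tends to 0.\<close>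
  have "0 \<le> - (psi i x * dpsi i x)"
  proof (rule nonneg_if_decreasing_to_0[where a = x and f = "\<lambda>x. - (psi i x * dpsi i x)"])
    show "((\<lambda>x. - (psi i x * dpsi i x)) has_real_derivative
        - ((dpsi i y)\<^sup>2 + (y\<^sup>2 - (2 * real i + 1)) * (psi i y)\<^sup>2)) (at y)" for y
      by (rule derivative_eq_intros psi_deriv dpsi_deriv refl)+ (simp add: power2_eq_square algebra_simps)
    show "- ((dpsi i y)\<^sup>2 + (y\<^sup>2 - (2 * real i + 1)) * (psi i y)\<^sup>2) \<le> 0" if "x \<le> y" for y
    proof -
      have "x\<^sup>2 \<le> y\<^sup>2" using that assms by (intro power_mono) auto
      then have "0 \<le> (y\<^sup>2 - (2 * real i + 1)) * (psi i y)\<^sup>2"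
        using assms by (intro mult_nonneg_nonneg) auto
      then show ?thesis using zero_le_power2[of "dpsi i y"] by linarith
    qed
    have "((\<lambda>x. psi i x * dpsi i x) \<longlongrightarrow> 0) at_top"
      by (rule growth_tendsto_0(1)[OF growth_mult[OF psi_growth dpsi_growth]]) simp
    then show "((\<lambda>x. - (psi i x * dpsi i x)) \<longlongrightarrow> 0) at_top"
      using tendsto_minus by fastforce
  qed simp
  then show ?thesis by simp
qed

lemma psi_outer_decreasing:
  assumes a: "0 \<le> a" "2 * real i + 1 \<le> a\<^sup>2" and x: "a \<le> x"
  shows "(psi i x)\<^sup>2 \<le> (psi i a)\<^sup>2" "(dpsi i x)\<^sup>2 \<le> (dpsi i a)\<^sup>2"
proof -
  have sq: "a\<^sup>2 \<le> y\<^sup>2" if "a \<le> y" for y using that a by (intro power_mono) auto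
  have n: "psi i y * dpsi i y \<le> 0" if "a \<le> y" for y
    by (rule psi_dpsi_nonpos) (use sq[OF that] a that in linarith)+
  show "(psi i x)\<^sup>2 \<le> (psi i a)\<^sup>2"
  proof (rule DERIV_nonpos_imp_nonincreasing[OF x])
    fix y assume y: "a \<le> y"
    have "((\<lambda>x. (psi i x)\<^sup>2) has_real_derivative 2 * (psi i y * dpsi i y)) (at y)"
      by (rule derivative_eq_intros psi_deriv refl)+ simp
    then show "\<exists>D. ((\<lambda>x. (psi i x)\<^sup>2) has_real_derivative D) (at y) \<and> D \<le> 0"
      using n[OF y] by (intro exI[of _ "2 * (psi i y * dpsi i y)"]) auto
  qed
  show "(dpsi i x)\<^sup>2 \<le> (dpsi i a)\<^sup>2"
  proof (rule DERIV_nonpos_imp_nonincreasing[OF x])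
    fix y assume y: "a \<le> y"
    have "((\<lambda>x. (dpsi i x)\<^sup>2) has_real_derivative 2 * ((y\<^sup>2 - (2 * real i + 1)) * (psi i y * dpsi i y))) (at y)"
      by (rule derivative_eq_intros dpsi_deriv refl)+ simp
    moreover have "(y\<^sup>2 - (2 * real i + 1)) * (psi i y * dpsi i y) \<le> 0"
      using sq[OF y] a by (intro mult_nonneg_nonpos[OF _ n[OF y]]) linarith
    ultimately show "\<exists>D. ((\<lambda>x. (dpsi i x)\<^sup>2) has_real_derivative D) (at y) \<and> D \<le> 0"
      by (meson mult_nonneg_nonpos zero_le_numeral)
  qed
qed

text \<open>The first bound comes from (y^2 - E + 1) psi^2 <= psi'^2 and (E - 1) (y^2 - E) >= 0. The
  second holds because x^2 psi^2 - psi'^2 tends to 0 and is nonincreasing: its derivative 2 (y psi^2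
  + E psi psi') is nonpositive by the first bound and the sign of psi psi'.\<close>

lemma dpsi_outer:
  assumes x: "0 \<le> x" "2 * real j + 1 \<le> x\<^sup>2"
  shows "x\<^sup>2 * (psi j x)\<^sup>2 \<le> (2 * real j + 1) * (dpsi j x)\<^sup>2" "(dpsi j x)\<^sup>2 \<le> x\<^sup>2 * (psi j x)\<^sup>2"
proof -
  define E where "E = 2 * real j + 1"
  have E: "1 \<le> E" by (simp add: E_def)
  have x2: "E \<le> x\<^sup>2" using x E_def by simp
  have sq: "E \<le> y\<^sup>2" if "x \<le> y" for y
    using power_mono[OF that x(1), of 2] x2 by simp
  have l: "y\<^sup>2 * (psi j y)\<^sup>2 \<le> E * (dpsi j y)\<^sup>2" if y: "x \<le> y" for y
  proof -
    have "(y\<^sup>2 - E + 1) * (psi j y)\<^sup>2 \<le> (dpsi j y)\<^sup>2"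
      using sum_psi_sq_energy(2)[of j y] unfolding E_def[symmetric] by (simp add: algebra_simps)
    then have "E * ((y\<^sup>2 - E + 1) * (psi j y)\<^sup>2) \<le> E * (dpsi j y)\<^sup>2"
      using E by (intro mult_left_mono) auto
    moreover have "y\<^sup>2 \<le> E * (y\<^sup>2 - E + 1)"
    proof -
      have "0 \<le> (E - 1) * (y\<^sup>2 - E)" using sq[OF y] E by simp
      then show ?thesis by (simp add: algebra_simps)
    qed
    then have "y\<^sup>2 * (psi j y)\<^sup>2 \<le> E * (y\<^sup>2 - E + 1) * (psi j y)\<^sup>2" by (rule mult_right_mono) simp
    ultimately show ?thesis by (simp only: mult.assoc)
  qed
  show "x\<^sup>2 * (psi j x)\<^sup>2 \<le> (2 * real j + 1) * (dpsi j x)\<^sup>2" using l[of x] unfolding E_def by simp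
  have "0 \<le> x\<^sup>2 * (psi j x)\<^sup>2 - (dpsi j x)\<^sup>2"
  proof (rule nonneg_if_decreasing_to_0[where a = x and f = "\<lambda>x. x\<^sup>2 * (psi j x)\<^sup>2 - (dpsi j x)\<^sup>2"])
    show "((\<lambda>x. x\<^sup>2 * (psi j x)\<^sup>2 - (dpsi j x)\<^sup>2) has_real_derivative
        2 * (y * (psi j y)\<^sup>2 + E * (psi j y * dpsi j y))) (at y)" for y
      unfolding E_def
      by (rule derivative_eq_intros psi_deriv dpsi_deriv refl)+ (simp add: power2_eq_square algebra_simps)
    show "2 * (y * (psi j y)\<^sup>2 + E * (psi j y * dpsi j y)) \<le> 0" if y: "x \<le> y" for y
    proof -
      have y0: "0 \<le> y" using x y by simp
      have "(y * \<bar>psi j y\<bar>)\<^sup>2 \<le> (E * \<bar>dpsi j y\<bar>)\<^sup>2"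
      proof -
        have "E * (dpsi j y)\<^sup>2 \<le> E * E * (dpsi j y)\<^sup>2"
          using E by (intro mult_right_mono) auto
        then show ?thesis using l[OF y] by (simp add: power_mult_distrib power2_eq_square[of E])
      qed
      then have "y * \<bar>psi j y\<bar> \<le> E * \<bar>dpsi j y\<bar>" by (rule power2_le_imp_le) (use E in simp)
      then have "y * \<bar>psi j y\<bar> * \<bar>psi j y\<bar> \<le> E * \<bar>dpsi j y\<bar> * \<bar>psi j y\<bar>" by (rule mult_right_mono) simp
      then have "y * (psi j y)\<^sup>2 \<le> E * \<bar>psi j y * dpsi j y\<bar>"
        by (simp add: power2_eq_square abs_mult mult_ac)
      also have "\<bar>psi j y * dpsi j y\<bar> = - (psi j y * dpsi j y)"
        using psi_dpsi_nonpos[of j y] sq[OF y] y0 unfolding E_def by simp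
      finally show ?thesis by simp
    qed
    have "growth (0 + (0 + (- 1 / 2 + - 1 / 2))) (\<lambda>x. x * (x * (psi j x * psi j x)))"
      by (intro growth_mult growth_ident psi_growth)
    then have g1: "growth (- 1) (\<lambda>x. x\<^sup>2 * (psi j x)\<^sup>2)" by (simp add: power2_eq_square mult_ac)
    have "growth (- 1 / 2 + - 1 / 2) (\<lambda>x. dpsi j x * dpsi j x)"
      by (intro growth_mult dpsi_growth)
    then have g2: "growth (- 1) (\<lambda>x. (dpsi j x)\<^sup>2)" by (simp add: power2_eq_square)
    show "((\<lambda>x. x\<^sup>2 * (psi j x)\<^sup>2 - (dpsi j x)\<^sup>2) \<longlongrightarrow> 0) at_top"
      by (rule growth_tendsto_0(1)[OF growth_diff[OF g1 g2]]) simp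
  qed simp
  then show "(dpsi j x)\<^sup>2 \<le> x\<^sup>2 * (psi j x)\<^sup>2" by simp
qed

lemma pattern_sum_outer:
  assumes x: "0 \<le> x" "2 * real j + 1 \<le> x\<^sup>2" and pos: "0 \<le> phi j x * deriv (phi j) x"
  shows "(\<Sum>i\<le>j. (psi i x)\<^sup>2) * (deriv (phi j) x)\<^sup>2 + (\<Sum>i\<le>j. (dpsi i x)\<^sup>2) * (phi j x)\<^sup>2
    \<le> 12 * (2 * real j + 1)"
proof -
  define E where "E = 2 * real j + 1"
  define a where "a = sqrt E"
  have E: "1 \<le> E" and a: "1 \<le> a" "a * a = E" unfolding E_def a_def by auto
  let ?K = "\<Sum>i\<le>j. (psi i x)\<^sup>2" and ?L = "\<Sum>i\<le>j. (dpsi i x)\<^sup>2"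
  define p where "p = psi j x" define d where "d = dpsi j x"
  define v where "v = phi j x" define w where "w = deriv (phi j) x"
  have pd: "p * d \<le> 0" using psi_dpsi_nonpos[OF x(2,1)] unfolding p_def d_def .
  have W: "p * w - d * v = 2" using phi_wronskian[of j x] unfolding p_def d_def v_def w_def .
  \<comment> \<open>The product of u v' and -u' v equals -(u u') (v v') >= 0 and their sum is the
    Wronskian 2, so both lie in [0, 2].\<close>
  have prod: "0 \<le> (p * w) * (- (d * v))"
  proof -
    have "0 \<le> - (p * d) * (v * w)" using pd pos unfolding v_def[symmetric] w_def[symmetric] by (intro mult_nonneg_nonneg[of "- (p * d)"]) auto
    then show ?thesis by (simp add: algebra_simps)
  qed
  have "0 \<le> X \<and> 0 \<le> Y" if "0 \<le> X * Y" "X + Y = 2" for X Y :: real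
    using that by (auto simp: zero_le_mult_iff)
  from this[OF prod] have "0 \<le> p * w \<and> 0 \<le> - (d * v)" using W by simp
  then have b: "0 \<le> p * w" "p * w \<le> 2" "0 \<le> - (d * v)" "- (d * v) \<le> 2" using W by auto
  have pw: "p\<^sup>2 * w\<^sup>2 \<le> 4" using power_mono[OF b(2,1), of 2] by (simp add: power_mult_distrib)
  have dv: "d\<^sup>2 * v\<^sup>2 \<le> 4" using power_mono[OF b(4,3), of 2] by (simp add: power_mult_distrib)
  have low: "x\<^sup>2 * p\<^sup>2 \<le> E * d\<^sup>2" and up: "d\<^sup>2 \<le> x\<^sup>2 * p\<^sup>2"
    using dpsi_outer[OF x] unfolding E_def p_def d_def by auto
  have "2 * ?K = (E + 1 - x\<^sup>2) * p\<^sup>2 + d\<^sup>2" using sum_psi_sq[of x j] unfolding E_def p_def d_def by simp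
  also have "\<dots> \<le> (E + 1) * p\<^sup>2" using up by (simp add: algebra_simps)
  finally have K: "?K \<le> (E + 1) / 2 * p\<^sup>2" by simp
  have "?K * w\<^sup>2 \<le> (E + 1) / 2 * p\<^sup>2 * w\<^sup>2" using K by (rule mult_right_mono) simp
  also have "\<dots> \<le> (E + 1) / 2 * 4" unfolding mult.assoc using pw E by (intro mult_left_mono) auto
  finally have t1: "?K * w\<^sup>2 \<le> 2 * E + 2" by simp
  have cross: "- 2 * x * p * d \<le> 2 * a * d\<^sup>2"
  proof -
    have "(x * \<bar>p\<bar>)\<^sup>2 \<le> (a * \<bar>d\<bar>)\<^sup>2" using low a by (simp add: power_mult_distrib power2_eq_square[of a])
    then have "x * \<bar>p\<bar> \<le> a * \<bar>d\<bar>" by (rule power2_le_imp_le) (use a in simp)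
    then have "x * \<bar>p\<bar> * \<bar>d\<bar> \<le> a * \<bar>d\<bar> * \<bar>d\<bar>" by (rule mult_right_mono) simp
    moreover have "- (x * p * d) \<le> x * \<bar>p\<bar> * \<bar>d\<bar>"
      using abs_ge_minus_self[of "x * p * d"] x by (simp add: abs_mult)
    ultimately have "- (x * p * d) \<le> a * \<bar>d\<bar> * \<bar>d\<bar>" by linarith
    also have "\<dots> = a * d\<^sup>2" by (simp add: power2_eq_square)
    finally show ?thesis by linarith
  qed
  have "(\<Sum>i\<le>j. (2 * real i + 1 - x\<^sup>2) * (psi i x)\<^sup>2) \<le> 0"
    using x by (intro sum_nonpos mult_nonpos_nonneg) auto
  moreover have "(x\<^sup>2 - (2 * real j + 2)) * p\<^sup>2 \<le> d\<^sup>2"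
  proof -
    have "(x\<^sup>2 - (2 * real j + 2)) * p\<^sup>2 = - ((2 * real j + 1 - x\<^sup>2) * p\<^sup>2) - p\<^sup>2"
      by (simp add: algebra_simps)
    then show ?thesis
      using sum_psi_sq_energy(2)[of j x] zero_le_power2[of p] unfolding p_def d_def by linarith
  qed
  ultimately have "2 * ?L \<le> d\<^sup>2 + 2 * a * d\<^sup>2 + d\<^sup>2"
    using sum_dpsi_sq[of x j] cross unfolding p_def d_def by linarith
  then have L: "?L \<le> (1 + a) * d\<^sup>2" by (simp add: algebra_simps)
  have "?L * v\<^sup>2 \<le> (1 + a) * d\<^sup>2 * v\<^sup>2" using L by (rule mult_right_mono) simp
  also have "\<dots> \<le> (1 + a) * 4" unfolding mult.assoc using dv a by (intro mult_left_mono) auto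
  finally have t2: "?L * v\<^sup>2 \<le> 4 + 4 * a" by simp
  have "a * 1 \<le> a * a" using a by (intro mult_left_mono) auto
  then have "a \<le> E" using a by simp
  then have "?K * w\<^sup>2 + ?L * v\<^sup>2 \<le> 12 * E" using t1 t2 E by linarith
  then show ?thesis unfolding v_def w_def E_def .
qed

lemma pattern_sum_le_aux:
  fixes j :: nat
  assumes x: "0 \<le> x"
  defines "E \<equiv> 2 * real j + 1"
  shows "(\<Sum>i\<le>j. (psi i x)\<^sup>2) * (deriv (phi j) x)\<^sup>2 + (\<Sum>i\<le>j. (dpsi i x)\<^sup>2) * (phi j x)\<^sup>2
    \<le> 96 * (E * sqrt (sqrt E))"
proof -
  have E: "1 \<le> E" by (simp add: E_def)
  define a where "a = sqrt E"
  have a: "0 \<le> a" "a\<^sup>2 = E" using E by (auto simp: a_def)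
  consider "x\<^sup>2 \<le> E" | "E \<le> x\<^sup>2" "0 \<le> phi j x * deriv (phi j) x" | "E \<le> x\<^sup>2" "phi j x * deriv (phi j) x < 0"
    by linarith
  then show ?thesis
  proof cases
    case 1
    then show ?thesis using pattern_sum_inner[OF x] unfolding E_def by simp
  next
    case 2
    have "1 \<le> sqrt (sqrt E)" using E by simp
    then have "12 * E * 1 \<le> 96 * E * sqrt (sqrt E)" using E by (intro mult_mono) auto
    moreover note pattern_sum_outer[OF x 2[unfolded E_def], folded E_def]
    ultimately show ?thesis by linarith
  next
    case 3
    have ax: "a \<le> x" by (rule power2_le_imp_le) (use a 3 x in auto)
    note D = oscillatorD[OF oscillator_phi, of j, folded E_def]
    have sq: "E \<le> y\<^sup>2" if "a \<le> y" for y
      using power_mono[OF that a(1), of 2] a by simp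
    \<comment> \<open>Beyond the turning point phi phi' is nondecreasing. Being negative at x it is
      nonpositive on all of [a, x], so phi^2 and phi'^2 decrease there, as do the Hermite sums, and
      the bound at a = sqrt E applies.\<close>
    have neg: "phi j y * deriv (phi j) y \<le> 0" if y: "a \<le> y" "y \<le> x" for y
    proof -
      have "phi j y * deriv (phi j) y \<le> phi j x * deriv (phi j) x"
      proof (rule DERIV_nonneg_imp_nondecreasing[OF y(2)])
        fix z assume z: "y \<le> z"
        have "((\<lambda>z. phi j z * deriv (phi j) z) has_real_derivative
            (deriv (phi j) z)\<^sup>2 + (z\<^sup>2 - E) * (phi j z)\<^sup>2) (at z)"
          by (rule derivative_eq_intros D refl)+ (simp add: power2_eq_square algebra_simps)
        moreover have "0 \<le> (deriv (phi j) z)\<^sup>2 + (z\<^sup>2 - E) * (phi j z)\<^sup>2" using sq[of z] z y by simp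
        ultimately show "\<exists>D. ((\<lambda>z. phi j z * deriv (phi j) z) has_real_derivative D) (at z) \<and> 0 \<le> D" by blast
      qed
      then show ?thesis using 3 by simp
    qed
    have v: "(phi j x)\<^sup>2 \<le> (phi j a)\<^sup>2"
    proof (rule DERIV_nonpos_imp_nonincreasing[OF ax])
      fix y assume y: "a \<le> y" "y \<le> x"
      have "((\<lambda>x. (phi j x)\<^sup>2) has_real_derivative 2 * (phi j y * deriv (phi j) y)) (at y)"
        by (rule derivative_eq_intros D refl)+ simp
      then show "\<exists>D. ((\<lambda>x. (phi j x)\<^sup>2) has_real_derivative D) (at y) \<and> D \<le> 0"
        using neg[OF y] by (intro exI[of _ "2 * (phi j y * deriv (phi j) y)"]) auto
    qed
    have w: "(deriv (phi j) x)\<^sup>2 \<le> (deriv (phi j) a)\<^sup>2"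
    proof (rule DERIV_nonpos_imp_nonincreasing[OF ax])
      fix y assume y: "a \<le> y" "y \<le> x"
      have "((\<lambda>x. (deriv (phi j) x)\<^sup>2) has_real_derivative 2 * ((y\<^sup>2 - E) * (phi j y * deriv (phi j) y))) (at y)"
        by (rule derivative_eq_intros D refl)+ simp
      moreover have "(y\<^sup>2 - E) * (phi j y * deriv (phi j) y) \<le> 0"
        using sq[OF y(1)] by (intro mult_nonneg_nonpos[OF _ neg[OF y]]) linarith
      ultimately show "\<exists>D. ((\<lambda>x. (deriv (phi j) x)\<^sup>2) has_real_derivative D) (at y) \<and> D \<le> 0"
        by (meson mult_nonneg_nonpos zero_le_numeral)
    qed
    have i: "2 * real i + 1 \<le> a\<^sup>2" if "i \<le> j" for i using that unfolding a E_def by simp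
    have "(\<Sum>i\<le>j. (psi i x)\<^sup>2) * (deriv (phi j) x)\<^sup>2 + (\<Sum>i\<le>j. (dpsi i x)\<^sup>2) * (phi j x)\<^sup>2
        \<le> (\<Sum>i\<le>j. (psi i a)\<^sup>2) * (deriv (phi j) a)\<^sup>2 + (\<Sum>i\<le>j. (dpsi i a)\<^sup>2) * (phi j a)\<^sup>2"
      using psi_outer_decreasing[OF a(1) i ax] v w
      by (intro add_mono mult_mono sum_mono sum_nonneg) auto
    also have "\<dots> \<le> 96 * (E * sqrt (sqrt E))"
      using pattern_sum_inner[of a j] a unfolding E_def by simp
    finally show ?thesis .
  qed
qed

section \<open>Uniform bounds for sums of squared pattern functions\<close>

lemma pattern_fun_eq:
  "k \<le> j \<Longrightarrow> pattern_fun k j x = dpsi k x * phi j x + psi k x * deriv (phi j) x"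
  unfolding pattern_fun_def
  using DERIV_imp_deriv[OF DERIV_mult[OF psi_deriv oscillatorD(1)[OF oscillator_phi]]]
  by (simp add: mult.commute add.commute)

lemma pattern_fun_commute: "pattern_fun k j = pattern_fun j k"
  unfolding pattern_fun_def by (cases "k = j") auto

lemma pattern_fun_minus: "pattern_fun k j (- x) = (- 1) ^ (k + j) * pattern_fun k j x"
proof -
  have *: "pattern_fun k j (- x) = (- 1) ^ (k + j) * pattern_fun k j x" if "k \<le> j" for k j
    unfolding pattern_fun_eq[OF that] psi_minus dpsi_minus phi_minus dphi_minus
    by (simp add: power_add algebra_simps)
  show ?thesis
    using *[of k j] *[of j k] pattern_fun_commute[of k j] by (cases "k \<le> j") (simp_all add: add.commute)
qed

lemma pattern_sum_le:
  "(\<Sum>i\<le>j. (pattern_fun i j x)\<^sup>2) \<le> 192 * ((2 * real j + 1) * sqrt (sqrt (2 * real j + 1)))"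
proof -
  have nn: "(\<Sum>i\<le>j. (pattern_fun i j x)\<^sup>2) \<le> 192 * ((2 * real j + 1) * sqrt (sqrt (2 * real j + 1)))"
    if "0 \<le> x" for x
  proof -
    have "(\<Sum>i\<le>j. (pattern_fun i j x)\<^sup>2) \<le>
        (\<Sum>i\<le>j. 2 * ((psi i x)\<^sup>2 * (deriv (phi j) x)\<^sup>2 + (dpsi i x)\<^sup>2 * (phi j x)\<^sup>2))"
    proof (rule sum_mono)
      fix i assume "i \<in> {..j}"
      then have "(pattern_fun i j x)\<^sup>2 = (dpsi i x * phi j x + psi i x * deriv (phi j) x)\<^sup>2"
        using pattern_fun_eq by simp
      also have "\<dots> \<le> 2 * ((psi i x)\<^sup>2 * (deriv (phi j) x)\<^sup>2 + (dpsi i x)\<^sup>2 * (phi j x)\<^sup>2)"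
        using sum_squares_bound[of "dpsi i x * phi j x" "psi i x * deriv (phi j) x"]
        by (simp add: power2_sum power_mult_distrib mult_ac)
      finally show "(pattern_fun i j x)\<^sup>2 \<le> 2 * ((psi i x)\<^sup>2 * (deriv (phi j) x)\<^sup>2 + (dpsi i x)\<^sup>2 * (phi j x)\<^sup>2)" .
    qed
    also have "\<dots> = 2 * ((\<Sum>i\<le>j. (psi i x)\<^sup>2) * (deriv (phi j) x)\<^sup>2 + (\<Sum>i\<le>j. (dpsi i x)\<^sup>2) * (phi j x)\<^sup>2)"
      by (simp add: sum_distrib_left sum_distrib_right sum.distrib)
    also have "\<dots> \<le> 2 * (96 * ((2 * real j + 1) * sqrt (sqrt (2 * real j + 1))))"
      using pattern_sum_le_aux[OF that, of j] by simp
    finally show ?thesis by simp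
  qed
  show ?thesis
  proof (cases "0 \<le> x")
    case False
    have "(pattern_fun i j (- x))\<^sup>2 = (pattern_fun i j x)\<^sup>2" for i
      unfolding pattern_fun_minus power_mult_distrib by (simp flip: power_mult)
    then show ?thesis using nn[of "- x"] False by simp
  qed (use nn in blast)
qed

lemma pattern_double_sum_le:
  "(\<Sum>k<N. \<Sum>j<N. (pattern_fun k j x)\<^sup>2) \<le> 1152 * (real N powr (9 / 4))"
proof (cases "N = 0")
  case False
  have "(\<Sum>k<N. \<Sum>j<N. (pattern_fun k j x)\<^sup>2) = (\<Sum>(k, j)\<in>{..<N} \<times> {..<N}. (pattern_fun k j x)\<^sup>2)"
    by (simp add: sum.cartesian_product)
  also have "\<dots> \<le> (\<Sum>(k, j)\<in>{(k, j). k \<le> j \<and> j < N} \<union> {(k, j). j \<le> k \<and> k < N}. (pattern_fun k j x)\<^sup>2)"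
    by (rule sum_mono2) (auto intro: finite_subset[of _ "{..<N} \<times> {..<N}"])
  also have "\<dots> \<le> (\<Sum>(k, j)\<in>{(k, j). k \<le> j \<and> j < N}. (pattern_fun k j x)\<^sup>2)
      + (\<Sum>(k, j)\<in>{(k, j). j \<le> k \<and> k < N}. (pattern_fun k j x)\<^sup>2)"
    by (subst sum_Un) (auto intro: finite_subset[of _ "{..<N} \<times> {..<N}"] intro!: sum_nonneg)
  also have "(\<Sum>(k, j)\<in>{(k, j). j \<le> k \<and> k < N}. (pattern_fun k j x)\<^sup>2)
      = (\<Sum>(k, j)\<in>{(k, j). k \<le> j \<and> j < N}. (pattern_fun k j x)\<^sup>2)"
    by (rule sum.reindex_bij_witness[of _ prod.swap prod.swap]) (auto simp: pattern_fun_commute)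
  also have "(\<Sum>(k, j)\<in>{(k, j). k \<le> j \<and> j < N}. (pattern_fun k j x)\<^sup>2) = (\<Sum>j<N. \<Sum>k\<le>j. (pattern_fun k j x)\<^sup>2)"
    unfolding sum.Sigma[OF finite_lessThan ballI[OF finite_atMost]]
    by (rule sum.reindex_bij_witness[of _ prod.swap prod.swap]) auto
  \<comment> \<open>The 3 dominates 2^(5/4), as 2^5 <= 3^4, and arises from 2 j + 1 <= 2 N. The
    final 1152 is 2 * 192 * 3, with 2 for the two triangles that cover the square.\<close>
  also have "\<dots> \<le> (\<Sum>j<N. 192 * (3 * (real N powr (5 / 4))))"
  proof (rule sum_mono)
    fix j assume "j \<in> {..<N}"
    then have j: "2 * real j + 1 \<le> 2 * real N" by simp
    have p: "t * sqrt (sqrt t) = t powr (5 / 4)" if "0 < t" for t :: real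
    proof -
      have "t * sqrt (sqrt t) = t powr 1 * t powr (1 / 4)"
        using that by (simp add: powr_half_sqrt[symmetric] powr_powr)
      then show ?thesis by (simp only: powr_add[symmetric]) simp
    qed
    have "(2 * real j + 1) powr (5 / 4) \<le> (2 * real N) powr (5 / 4)" using j by (intro powr_mono2) auto
    also have "\<dots> = 2 powr (5 / 4) * real N powr (5 / 4)" by (simp add: powr_mult)
    also have "\<dots> \<le> 3 * real N powr (5 / 4)"
    proof (rule mult_right_mono)
      have "(2 powr (5 / 4)) ^ 4 \<le> (3::real) ^ 4"
        by (simp add: powr_powr flip: powr_realpow)
      then show "2 powr (5 / 4) \<le> (3::real)" by (rule power_mono_iff[THEN iffD1, rotated 3]) auto
    qed simp
    finally have "(2 * real j + 1) powr (5 / 4) \<le> 3 * real N powr (5 / 4)" .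
    then show "(\<Sum>k\<le>j. (pattern_fun k j x)\<^sup>2) \<le> 192 * (3 * (real N powr (5 / 4)))"
      using pattern_sum_le[of j x] p[of "2 * real j + 1"] by simp
  qed
  also have "\<dots> = 576 * (real N powr 1 * real N powr (5 / 4))" using False by simp
  also have "\<dots> = 576 * (real N powr (9 / 4))" by (simp only: powr_add[symmetric]) simp
  finally show ?thesis by simp
qed simp

subsection \<open>Biorthogonality\<close>

lemma phi_deriv: "(phi j has_real_derivative deriv (phi j) x) (at x)"
  and dphi_deriv: "(deriv (phi j) has_real_derivative (x\<^sup>2 - (2 * real j + 1)) * phi j x) (at x)"
  using oscillatorD[OF oscillator_phi] by auto

lemma phi_continuous: "continuous_on S (phi j)"
  by (rule DERIV_continuous_on) (rule has_field_derivative_at_within[OF phi_deriv])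

lemma dphi_continuous: "continuous_on S (deriv (phi j))"
  by (rule DERIV_continuous_on) (rule has_field_derivative_at_within[OF dphi_deriv])

lemmas osc_continuous = psi_continuous dpsi_continuous phi_continuous dphi_continuous

lemma pattern_fun_continuous: "continuous_on S (pattern_fun k j)"
proof -
  have *: "continuous_on S (pattern_fun k j)" if "k \<le> j" for k j
    unfolding pattern_fun_eq[OF that, abs_def] by (intro continuous_intros osc_continuous)
  show ?thesis using *[of k j] *[of j k] pattern_fun_commute[of k j] by (cases "k \<le> j") simp_all
qed

lemma pattern_fun_growth: "growth 0 (pattern_fun k j)"
proof -
  have *: "growth 0 (pattern_fun k j)" if "k \<le> j" for k j
    unfolding pattern_fun_eq[OF that, abs_def]
    using growth_add[OF growth_mult[OF dpsi_growth phi_growth] growth_mult[OF psi_growth dphi_growth]] by simp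
  show ?thesis using *[of k j] *[of j k] pattern_fun_commute[of k j] by (cases "k \<le> j") simp_all
qed

text \<open>\<open>pattern_fun_growth\<close> still allows polynomial growth, whereas L1 convergence
  of the density has to be tested against bounded functions. A single term of
  \<open>pattern_sum_le\<close> supplies the bound.\<close>

lemma pattern_fun_bounded: obtains B where "0 \<le> B" "\<And>x. \<bar>pattern_fun k j x\<bar> \<le> B"
proof -
  have "\<exists>B. \<forall>x. \<bar>pattern_fun k j x\<bar> \<le> B" if "k \<le> j" for k j
  proof -
    let ?C = "192 * ((2 * real j + 1) * sqrt (sqrt (2 * real j + 1)))"
    have "\<bar>pattern_fun k j x\<bar> \<le> sqrt ?C" for x
    proof (rule real_le_rsqrt)
      have "(pattern_fun k j x)\<^sup>2 \<le> (\<Sum>i\<le>j. (pattern_fun i j x)\<^sup>2)"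
        using that by (intro member_le_sum[of k "{..j}" "\<lambda>i. (pattern_fun i j x)\<^sup>2"]) auto
      then show "\<bar>pattern_fun k j x\<bar>\<^sup>2 \<le> ?C" using pattern_sum_le[of j x] by simp
    qed
    then show ?thesis by blast
  qed
  from this[of k j] this[of j k] obtain B where "\<And>x. \<bar>pattern_fun k j x\<bar> \<le> B"
    using pattern_fun_commute[of k j] by (metis nle_le)
  moreover from this[of 0] have "0 \<le> B" by (meson abs_ge_zero order_trans)
  ultimately show ?thesis using that by blast
qed

lemma pattern_psi_integrable: "integrable lborel (\<lambda>x. pattern_fun k j x * (psi a x * psi b x))"
proof (rule growth_integrable)
  show "growth (0 + (- 1 / 2 + - 1 / 2)) (\<lambda>x. pattern_fun k j x * (psi a x * psi b x))"
    by (intro growth_mult pattern_fun_growth psi_growth)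
qed (auto intro!: continuous_intros osc_continuous pattern_fun_continuous)

lemma four_product_growth:
  assumes "growth (- 1 / 2) p" "growth (1 / 2) q" "growth (- 1 / 2) r" "growth (- 1 / 2) s"
  shows "growth (- 1) (\<lambda>x. p x * q x * (r x * s x))"
  using growth_mult[OF growth_mult[OF assms(1,2)] growth_mult[OF assms(3,4)]] by simp

text \<open>The derivative of psi_k^2 phi_j psi_j is twice the integrand minus psi_k^2 times the
  Wronskian. The Wronskian 2 and the normalization of \<open>psi k\<close> make the integral
  1.\<close>

lemma pattern_biorthogonal_diag:
  assumes kj: "k \<le> j"
  shows "(LINT x|lborel. pattern_fun k j x * (psi k x * psi j x)) = 1"
proof -
  have sq: "integrable lborel (\<lambda>x. (psi k x)\<^sup>2)"
  proof (rule growth_integrable)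
    show "growth (- 1 / 2 + - 1 / 2) (\<lambda>x. (psi k x)\<^sup>2)"
      unfolding power2_eq_square by (intro growth_mult psi_growth)
  qed (auto intro!: continuous_intros osc_continuous)
  have "(LINT x|lborel. 2 * (pattern_fun k j x * (psi k x * psi j x)) - 2 * (psi k x)\<^sup>2) = 0"
  proof (rule integral_deriv_eq_0[where F = "\<lambda>x. psi k x * phi j x * (psi k x * psi j x)"])
    fix x
    have "((\<lambda>x. psi k x * phi j x * (psi k x * psi j x)) has_real_derivative
        (dpsi k x * phi j x + psi k x * deriv (phi j) x) * (psi k x * psi j x)
        + psi k x * phi j x * (dpsi k x * psi j x + psi k x * dpsi j x)) (at x)"
      by (rule derivative_eq_intros psi_deriv phi_deriv refl)+ (simp add: algebra_simps)
    moreover have "(dpsi k x * phi j x + psi k x * deriv (phi j) x) * (psi k x * psi j x)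
        + psi k x * phi j x * (dpsi k x * psi j x + psi k x * dpsi j x)
        = 2 * (pattern_fun k j x * (psi k x * psi j x)) - (psi k x)\<^sup>2 * (psi j x * deriv (phi j) x - dpsi j x * phi j x)"
      unfolding pattern_fun_eq[OF kj] by (simp add: power2_eq_square algebra_simps)
    ultimately show "((\<lambda>x. psi k x * phi j x * (psi k x * psi j x)) has_real_derivative
        2 * (pattern_fun k j x * (psi k x * psi j x)) - 2 * (psi k x)\<^sup>2) (at x)"
      unfolding phi_wronskian by (simp add: mult.commute)
  next
    show "integrable lborel (\<lambda>x. 2 * (pattern_fun k j x * (psi k x * psi j x)) - 2 * (psi k x)\<^sup>2)"
      using pattern_psi_integrable sq by (intro Bochner_Integration.integrable_diff integrable_mult_right)
    have g: "growth (- 1) (\<lambda>x. psi k x * phi j x * (psi k x * psi j x))"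
      by (intro four_product_growth psi_growth phi_growth)
    show "((\<lambda>x. psi k x * phi j x * (psi k x * psi j x)) \<longlongrightarrow> 0) at_top"
      "((\<lambda>x. psi k x * phi j x * (psi k x * psi j x)) \<longlongrightarrow> 0) at_bot"
      using growth_tendsto_0[OF g] by auto
  qed (intro continuous_intros osc_continuous pattern_fun_continuous)
  then show ?thesis
    using pattern_psi_integrable[of k j k j] sq psi_integral_sq[of k]
    by (subst (asm) Bochner_Integration.integral_diff) auto
qed

text \<open>The boundary function is \<open>\<Delta> p q r s\<close> plus the product of the Wronskians of \<open>p, r\<close> and of
  \<open>q, s\<close>; both Wronskians have derivative \<open>\<plusminus>\<Delta>\<close> times the product of their arguments.\<close>

lemma pattern_biorthogonal_off:
  assumes kj: "k \<le> j" and d: "a + j = b + k" and ak: "a \<noteq> k"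
  shows "(LINT x|lborel. pattern_fun k j x * (psi a x * psi b x)) = 0"
proof -
  \<comment> \<open>The common gap between the oscillator constants: by a + j = b + k, passing from
    k to a shifts the constant exactly as passing from j to b does. This is the
    \<open>\<Delta>\<close> of the remark above.\<close>
  define D where "D = 2 * (real k - real a)"
  have "real a + real j = real b + real k" using d by (metis of_nat_add)
  then have D: "D \<noteq> 0" "D = 2 * (real j - real b)" using ak unfolding D_def by auto
  define F where "F = (\<lambda>x. D * (psi k x * phi j x * (psi a x * psi b x))
      + (dpsi k x * psi a x - psi k x * dpsi a x) * (phi j x * dpsi b x - deriv (phi j) x * psi b x))"
  have "(LINT x|lborel. 2 * D * (pattern_fun k j x * (psi a x * psi b x))) = 0"
  proof (rule integral_deriv_eq_0[where F = F])
    fix x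
    have e: "x\<^sup>2 - (2 * real a + 1) = x\<^sup>2 - (2 * real k + 1) + D"
      "x\<^sup>2 - (2 * real b + 1) = x\<^sup>2 - (2 * real j + 1) + D"
      using D unfolding D_def by auto
    have "(F has_real_derivative
        D * ((dpsi k x * phi j x + psi k x * deriv (phi j) x) * (psi a x * psi b x)
          + psi k x * phi j x * (dpsi a x * psi b x + psi a x * dpsi b x))
        + ((x\<^sup>2 - (2 * real k + 1)) * psi k x * psi a x - psi k x * ((x\<^sup>2 - (2 * real a + 1)) * psi a x))
          * (phi j x * dpsi b x - deriv (phi j) x * psi b x)
        + (dpsi k x * psi a x - psi k x * dpsi a x)
          * (phi j x * ((x\<^sup>2 - (2 * real b + 1)) * psi b x) - (x\<^sup>2 - (2 * real j + 1)) * phi j x * psi b x)) (at x)"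
      unfolding F_def
      by (rule derivative_eq_intros psi_deriv dpsi_deriv phi_deriv dphi_deriv refl)+ (simp add: algebra_simps)
    then show "(F has_real_derivative 2 * D * (pattern_fun k j x * (psi a x * psi b x))) (at x)"
    proof (rule DERIV_cong)
      show "D * ((dpsi k x * phi j x + psi k x * deriv (phi j) x) * (psi a x * psi b x)
          + psi k x * phi j x * (dpsi a x * psi b x + psi a x * dpsi b x))
        + ((x\<^sup>2 - (2 * real k + 1)) * psi k x * psi a x - psi k x * ((x\<^sup>2 - (2 * real a + 1)) * psi a x))
          * (phi j x * dpsi b x - deriv (phi j) x * psi b x)
        + (dpsi k x * psi a x - psi k x * dpsi a x)
          * (phi j x * ((x\<^sup>2 - (2 * real b + 1)) * psi b x) - (x\<^sup>2 - (2 * real j + 1)) * phi j x * psi b x)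
        = 2 * D * (pattern_fun k j x * (psi a x * psi b x))"
        unfolding e pattern_fun_eq[OF kj] by algebra
    qed
  next
    show "integrable lborel (\<lambda>x. 2 * D * (pattern_fun k j x * (psi a x * psi b x)))"
      using pattern_psi_integrable by (intro integrable_mult_right)
    have W1: "growth (- 1) (\<lambda>x. dpsi k x * psi a x - psi k x * dpsi a x)"
      using growth_diff[OF growth_mult[OF dpsi_growth psi_growth] growth_mult[OF psi_growth dpsi_growth]] by simp
    have W2: "growth 0 (\<lambda>x. phi j x * dpsi b x - deriv (phi j) x * psi b x)"
      using growth_diff[OF growth_mult[OF phi_growth dpsi_growth] growth_mult[OF dphi_growth psi_growth]] by simp
    have g: "growth (- 1) F"
      unfolding F_def
      using growth_add[OF growth_cmult[OF four_product_growth[OF psi_growth phi_growth psi_growth psi_growth]]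
          growth_mult[OF W1 W2, simplified]] .
    show "(F \<longlongrightarrow> 0) at_top" "(F \<longlongrightarrow> 0) at_bot"
      using growth_tendsto_0[OF g] by auto
  qed (intro continuous_intros osc_continuous pattern_fun_continuous)
  then show ?thesis using D by simp
qed

lemma lborel_integral_odd:
  fixes g :: "real \<Rightarrow> real"
  assumes "\<And>x. g (- x) = - g x"
  shows "(LINT x|lborel. g x) = 0"
  using lborel_integral_real_affine[of "- 1" g 0] assms by simp

lemma integral_cis:
  assumes "c \<noteq> 0"
  shows "(LINT t|lborel. indicator {0..pi} t *\<^sub>R cis (c * t)) = (cis (c * pi) - 1) / (\<i> * of_real c)"
proof -
  have "(LINT t|lborel. indicator {0..pi} t *\<^sub>R cis (c * t))
      = exp (\<i> * of_real c * of_real pi) / (\<i> * of_real c) - exp (\<i> * of_real c * of_real 0) / (\<i> * of_real c)"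
  proof (rule integral_FTC_atLeastAtMost)
    fix t :: real
    have "((\<lambda>z. exp (\<i> * of_real c * z) / (\<i> * of_real c)) has_field_derivative cis (c * t)) (at (of_real t))"
      using assms by (auto intro!: derivative_eq_intros simp: cis_conv_exp mult_ac)
    then show "((\<lambda>t. exp (\<i> * of_real c * of_real t) / (\<i> * of_real c)) has_vector_derivative cis (c * t)) (at t within {0..pi})"
      by (rule has_vector_derivative_real_field)
    show "continuous_on {0..pi} (\<lambda>t. cis (c * t))" by (intro continuous_intros)
  qed simp
  then show ?thesis by (simp add: cis_conv_exp diff_divide_distrib mult_ac)
qed

text \<open>Set d = (j - k) + (a - b). The interval [0, pi] is half a period, so the angular
  integral vanishes only for even d other than 0. For odd d the integrand in x is odd, and for d = 0
  biorthogonality decides.\<close>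

lemma pattern_cis_integral:
  "of_real (LINT x|lborel. pattern_fun k j x * (psi a x * psi b x)) *
     (LINT t|lborel. indicator {0..pi} t *\<^sub>R cis (- (real j - real k + (real a - real b)) * t))
   = (if a = k \<and> b = j then of_real pi else (0::complex))"
proof -
  define d where "d = int j - int k + (int a - int b)"
  have rd: "real j - real k + (real a - real b) = of_int d" unfolding d_def by simp
  consider "odd d" | "even d" "d \<noteq> 0" | "d = 0" by blast
  then show ?thesis
  proof cases
    case 1
    have "int (k + j + a + b) = d + 2 * (int k + int b)" unfolding d_def by simp
    then have "odd (int (k + j + a + b))" using 1 by (metis dvd_triv_left even_add)
    then have o: "odd (k + j + a + b)" using even_of_nat by blast
    have "pattern_fun k j (- x) * (psi a (- x) * psi b (- x))
        = (- 1) ^ (k + j + a + b) * (pattern_fun k j x * (psi a x * psi b x))" for x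
      unfolding pattern_fun_minus psi_minus by (simp add: power_add)
    then have "(LINT x|lborel. pattern_fun k j x * (psi a x * psi b x)) = 0"
      by (intro lborel_integral_odd) (use o in simp)
    moreover have "\<not> (a = k \<and> b = j)" using 1 unfolding d_def by auto
    ultimately show ?thesis by simp
  next
    case 2
    then obtain e where e: "d = 2 * e" by blast
    have "cis (- of_int d * pi) = 1"
      using cis_multiple_2pi[of "of_int (- e)"] e by (simp add: mult_ac)
    then have "(LINT t|lborel. indicator {0..pi} t *\<^sub>R cis (- of_int d * t)) = 0"
      using 2 by (subst integral_cis) auto
    moreover have "\<not> (a = k \<and> b = j)" using 2 unfolding d_def by auto
    ultimately show ?thesis unfolding rd by simp
  next
    case 3
    then have eq: "a + j = b + k" unfolding d_def by linarith
    have c: "(LINT t|lborel. indicator {0..pi} t *\<^sub>R cis (- (real j - real k + (real a - real b)) * t)) = of_real pi"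
      unfolding rd 3 by (simp add: scaleR_conv_of_real)
    show ?thesis
    proof (cases "k \<le> j")
      case True
      then show ?thesis
        unfolding c using pattern_biorthogonal_off[OF True eq] pattern_biorthogonal_diag[OF True] eq
        by (cases "a = k") auto
    next
      case False
      then have jk: "j \<le> k" by simp
      have "(LINT x|lborel. pattern_fun k j x * (psi a x * psi b x)) = (LINT x|lborel. pattern_fun j k x * (psi b x * psi a x))"
        by (simp add: pattern_fun_commute[of k j] mult.commute)
      then show ?thesis
        unfolding c using pattern_biorthogonal_off[OF jk eq[symmetric]] pattern_biorthogonal_diag[OF jk] eq
        by (cases "b = j") auto
    qed
  qed
qed

subsection \<open>Integrals over the observation space\<close>

lemma obs_set [measurable]: "UNIV \<times> {0..pi} \<in> sets (borel :: (real \<times> real) measure)"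
  by (simp add: borel_closed closed_Times)

lemma borel_measurable_obs: "f \<in> borel_measurable borel \<Longrightarrow> f \<in> borel_measurable obs_space"
  unfolding obs_space_def by (rule measurable_restrict_space1) simp

lemma integrable_product:
  fixes f g :: "real \<Rightarrow> complex"
  assumes f: "integrable lborel f" and g: "integrable lborel g"
  shows "integrable (lborel \<Otimes>\<^sub>M lborel) (\<lambda>(x, y). f x * g y)"
proof (rule lborel_pair.Fubini_integrable)
  have [measurable]: "f \<in> borel_measurable borel" "g \<in> borel_measurable borel"
    using f g by (auto dest: borel_measurable_integrable)
  show "(\<lambda>(x, y). f x * g y) \<in> borel_measurable (lborel \<Otimes>\<^sub>M lborel)" by measurable
  show "integrable lborel (\<lambda>x. LINT y|lborel. norm (case (x, y) of (x, y) \<Rightarrow> f x * g y))"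
    using f by (simp add: norm_mult)
  show "AE x in lborel. integrable lborel (\<lambda>y. case (x, y) of (x, y) \<Rightarrow> f x * g y)"
    using g by simp
qed

lemma
  fixes g :: "real \<Rightarrow> real"
  assumes g: "integrable lborel g"
  shows obs_integrable_cis: "integrable obs_space (\<lambda>(x, t). of_real (g x) * cis (c * t))" (is ?int)
    and obs_integral_cis: "(LINT z|obs_space. (case z of (x, t) \<Rightarrow> of_real (g x) * cis (c * t)))
      = of_real (LINT x|lborel. g x) * (LINT t|lborel. indicator {0..pi} t *\<^sub>R cis (c * t))" (is ?eq)
proof -
  have eq: "(\<lambda>z. indicator (UNIV \<times> {0..pi}) z *\<^sub>R (case z of (x, t) \<Rightarrow> of_real (g x) * cis (c * t)))
      = (\<lambda>(x, t). of_real (g x) * (indicator {0..pi} t *\<^sub>R cis (c * t)))"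
    by (auto simp: indicator_def)
  have 1: "integrable lborel (\<lambda>x. complex_of_real (g x))" using g by simp
  have 2: "integrable lborel (\<lambda>t. indicator {0..pi} t *\<^sub>R cis (c * t))"
    by (rule borel_integrable_compact) (auto intro!: continuous_intros)
  note prod = integrable_product[OF 1 2, unfolded lborel_prod]
  show ?int
    unfolding obs_space_def by (subst integrable_restrict_space) (simp, unfold eq, rule prod)
  have "(LINT z|obs_space. (case z of (x, t) \<Rightarrow> of_real (g x) * cis (c * t)))
      = (LINT z|lborel. (case z of (x, t) \<Rightarrow> of_real (g x) * (indicator {0..pi} t *\<^sub>R cis (c * t))))"
    unfolding obs_space_def by (subst integral_restrict_space) (simp, unfold eq, rule refl)
  also have "\<dots> = (LINT x|lborel. LINT t|lborel. of_real (g x) * (indicator {0..pi} t *\<^sub>R cis (c * t)))"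
    unfolding lborel_prod[symmetric]
    by (subst lborel_pair.integral_fst'[OF integrable_product[OF 1 2], symmetric]) (simp only: prod.case)
  also have "\<dots> = of_real (LINT x|lborel. g x) * (LINT t|lborel. indicator {0..pi} t *\<^sub>R cis (c * t))"
    by (simp only: integral_mult_right_zero integral_mult_left_zero integral_complex_of_real)
  finally show ?eq .
qed

lemma pattern_F_measurable: "pattern_F k j \<in> borel_measurable borel"
  unfolding pattern_F_def case_prod_beta'
  by (intro borel_measurable_continuous_onI continuous_intros
      continuous_on_compose2[OF pattern_fun_continuous[of UNIV]]) auto

lemma density_partial_measurable: "density_partial \<rho> m \<in> borel_measurable borel"
  unfolding density_partial_def case_prod_beta'
  by (intro borel_measurable_continuous_onI continuous_intros
      continuous_on_compose2[OF psi_continuous[of UNIV]]) auto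

lemma
  shows pattern_density_partial_integrable:
      "integrable obs_space (\<lambda>z. pattern_F k j z * density_partial \<rho> m z)" (is ?int)
    and pattern_density_partial_integral:
      "k < m \<Longrightarrow> j < m \<Longrightarrow> (LINT z|obs_space. pattern_F k j z * density_partial \<rho> m z) = \<rho> k j" (is "_ \<Longrightarrow> _ \<Longrightarrow> ?eq")
proof -
  define T where "T = (\<lambda>a b z. case z of (x, t) \<Rightarrow>
     of_real (pattern_fun k j x * (psi a x * psi b x)) * cis (- (real j - real k + (real a - real b)) * t))"
  have expand: "pattern_F k j z * density_partial \<rho> m z = (\<Sum>a<m. \<Sum>b<m. of_real (1 / pi) * \<rho> a b * T a b z)" for z
  proof -
    obtain x t where z: "z = (x, t)" by fastforce
    have c: "cis (- (real j - real k + (real a - real b)) * t) = cis (- (real j - real k) * t) * cis (- (real a - real b) * t)" for a b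
      by (simp add: cis_mult algebra_simps)
    show ?thesis
      unfolding z T_def pattern_F_def density_partial_def prod.case c sum_distrib_left
      by (intro sum.cong refl) (simp add: algebra_simps)
  qed
  have Ti: "integrable obs_space (T a b)" for a b
    unfolding T_def by (rule obs_integrable_cis[OF pattern_psi_integrable])
  show ?int unfolding expand using Ti by auto
  have TI: "(LINT z|obs_space. T a b z) = (if a = k \<and> b = j then of_real pi else 0)" for a b
    unfolding T_def by (subst obs_integral_cis[OF pattern_psi_integrable]) (rule pattern_cis_integral)
  assume m: "k < m" "j < m"
  have "(LINT z|obs_space. pattern_F k j z * density_partial \<rho> m z)
      = (\<Sum>a<m. \<Sum>b<m. of_real (1 / pi) * \<rho> a b * (if a = k \<and> b = j then of_real pi else 0))"
    unfolding expand using Ti by (simp add: TI Bochner_Integration.integral_sum)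
  also have "\<dots> = (\<Sum>a<m. \<Sum>b<m. if b = j then (if a = k then \<rho> a b else 0) else 0)"
    by (intro sum.cong refl) auto
  also have "\<dots> = \<rho> k j" using m by (simp add: sum.delta)
  finally show ?eq .
qed

lemma pattern_F_bounded: obtains B where "0 \<le> B" "\<And>z. cmod (pattern_F k j z) \<le> B"
proof -
  obtain B where "0 \<le> B" "\<And>x. \<bar>pattern_fun k j x\<bar> \<le> B" using pattern_fun_bounded by blast
  then show ?thesis using that[of B] by (auto simp: pattern_F_def norm_mult split: prod.splits)
qed

lemma pattern_density_integrable:
  assumes int: "integrable obs_space p"
  shows "integrable obs_space (\<lambda>z. pattern_F k j z * of_real (p z))"
proof -
  obtain B where B: "0 \<le> B" "\<And>z. cmod (pattern_F k j z) \<le> B" using pattern_F_bounded by blast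
  note [measurable] = borel_measurable_obs[OF pattern_F_measurable] borel_measurable_integrable[OF int]
  show ?thesis
  proof (rule Bochner_Integration.integrable_bound[where f = "\<lambda>z. B * p z"])
    show "AE z in obs_space. norm (pattern_F k j z * of_real (p z)) \<le> norm (B * p z)"
      using B by (intro AE_I2) (auto simp: norm_mult abs_mult intro!: mult_mono)
  qed (use int in auto)
qed

text \<open>Once m exceeds k and j, the partial density integrates against
  \<open>pattern_F k j\<close> to exactly \<open>\<rho> k j\<close>. The error made by replacing it
  with p is at most B times the L1 distance, which tends to 0.\<close>

lemma pattern_density_integral:
  assumes p: "homodyne_density \<rho> p" and int: "integrable obs_space p"
  shows "(LINT z|obs_space. pattern_F k j z * of_real (p z)) = \<rho> k j"
proof -
  obtain B where B: "0 \<le> B" "\<And>z. cmod (pattern_F k j z) \<le> B" using pattern_F_bounded by blast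
  let ?e = "\<lambda>m. \<integral>\<^sup>+ z. ennreal (cmod (density_partial \<rho> m z - of_real (p z))) \<partial>obs_space"
  have e0: "?e \<longlonglongrightarrow> 0" using p unfolding homodyne_density_def by blast
  note [measurable] = borel_measurable_obs[OF pattern_F_measurable] borel_measurable_obs[OF density_partial_measurable]
    borel_measurable_integrable[OF int]
  note Fp = pattern_density_integrable[OF int, of k j]
  have bound: "ennreal (cmod (\<rho> k j - (LINT z|obs_space. pattern_F k j z * of_real (p z)))) \<le> ennreal B * ?e m"
    if m: "k < m" "j < m" for m
  proof -
    have "\<rho> k j - (LINT z|obs_space. pattern_F k j z * of_real (p z))
        = (LINT z|obs_space. pattern_F k j z * density_partial \<rho> m z - pattern_F k j z * of_real (p z))"
      using pattern_density_partial_integral[OF m, of \<rho>] pattern_density_partial_integrable Fp by simp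
    also have "ennreal (cmod \<dots>)
        \<le> (\<integral>\<^sup>+ z. ennreal (cmod (pattern_F k j z * density_partial \<rho> m z - pattern_F k j z * of_real (p z))) \<partial>obs_space)"
      by (rule integral_norm_bound_ennreal)
        (intro Bochner_Integration.integrable_diff pattern_density_partial_integrable Fp)
    also have "\<dots> \<le> (\<integral>\<^sup>+ z. ennreal B * ennreal (cmod (density_partial \<rho> m z - of_real (p z))) \<partial>obs_space)"
      by (intro nn_integral_mono)
        (use B in \<open>auto simp: norm_mult right_diff_distrib[symmetric] ennreal_mult[symmetric] intro!: ennreal_leI mult_right_mono\<close>)
    also have "\<dots> = ennreal B * ?e m" by (rule nn_integral_cmult) measurable
    finally show ?thesis .
  qed
  have "(\<lambda>m. ennreal B * ?e m) \<longlonglongrightarrow> ennreal B * 0"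
    by (rule tendsto_mult_ennreal[OF tendsto_const e0]) auto
  moreover have "\<forall>\<^sub>F m in sequentially. ennreal (cmod (\<rho> k j - (LINT z|obs_space. pattern_F k j z * of_real (p z)))) \<le> ennreal B * ?e m"
    using eventually_gt_at_top[of k] eventually_gt_at_top[of j] by eventually_elim (rule bound)
  ultimately have "ennreal (cmod (\<rho> k j - (LINT z|obs_space. pattern_F k j z * of_real (p z)))) \<le> 0"
    using tendsto_lowerbound[of "\<lambda>m. ennreal B * ?e m" 0 sequentially] by simp
  then show ?thesis by simp
qed

subsection \<open>The variance of the estimator\<close>

text \<open>The bound uses the second moment s rather than the variance, because it is the sum of
  the second moments over all entries that the uniform estimate of the pattern functions
  controls.\<close>

lemma (in prob_space) iid_mean_square:
  fixes g :: "'b \<Rightarrow> real" and n :: nat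
  assumes ind: "indep_vars (\<lambda>_. S) Z UNIV" and g[measurable]: "g \<in> borel_measurable S"
    and B: "\<And>z. \<bar>g z\<bar> \<le> B"
    and mean: "\<And>l. expectation (\<lambda>\<omega>. g (Z l \<omega>)) = \<mu>"
    and sq: "\<And>l. expectation (\<lambda>\<omega>. (g (Z l \<omega>))\<^sup>2) = s"
    and n: "0 < n"
  shows "integrable M (\<lambda>\<omega>. ((\<Sum>l<n. g (Z l \<omega>)) / real n - \<mu>)\<^sup>2)"
    and "expectation (\<lambda>\<omega>. ((\<Sum>l<n. g (Z l \<omega>)) / real n - \<mu>)\<^sup>2) \<le> s / real n"
proof -
  have [measurable]: "random_variable S (Z l)" for l using ind unfolding indep_vars_def by blast
  define Y where "Y = (\<lambda>l \<omega>. g (Z l \<omega>) - \<mu>)"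
  have [measurable]: "random_variable borel (Y l)" for l unfolding Y_def by measurable
  have bg: "integrable M (\<lambda>\<omega>. g (Z l \<omega>))" for l
    by (rule integrable_const_bound[of _ B]) (use B in auto)
  have bg2: "integrable M (\<lambda>\<omega>. (g (Z l \<omega>))\<^sup>2)" for l
    by (rule integrable_const_bound[of _ "B\<^sup>2"])
      (use B in \<open>auto simp: abs_le_square_iff[symmetric] intro!: order_trans[OF B]\<close>)
  have YB: "\<bar>Y l \<omega>\<bar> \<le> B + \<bar>\<mu>\<bar>" for l \<omega> unfolding Y_def using B[of "Z l \<omega>"] by linarith
  have Yi: "integrable M (Y l)" for l
    by (rule integrable_const_bound[of _ "B + \<bar>\<mu>\<bar>"]) (use YB in auto)
  have YYi: "integrable M (\<lambda>\<omega>. Y l \<omega> * Y m \<omega>)" for l m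
  proof (rule integrable_const_bound[of _ "(B + \<bar>\<mu>\<bar>) * (B + \<bar>\<mu>\<bar>)"])
    show "AE \<omega> in M. norm (Y l \<omega> * Y m \<omega>) \<le> (B + \<bar>\<mu>\<bar>) * (B + \<bar>\<mu>\<bar>)"
      using YB by (intro AE_I2) (auto simp: abs_mult intro!: mult_mono order_trans[OF abs_ge_zero YB])
  qed measurable
  have Y0: "expectation (Y l) = 0" for l
    unfolding Y_def using bg mean by (simp add: prob_space)
  have cross: "expectation (\<lambda>\<omega>. Y l \<omega> * Y m \<omega>) = 0" if "l \<noteq> m" for l m
  proof -
    have "indep_vars (\<lambda>_. borel) (\<lambda>l \<omega>. g (Z l \<omega>) - \<mu>) UNIV"
      by (rule indep_vars_compose2[OF ind, of "\<lambda>_ z. g z - \<mu>"]) measurable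
    then have "indep_vars (\<lambda>_. borel) Y {l, m}"
      unfolding Y_def by (rule indep_vars_subset) simp
    from indep_vars_lebesgue_integral[OF _ this] Yi Y0 that show ?thesis by simp
  qed
  have diag: "expectation (\<lambda>\<omega>. Y l \<omega> * Y l \<omega>) \<le> s" for l
  proof -
    have "expectation (\<lambda>\<omega>. Y l \<omega> * Y l \<omega>) = expectation (\<lambda>\<omega>. (g (Z l \<omega>))\<^sup>2 - 2 * \<mu> * g (Z l \<omega>) + \<mu>\<^sup>2)"
      unfolding Y_def by (intro Bochner_Integration.integral_cong refl) (simp add: power2_eq_square algebra_simps)
    also have "\<dots> = s - 2 * \<mu> * \<mu> + \<mu>\<^sup>2" using bg bg2 by (simp add: mean sq prob_space)
    finally show ?thesis by (simp add: power2_eq_square)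
  qed
  have expand: "((\<Sum>l<n. g (Z l \<omega>)) / real n - \<mu>)\<^sup>2 = (1 / (real n)\<^sup>2) * (\<Sum>l<n. \<Sum>m<n. Y l \<omega> * Y m \<omega>)" for \<omega>
  proof -
    have "(\<Sum>l<n. g (Z l \<omega>)) / real n - \<mu> = (\<Sum>l<n. Y l \<omega>) / real n"
      unfolding Y_def using n by (simp add: sum_subtractf diff_divide_distrib)
    then show ?thesis by (simp add: power_divide sum_product power2_eq_square)
  qed
  show "integrable M (\<lambda>\<omega>. ((\<Sum>l<n. g (Z l \<omega>)) / real n - \<mu>)\<^sup>2)"
    unfolding expand using YYi by simp
  have "expectation (\<lambda>\<omega>. ((\<Sum>l<n. g (Z l \<omega>)) / real n - \<mu>)\<^sup>2)
      = (1 / (real n)\<^sup>2) * (\<Sum>l<n. \<Sum>m<n. expectation (\<lambda>\<omega>. Y l \<omega> * Y m \<omega>))"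
    unfolding expand using YYi by (simp add: Bochner_Integration.integral_sum)
  also have "\<dots> \<le> (1 / (real n)\<^sup>2) * (\<Sum>l<n. \<Sum>m<n. if l = m then s else 0)"
    using cross diag by (intro mult_left_mono sum_mono) auto
  also have "\<dots> = s / real n" using n by (simp add: power2_eq_square)
  finally show "expectation (\<lambda>\<omega>. ((\<Sum>l<n. g (Z l \<omega>)) / real n - \<mu>)\<^sup>2) \<le> s / real n" .
qed

subsection \<open>Hilbert--Schmidt matrices\<close>

lemma suminf_eq_infsum:
  fixes f :: "nat \<Rightarrow> 'a :: banach"
  assumes "f summable_on UNIV"
  shows "suminf f = infsum f UNIV"
  using sums_unique[OF has_sum_imp_sums[OF has_sum_infsum[OF assms]]] by simp

text \<open>Matrix products, forms and traces are iterated ordered series. An absolute bound on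
  finite squares turns them into unordered sums, where the order may be exchanged and square partial
  sums converge to the same value.\<close>

lemma double_series:
  fixes F :: "nat \<Rightarrow> nat \<Rightarrow> complex"
  assumes B: "\<And>m. (\<Sum>j<m. \<Sum>k<m. cmod (F j k)) \<le> B"
  shows "summable (\<lambda>j. \<Sum>k. F j k)" "(\<Sum>j. \<Sum>k. F j k) = (\<Sum>k. \<Sum>j. F j k)"
    "(\<lambda>m. \<Sum>j<m. \<Sum>k<m. F j k) \<longlonglongrightarrow> (\<Sum>j. \<Sum>k. F j k)"
proof -
  let ?f = "\<lambda>(j, k). F j k"
  have abs: "(\<lambda>x. norm (?f x)) summable_on UNIV \<times> UNIV"
  proof (rule nonneg_bdd_above_summable_on)
    show "bdd_above (sum (\<lambda>x. norm (?f x)) ` {E. E \<subseteq> UNIV \<times> UNIV \<and> finite E})"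
    proof (rule bdd_aboveI2)
      fix E :: "(nat \<times> nat) set" assume "E \<in> {E. E \<subseteq> UNIV \<times> UNIV \<and> finite E}"
      then have fin: "finite (fst ` E \<union> snd ` E)" by simp
      then obtain m where m: "fst ` E \<union> snd ` E \<subseteq> {..<m}"
        using finite_nat_iff_bounded by blast
      have "E \<subseteq> {..<m} \<times> {..<m}"
      proof
        fix x assume "x \<in> E"
        then have "fst x \<in> {..<m}" "snd x \<in> {..<m}" using m by blast+
        then show "x \<in> {..<m} \<times> {..<m}" by (simp add: mem_Times_iff)
      qed
      then have "(\<Sum>x\<in>E. norm (?f x)) \<le> (\<Sum>x\<in>{..<m} \<times> {..<m}. norm (?f x))"
        by (intro sum_mono2) auto
      also have "\<dots> = (\<Sum>j<m. \<Sum>k<m. cmod (F j k))"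
        by (simp add: sum.cartesian_product case_prod_unfold)
      finally show "(\<Sum>x\<in>E. norm (?f x)) \<le> B" using B[of m] by simp
    qed
  qed simp
  then have s: "?f summable_on UNIV \<times> UNIV" by (rule abs_summable_summable)
  have s': "(\<lambda>(k, j). F j k) summable_on UNIV \<times> UNIV"
    using summable_on_swap[of "?f" UNIV UNIV] s by (simp add: case_prod_unfold)
  have row: "(\<lambda>k. F j k) summable_on UNIV" for j
    using summable_on_SigmaD1[of F UNIV "\<lambda>_. UNIV" j] s by simp
  have col: "(\<lambda>j. F j k) summable_on UNIV" for k
    using summable_on_SigmaD1[of "\<lambda>k j. F j k" UNIV "\<lambda>_. UNIV" k] s' by simp
  have srow: "(\<lambda>j. infsum (\<lambda>k. F j k) UNIV) summable_on UNIV"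
    using summable_on_Sigma_banach[of F UNIV "\<lambda>_. UNIV"] s by simp
  have scol: "(\<lambda>k. infsum (\<lambda>j. F j k) UNIV) summable_on UNIV"
    using summable_on_Sigma_banach[of "\<lambda>k j. F j k" UNIV "\<lambda>_. UNIV"] s' by simp
  show "summable (\<lambda>j. \<Sum>k. F j k)"
    using summable_on_imp_summable[OF srow] row by (simp add: suminf_eq_infsum)
  have eq: "(\<Sum>j. \<Sum>k. F j k) = infsum (\<lambda>j. infsum (\<lambda>k. F j k) UNIV) UNIV"
    using srow row by (simp add: suminf_eq_infsum)
  also have "\<dots> = infsum (\<lambda>k. infsum (\<lambda>j. F j k) UNIV) UNIV"
    by (rule infsum_swap_banach[OF s])
  also have "\<dots> = (\<Sum>k. \<Sum>j. F j k)" using scol col by (simp add: suminf_eq_infsum)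
  finally show "(\<Sum>j. \<Sum>k. F j k) = (\<Sum>k. \<Sum>j. F j k)" .
  have "infsum (\<lambda>j. infsum (\<lambda>k. F j k) UNIV) UNIV = infsum ?f (UNIV \<times> UNIV)"
    by (rule infsum_Sigma'_banach[OF s])
  then have "(?f has_sum (\<Sum>j. \<Sum>k. F j k)) (UNIV \<times> UNIV)" unfolding eq using s by simp
  then have lim: "(sum ?f \<longlongrightarrow> (\<Sum>j. \<Sum>k. F j k)) (finite_subsets_at_top (UNIV \<times> UNIV))"
    unfolding has_sum_def .
  have sq: "filterlim (\<lambda>m. {..<m} \<times> {..<m}) (finite_subsets_at_top (UNIV \<times> UNIV)) (sequentially :: nat filter)"
    unfolding filterlim_finite_subsets_at_top
  proof (intro allI impI)
    fix X :: "(nat \<times> nat) set" assume "finite X \<and> X \<subseteq> UNIV \<times> UNIV"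
    then have "finite (fst ` X \<union> snd ` X)" by simp
    then obtain M where M: "fst ` X \<union> snd ` X \<subseteq> {..<M}" using finite_nat_iff_bounded by blast
    show "\<forall>\<^sub>F m in sequentially. finite ({..<m} \<times> {..<m}) \<and> X \<subseteq> {..<m} \<times> {..<m} \<and> {..<m} \<times> {..<m} \<subseteq> UNIV \<times> UNIV"
      using eventually_ge_at_top[of M]
    proof eventually_elim
      fix m assume m: "M \<le> m"
      have "X \<subseteq> {..<m} \<times> {..<m}"
      proof
        fix x assume "x \<in> X"
        then have "fst x \<in> {..<M}" "snd x \<in> {..<M}" using M by blast+
        then show "x \<in> {..<m} \<times> {..<m}" using m by (simp add: mem_Times_iff)
      qed
      then show "finite ({..<m} \<times> {..<m}) \<and> X \<subseteq> {..<m} \<times> {..<m} \<and> {..<m} \<times> {..<m} \<subseteq> UNIV \<times> UNIV" by simp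
    qed
  qed
  show "(\<lambda>m. \<Sum>j<m. \<Sum>k<m. F j k) \<longlonglongrightarrow> (\<Sum>j. \<Sum>k. F j k)"
    using filterlim_compose[OF lim sq] by (simp add: sum.cartesian_product)
qed

text \<open>A bound on the squared Hilbert--Schmidt norm, stated through finite square sections: it
  presupposes no summability and passes directly to entrywise limits.\<close>

definition hs_le :: "(nat \<Rightarrow> nat \<Rightarrow> complex) \<Rightarrow> real \<Rightarrow> bool" where
  "hs_le A B \<longleftrightarrow> (\<forall>m. (\<Sum>j<m. \<Sum>k<m. (cmod (A j k))\<^sup>2) \<le> B)"

lemma hs_leD: "hs_le A B \<Longrightarrow> (\<Sum>j<m. \<Sum>k<m. (cmod (A j k))\<^sup>2) \<le> B"
  unfolding hs_le_def by blast

lemma hs_le_nonneg: "hs_le A B \<Longrightarrow> 0 \<le> B"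
  using hs_leD[of A B 0] by simp

lemma hs_le_rect:
  assumes "hs_le A B"
  shows "(\<Sum>j<J. \<Sum>k<K. (cmod (A j k))\<^sup>2) \<le> B"
proof -
  have "(\<Sum>j<J. \<Sum>k<K. (cmod (A j k))\<^sup>2) \<le> (\<Sum>j<max J K. \<Sum>k<K. (cmod (A j k))\<^sup>2)"
    by (intro sum_mono2) (auto intro: sum_nonneg)
  also have "\<dots> \<le> (\<Sum>j<max J K. \<Sum>k<max J K. (cmod (A j k))\<^sup>2)"
    by (intro sum_mono sum_mono2) auto
  finally show ?thesis using hs_leD[OF assms, of "max J K"] by linarith
qed

lemma hs_le_transpose: "hs_le A B \<Longrightarrow> hs_le (\<lambda>j k. A k j) B"
  unfolding hs_le_def by (subst sum.swap) blast

lemma hs_le_row_sums: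
  assumes "hs_le A B"
  shows "summable (\<lambda>k. (cmod (A j k))\<^sup>2)" "(\<Sum>j<J. \<Sum>k. (cmod (A j k))\<^sup>2) \<le> B"
proof -
  have row: "(\<Sum>k<K. (cmod (A j k))\<^sup>2) \<le> B" for j K
  proof -
    have "(\<Sum>k<K. (cmod (A j k))\<^sup>2) \<le> (\<Sum>i<Suc j. \<Sum>k<K. (cmod (A i k))\<^sup>2)"
      by (rule member_le_sum) (auto intro: sum_nonneg)
    then show ?thesis using hs_le_rect[OF assms, where J="Suc j" and K=K] by linarith
  qed
  show s: "summable (\<lambda>k. (cmod (A j k))\<^sup>2)" for j
    by (rule bounded_imp_summable[of _ B])
      (use row[where K="Suc _", unfolded lessThan_Suc_atMost] in auto)
  have "(\<lambda>K. \<Sum>j<J. \<Sum>k<K. (cmod (A j k))\<^sup>2) \<longlonglongrightarrow> (\<Sum>j<J. \<Sum>k. (cmod (A j k))\<^sup>2)"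
    by (intro tendsto_sum summable_LIMSEQ s)
  then show "(\<Sum>j<J. \<Sum>k. (cmod (A j k))\<^sup>2) \<le> B"
    by (rule LIMSEQ_le_const2) (use hs_le_rect[OF assms] in auto)
qed

lemma hs_le_ell2: "hs_le A B \<Longrightarrow> A j \<in> ell2" "hs_le A B \<Longrightarrow> (\<lambda>i. A i j) \<in> ell2"
  using hs_le_row_sums(1) hs_le_row_sums(1)[OF hs_le_transpose] unfolding ell2_def by auto

lemma ell2_mult:
  assumes u: "u \<in> ell2" and v: "v \<in> ell2"
  shows "summable (\<lambda>k. cmod (u k * v k))"
    "(cmod (\<Sum>k. u k * v k))\<^sup>2 \<le> (\<Sum>k. (cmod (u k))\<^sup>2) * (\<Sum>k. (cmod (v k))\<^sup>2)"
proof -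
  let ?U = "\<Sum>k. (cmod (u k))\<^sup>2" and ?V = "\<Sum>k. (cmod (v k))\<^sup>2"
  have su: "summable (\<lambda>k. (cmod (u k))\<^sup>2)" and sv: "summable (\<lambda>k. (cmod (v k))\<^sup>2)"
    using u v unfolding ell2_def by auto
  have U: "0 \<le> ?U" and V: "0 \<le> ?V" using su sv by (auto intro: suminf_nonneg)
  have b: "(\<Sum>k<n. cmod (u k * v k)) \<le> sqrt (?U * ?V)" for n
  proof (rule real_le_rsqrt)
    have "(\<Sum>k<n. cmod (u k * v k))\<^sup>2 \<le> (\<Sum>k<n. (cmod (u k))\<^sup>2) * (\<Sum>k<n. (cmod (v k))\<^sup>2)"
      unfolding norm_mult by (rule Cauchy_Schwarz_ineq_sum)
    also have "\<dots> \<le> ?U * ?V"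
      using U by (intro mult_mono sum_le_suminf su sv) (auto intro: sum_nonneg)
    finally show "(\<Sum>k<n. cmod (u k * v k))\<^sup>2 \<le> ?U * ?V" .
  qed
  show s: "summable (\<lambda>k. cmod (u k * v k))"
    by (rule bounded_imp_summable[of _ "sqrt (?U * ?V)"])
      (use b[of "Suc _", unfolded lessThan_Suc_atMost] in auto)
  have "cmod (\<Sum>k. u k * v k) \<le> (\<Sum>k. cmod (u k * v k))" by (rule summable_norm[OF s])
  also have "\<dots> \<le> sqrt (?U * ?V)" by (rule suminf_le_const[OF s b])
  finally have "(cmod (\<Sum>k. u k * v k))\<^sup>2 \<le> (sqrt (?U * ?V))\<^sup>2" by (intro power_mono) auto
  then show "(cmod (\<Sum>k. u k * v k))\<^sup>2 \<le> ?U * ?V" using U V by simp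
qed

lemma ell2_mult_summable: "u \<in> ell2 \<Longrightarrow> v \<in> ell2 \<Longrightarrow> summable (\<lambda>k. u k * v k)"
  by (rule summable_norm_cancel) (rule ell2_mult(1))

lemma suminf_cnj: "summable f \<Longrightarrow> (\<Sum>k. cnj (f k)) = cnj (\<Sum>k. f k)"
  using sums_cnj sums_unique summable_sums by metis

lemma suminf_Re: "summable f \<Longrightarrow> Re (\<Sum>k. f k) = (\<Sum>k. Re (f k))"
  by (rule bounded_linear.suminf[OF bounded_linear_Re])

lemma ell2_cnj: "u \<in> ell2 \<Longrightarrow> (\<lambda>k. cnj (u k)) \<in> ell2"
  unfolding ell2_def by simp

lemma ell2_add: assumes "u \<in> ell2" "v \<in> ell2" shows "(\<lambda>k. u k + v k) \<in> ell2"
proof -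
  have s: "summable (\<lambda>k. 2 * (cmod (u k))\<^sup>2 + 2 * (cmod (v k))\<^sup>2)"
    using assms unfolding ell2_def by (intro summable_add summable_mult) auto
  have le: "(cmod (u k + v k))\<^sup>2 \<le> 2 * (cmod (u k))\<^sup>2 + 2 * (cmod (v k))\<^sup>2" for k
  proof -
    have "(cmod (u k + v k))\<^sup>2 \<le> (cmod (u k) + cmod (v k))\<^sup>2"
      by (intro power_mono norm_triangle_ineq) auto
    also have "\<dots> \<le> 2 * (cmod (u k))\<^sup>2 + 2 * (cmod (v k))\<^sup>2"
      using sum_squares_bound[of "cmod (u k)" "cmod (v k)"] by (simp add: power2_sum)
    finally show ?thesis .
  qed
  have "summable (\<lambda>k. (cmod (u k + v k))\<^sup>2)"
    by (rule summable_comparison_test'[OF s, where N = 0]) (use le in simp)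
  then show ?thesis unfolding ell2_def by simp
qed

lemma ell2_finite: "(\<And>k. m \<le> k \<Longrightarrow> v k = 0) \<Longrightarrow> v \<in> ell2"
  unfolding ell2_def mem_Collect_eq by (rule summable_finite[of "{..<m}"]) auto

lemma ell2_bounded:
  assumes "\<And>n. (\<Sum>k<n. (cmod (v k))\<^sup>2) \<le> C"
  shows "v \<in> ell2" "(\<Sum>k. (cmod (v k))\<^sup>2) \<le> C"
proof -
  have s: "summable (\<lambda>k. (cmod (v k))\<^sup>2)"
    by (rule bounded_imp_summable[of _ C]) (use assms[of "Suc _", unfolded lessThan_Suc_atMost] in auto)
  then show "v \<in> ell2" unfolding ell2_def by simp
  show "(\<Sum>k. (cmod (v k))\<^sup>2) \<le> C" by (rule suminf_le_const[OF s assms])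
qed

lemma hs_bounded_mat:
  assumes A: "hs_le A B"
  shows "bounded_mat A"
proof -
  have b: "(\<Sum>j<n. (cmod (mat_app A v j))\<^sup>2) \<le> B * (\<Sum>k. (cmod (v k))\<^sup>2)" if v: "v \<in> ell2" for v n
  proof -
    have "(\<Sum>j<n. (cmod (mat_app A v j))\<^sup>2) \<le> (\<Sum>j<n. (\<Sum>k. (cmod (A j k))\<^sup>2) * (\<Sum>k. (cmod (v k))\<^sup>2))"
      unfolding mat_app_def by (intro sum_mono ell2_mult(2) hs_le_ell2(1)[OF A] v)
    also have "\<dots> = (\<Sum>j<n. \<Sum>k. (cmod (A j k))\<^sup>2) * (\<Sum>k. (cmod (v k))\<^sup>2)"
      by (simp add: sum_distrib_right)
    also have "\<dots> \<le> B * (\<Sum>k. (cmod (v k))\<^sup>2)"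
      using v hs_le_row_sums(2)[OF A, of n] unfolding ell2_def by (intro mult_right_mono suminf_nonneg) auto
    finally show ?thesis .
  qed
  have "ell2_norm (mat_app A v) \<le> sqrt B * ell2_norm v" if v: "v \<in> ell2" for v
    unfolding ell2_norm_def real_sqrt_mult[symmetric] using ell2_bounded(2)[OF b[OF v]] by simp
  then have "\<exists>C. \<forall>v\<in>ell2. ell2_norm (mat_app A v) \<le> C * ell2_norm v" by blast
  moreover have "mat_app A v \<in> ell2" if "v \<in> ell2" for v by (rule ell2_bounded(1)[OF b[OF that]])
  moreover have "summable (\<lambda>k. A j k * v k)" if "v \<in> ell2" for j v
    by (rule ell2_mult_summable[OF hs_le_ell2(1)[OF A] that])
  ultimately show ?thesis unfolding bounded_mat_def by simp
qed

lemma hs_product_bound: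
  assumes A: "hs_le A B" and C: "hs_le C D"
  shows "(\<Sum>j<m. \<Sum>k<m. cmod (A j k * C j k)) \<le> (B + D) / 2"
proof -
  have "(\<Sum>j<m. \<Sum>k<m. cmod (A j k * C j k)) \<le> (\<Sum>j<m. \<Sum>k<m. (cmod (A j k))\<^sup>2 / 2 + (cmod (C j k))\<^sup>2 / 2)"
    unfolding norm_mult
  proof (intro sum_mono)
    show "cmod (A j k) * cmod (C j k) \<le> (cmod (A j k))\<^sup>2 / 2 + (cmod (C j k))\<^sup>2 / 2" for j k
      using sum_squares_bound[of "cmod (A j k)" "cmod (C j k)"] by simp
  qed
  also have "\<dots> = (\<Sum>j<m. \<Sum>k<m. (cmod (A j k))\<^sup>2) / 2 + (\<Sum>j<m. \<Sum>k<m. (cmod (C j k))\<^sup>2) / 2"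
    by (simp add: sum.distrib sum_divide_distrib)
  also have "\<dots> \<le> (B + D) / 2" using hs_leD[OF A, of m] hs_leD[OF C, of m] by (simp add: add_divide_distrib)
  finally show ?thesis .
qed

definition fin_form :: "nat \<Rightarrow> (nat \<Rightarrow> nat \<Rightarrow> complex) \<Rightarrow> (nat \<Rightarrow> complex) \<Rightarrow> complex" where
  "fin_form m A v = (\<Sum>j<m. \<Sum>k<m. cnj (v j) * A j k * v k)"

text \<open>The matrix with entries \<open>cnj (v j) * v k\<close> is itself Hilbert--Schmidt, so
  the double series of the quadratic form converges absolutely and is the limit of its finite
  sections.\<close>

lemma psd_mat_from_forms:
  assumes A: "hs_le A B" and h: "mat_adj A = A" and f: "\<And>m v. 0 \<le> Re (fin_form m A v)"
  shows "psd_mat A"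
proof -
  have "0 \<le> Re (ell2_inner v (mat_app A v))" if v: "v \<in> ell2" for v
  proof -
    define F where "F = (\<lambda>j k. cnj (v j) * A j k * v k)"
    have sv: "summable (\<lambda>k. (cmod (v k))\<^sup>2)" using v unfolding ell2_def by simp
    let ?V = "\<Sum>k. (cmod (v k))\<^sup>2"
    have "hs_le (\<lambda>j k. cnj (v j) * v k) (?V * ?V)"
      unfolding hs_le_def
    proof
      fix m
      have "(\<Sum>j<m. \<Sum>k<m. (cmod (cnj (v j) * v k))\<^sup>2) = (\<Sum>j<m. (cmod (v j))\<^sup>2) * (\<Sum>k<m. (cmod (v k))\<^sup>2)"
        by (simp add: norm_mult power_mult_distrib sum_product)
      also have "\<dots> \<le> ?V * ?V"
        using sv by (intro mult_mono sum_le_suminf suminf_nonneg) (auto intro: sum_nonneg)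
      finally show "(\<Sum>j<m. \<Sum>k<m. (cmod (cnj (v j) * v k))\<^sup>2) \<le> ?V * ?V" .
    qed
    from hs_product_bound[OF A this] have "(\<Sum>j<m. \<Sum>k<m. cmod (F j k)) \<le> (B + ?V * ?V) / 2" for m
      unfolding F_def by (simp add: mult_ac)
    from double_series(3)[OF this] have lim: "(\<lambda>m. fin_form m A v) \<longlonglongrightarrow> (\<Sum>j. \<Sum>k. F j k)"
      unfolding fin_form_def F_def .
    have "(\<Sum>j. \<Sum>k. F j k) = ell2_inner v (mat_app A v)"
      unfolding ell2_inner_def mat_app_def F_def mult.assoc
      using suminf_mult[OF ell2_mult_summable[OF hs_le_ell2(1)[OF A] v]] by simp
    with tendsto_Re[OF lim] have "(\<lambda>m. Re (fin_form m A v)) \<longlonglongrightarrow> Re (ell2_inner v (mat_app A v))" by simp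
    then show ?thesis by (rule LIMSEQ_le_const) (use f in auto)
  qed
  then show ?thesis unfolding psd_mat_def using hs_bounded_mat[OF A] h by blast
qed

subsection \<open>Positive semidefinite matrices\<close>

definition unit_seq :: "nat \<Rightarrow> nat \<Rightarrow> complex" where
  "unit_seq j = (\<lambda>k. if k = j then 1 else 0)"

lemma unit_seq_ell2: "unit_seq j \<in> ell2"
  by (rule ell2_finite[of "Suc j"]) (simp add: unit_seq_def)

lemma suminf_unit: "(\<Sum>k. f k * unit_seq j k) = f j" "(\<Sum>k. unit_seq j k * f k) = f j"
  and suminf_cnj_unit: "(\<Sum>k. cnj (unit_seq j k) * f k) = f j"
  using suminf_finite[of "{j}" "\<lambda>k. f k * unit_seq j k"] suminf_finite[of "{j}" "\<lambda>k. unit_seq j k * f k"]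
    suminf_finite[of "{j}" "\<lambda>k. cnj (unit_seq j k) * f k"]
  by (auto simp: unit_seq_def)

lemma psd_row_ell2:
  assumes "psd_mat P"
  shows "(\<lambda>i. P i j) \<in> ell2" "P j \<in> ell2"
proof -
  have "mat_app P (unit_seq j) \<in> ell2"
    using assms unit_seq_ell2 unfolding psd_mat_def bounded_mat_def by blast
  moreover have "mat_app P (unit_seq j) = (\<lambda>i. P i j)" unfolding mat_app_def suminf_unit ..
  ultimately show c: "(\<lambda>i. P i j) \<in> ell2" by simp
  have "P j = (\<lambda>i. cnj (P i j))" using assms unfolding psd_mat_def mat_adj_def by metis
  then show "P j \<in> ell2" using ell2_cnj[OF c] by simp
qed

lemma psd_hermitian: "psd_mat P \<Longrightarrow> cnj (P j k) = P k j"
  unfolding psd_mat_def mat_adj_def by metis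

lemma psd_diag_nonneg: assumes "psd_mat P" shows "0 \<le> Re (P j j)"
proof -
  have "0 \<le> Re (ell2_inner (unit_seq j) (mat_app P (unit_seq j)))"
    using assms unit_seq_ell2 unfolding psd_mat_def by blast
  then show ?thesis unfolding ell2_inner_def mat_app_def suminf_unit suminf_cnj_unit .
qed

text \<open>A zero of a nonnegative form is a minimum, so the form cannot decrease in the direction
  of the j-th unit vector. One explicit step t along that vector changes its value by -2 |c|^2 / (d
  + 1) + d |c|^2 / (d + 1)^2, which is negative unless c = 0.\<close>

lemma psd_null_form:
  assumes P: "psd_mat P" and v: "v \<in> ell2" and z: "Re (ell2_inner v (mat_app P v)) = 0"
  shows "mat_app P v j = 0"
proof -
  define c where "c = mat_app P v j"
  define d where "d = Re (P j j)"
  have d: "0 \<le> d" unfolding d_def by (rule psd_diag_nonneg[OF P])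
  have rows: "P i \<in> ell2" and cols: "(\<lambda>i. P i k) \<in> ell2" for i k using psd_row_ell2[OF P] by auto
  have Pv: "mat_app P v \<in> ell2" using P v unfolding psd_mat_def bounded_mat_def by blast
  \<comment> \<open>The minimising step would be -c / d; d + 1 avoids the case d = 0.\<close>
  define t where "t = - of_real (1 / (d + 1)) * c"
  have tu: "(\<lambda>k. t * unit_seq j k) \<in> ell2"
    by (rule ell2_finite[of "Suc j"]) (simp add: unit_seq_def)
  define w where "w = (\<lambda>k. v k + t * unit_seq j k)"
  have w: "w \<in> ell2" unfolding w_def by (rule ell2_add[OF v tu])
  have Pw: "mat_app P w = (\<lambda>i. mat_app P v i + t * P i j)"
  proof
    fix i
    have "mat_app P w i = (\<Sum>k. P i k * v k + (P i k * t) * unit_seq j k)"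
      unfolding mat_app_def w_def by (simp add: algebra_simps)
    also have "\<dots> = mat_app P v i + (\<Sum>k. (P i k * t) * unit_seq j k)"
      unfolding mat_app_def
      by (rule suminf_add[symmetric]) (use ell2_mult_summable[OF rows v] ell2_mult_summable[OF rows tu] in \<open>auto simp: mult_ac\<close>)
    finally show "mat_app P w i = mat_app P v i + t * P i j" unfolding suminf_unit by (simp add: mult.commute)
  qed
  have vP: "(\<Sum>i. cnj (v i) * P i j) = cnj c"
  proof -
    have "cnj c = (\<Sum>k. cnj (P j k * v k))"
      unfolding c_def mat_app_def by (rule suminf_cnj[symmetric, OF ell2_mult_summable[OF rows v]])
    then show ?thesis by (simp add: psd_hermitian[OF P] mult.commute)
  qed
  have s1: "summable (\<lambda>i. cnj (v i) * mat_app P v i)" by (rule ell2_mult_summable[OF ell2_cnj[OF v] Pv])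
  have s2: "summable (\<lambda>i. cnj (v i) * P i j)" by (rule ell2_mult_summable[OF ell2_cnj[OF v] cols])
  have s3: "summable (\<lambda>i. cnj (unit_seq j i) * (cnj t * (mat_app P v i + t * P i j)))"
    by (rule summable_finite[of "{j}"]) (auto simp: unit_seq_def)
  have "ell2_inner w (mat_app P w) = (\<Sum>i. (cnj (v i) * mat_app P v i + t * (cnj (v i) * P i j))
      + cnj (unit_seq j i) * (cnj t * (mat_app P v i + t * P i j)))"
    unfolding ell2_inner_def Pw by (simp add: w_def algebra_simps)
  also have "\<dots> = ell2_inner v (mat_app P v) + t * cnj c + cnj t * (c + t * P j j)"
    unfolding suminf_add[OF summable_add[OF s1 summable_mult[OF s2]] s3, symmetric]
      suminf_add[OF s1 summable_mult[OF s2], symmetric] suminf_mult[OF s2] suminf_cnj_unit vP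
    by (simp add: ell2_inner_def c_def)
  finally have "0 \<le> Re (ell2_inner v (mat_app P v) + t * cnj c + cnj t * (c + t * P j j))"
    using P w unfolding psd_mat_def by metis
  also have "\<dots> = Re (t * cnj c) + Re (cnj t * c) + Re (cnj t * t * P j j)"
    using z by (simp add: algebra_simps)
  also have "cnj t * t = of_real ((cmod c)\<^sup>2 / (d + 1)\<^sup>2)"
    unfolding t_def using complex_norm_square[of c] by (simp add: power2_eq_square mult_ac)
  also have "t * cnj c = - of_real ((cmod c)\<^sup>2 / (d + 1))"
    unfolding t_def using complex_norm_square[of c] by (simp add: mult_ac)
  also have "cnj t * c = - of_real ((cmod c)\<^sup>2 / (d + 1))"
    unfolding t_def using complex_norm_square[of c] by (simp add: mult_ac)
  finally have "2 * ((cmod c)\<^sup>2 / (d + 1)) \<le> (cmod c)\<^sup>2 / (d + 1)\<^sup>2 * d"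
    unfolding d_def by simp
  also have "\<dots> = (cmod c)\<^sup>2 / (d + 1) * (d / (d + 1))" by (simp add: power2_eq_square)
  also have "\<dots> \<le> (cmod c)\<^sup>2 / (d + 1) * 1" using d by (intro mult_left_mono) auto
  finally have "(cmod c)\<^sup>2 / (d + 1) \<le> 0" by simp
  then have "(cmod c)\<^sup>2 \<le> 0" using d by (simp add: divide_le_0_iff)
  then show ?thesis unfolding c_def by simp
qed

text \<open>Comparing the diagonals of P^2 and of the square of A, the rows of P have the norms of
  the columns of A. Every candidate in the description \<open>mat_abs A\<close> is therefore
  Hilbert--Schmidt, which makes \<open>psd_sqrt_unique\<close> applicable to it.\<close>

lemma psd_hs_of_square:
  assumes P: "psd_mat P" and A: "hs_le A B" and eq: "mat_mult P P = mat_mult (mat_adj A) A"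
  shows "hs_le P B"
  unfolding hs_le_def
proof
  fix m
  have r: "(\<Sum>l. (cmod (P j l))\<^sup>2) = (\<Sum>l. (cmod (A l j))\<^sup>2)" for j
  proof -
    have s1: "summable (\<lambda>l. (cmod (P j l))\<^sup>2)" using psd_row_ell2(2)[OF P] unfolding ell2_def by simp
    have s2: "summable (\<lambda>l. (cmod (A l j))\<^sup>2)" using hs_le_row_sums(1)[OF hs_le_transpose[OF A]] .
    have "P j l * P l j = of_real ((cmod (P j l))\<^sup>2)" for l
      by (subst psd_hermitian[OF P, of j l, symmetric]) (rule complex_norm_square[symmetric])
    then have "mat_mult P P j j = of_real (\<Sum>l. (cmod (P j l))\<^sup>2)"
      unfolding mat_mult_def using suminf_of_real[OF s1, where 'a = complex] by (simp del: of_real_power)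
    moreover have "cnj (A l j) * A l j = of_real ((cmod (A l j))\<^sup>2)" for l
      by (subst mult.commute) (rule complex_norm_square[symmetric])
    then have "mat_mult (mat_adj A) A j j = of_real (\<Sum>l. (cmod (A l j))\<^sup>2)"
      unfolding mat_mult_def mat_adj_def using suminf_of_real[OF s2, where 'a = complex] by (simp del: of_real_power)
    ultimately show ?thesis using eq of_real_eq_iff by metis
  qed
  have "(\<Sum>j<m. \<Sum>k<m. (cmod (P j k))\<^sup>2) \<le> (\<Sum>j<m. \<Sum>k. (cmod (P j k))\<^sup>2)"
    using psd_row_ell2(2)[OF P] unfolding ell2_def by (intro sum_mono sum_le_suminf) auto
  also have "\<dots> = (\<Sum>j<m. \<Sum>k. (cmod (A k j))\<^sup>2)" by (simp add: r)
  also have "\<dots> \<le> B" by (rule hs_le_row_sums(2)[OF hs_le_transpose[OF A]])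
  finally show "(\<Sum>j<m. \<Sum>k<m. (cmod (P j k))\<^sup>2) \<le> B" .
qed

lemma hs_le_mult:
  assumes A: "hs_le A B" and C: "hs_le C D"
  shows "hs_le (mat_mult A C) (B * D)"
  unfolding hs_le_def
proof
  fix m
  have "(\<Sum>j<m. \<Sum>k<m. (cmod (mat_mult A C j k))\<^sup>2)
      \<le> (\<Sum>j<m. \<Sum>k<m. (\<Sum>l. (cmod (A j l))\<^sup>2) * (\<Sum>l. (cmod (C l k))\<^sup>2))"
    unfolding mat_mult_def
    by (intro sum_mono ell2_mult(2) hs_le_ell2(1)[OF A] hs_le_ell2(2)[OF C])
  also have "\<dots> = (\<Sum>j<m. \<Sum>l. (cmod (A j l))\<^sup>2) * (\<Sum>k<m. \<Sum>l. (cmod (C l k))\<^sup>2)"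
    by (simp add: sum_product)
  also have "\<dots> \<le> B * D"
    using hs_le_row_sums[OF A] hs_le_row_sums[OF hs_le_transpose[OF C]] hs_le_nonneg[OF A]
    by (intro mult_mono) (auto intro!: sum_nonneg suminf_nonneg)
  finally show "(\<Sum>j<m. \<Sum>k<m. (cmod (mat_mult A C j k))\<^sup>2) \<le> B * D" .
qed

lemma hs_le_diff:
  assumes A: "hs_le A B" and C: "hs_le C D"
  shows "hs_le (\<lambda>j k. A j k - C j k) (2 * B + 2 * D)"
  unfolding hs_le_def
proof
  fix m
  have "(cmod (A j k - C j k))\<^sup>2 \<le> 2 * (cmod (A j k))\<^sup>2 + 2 * (cmod (C j k))\<^sup>2" for j k
  proof -
    have "(cmod (A j k - C j k))\<^sup>2 \<le> (cmod (A j k) + cmod (C j k))\<^sup>2"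
      by (intro power_mono norm_triangle_ineq4) auto
    also have "\<dots> \<le> 2 * (cmod (A j k))\<^sup>2 + 2 * (cmod (C j k))\<^sup>2"
      using sum_squares_bound[of "cmod (A j k)" "cmod (C j k)"] by (simp add: power2_sum)
    finally show ?thesis .
  qed
  then have "(\<Sum>j<m. \<Sum>k<m. (cmod (A j k - C j k))\<^sup>2)
      \<le> (\<Sum>j<m. \<Sum>k<m. 2 * (cmod (A j k))\<^sup>2 + 2 * (cmod (C j k))\<^sup>2)" by (intro sum_mono)
  also have "\<dots> = 2 * (\<Sum>j<m. \<Sum>k<m. (cmod (A j k))\<^sup>2) + 2 * (\<Sum>j<m. \<Sum>k<m. (cmod (C j k))\<^sup>2)"
    by (simp add: sum.distrib sum_distrib_left)
  also have "\<dots> \<le> 2 * B + 2 * D" using hs_leD[OF A, of m] hs_leD[OF C, of m] by linarith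
  finally show "(\<Sum>j<m. \<Sum>k<m. (cmod (A j k - C j k))\<^sup>2) \<le> 2 * B + 2 * D" .
qed

text \<open>With \<open>X = P - Q\<close> and \<open>P\<^sup>2 = Q\<^sup>2\<close> one has \<open>P X = - X Q\<close>; hence the traces of \<open>X P X\<close> and \<open>X Q X\<close>
  are opposite, and both are nonnegative.\<close>

lemma psd_sqrt_unique:
  assumes P: "psd_mat P" "hs_le P B" and Q: "psd_mat Q" "hs_le Q D" and eq: "mat_mult P P = mat_mult Q Q"
  shows "P = Q"
proof -
  define X where "X = (\<lambda>j k. P j k - Q j k)"
  have X: "hs_le X (2 * B + 2 * D)" unfolding X_def by (rule hs_le_diff[OF P(2) Q(2)])
  note e = hs_le_ell2
  have Xh: "cnj (X j k) = X k j" for j k unfolding X_def using psd_hermitian[OF P(1)] psd_hermitian[OF Q(1)] by simp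
  define Y where "Y = mat_mult P X"
  have Yhs: "hs_le Y (B * (2 * B + 2 * D))" unfolding Y_def by (rule hs_le_mult[OF P(2) X])
  have PX: "Y j k = mat_mult P P j k - mat_mult P Q j k" for j k
    unfolding Y_def mat_mult_def X_def right_diff_distrib
    by (rule suminf_diff[symmetric]) (intro ell2_mult_summable e[OF P(2)] e[OF Q(2)])+
  have XQ: "(\<Sum>l. X j l * Q l k) = mat_mult P Q j k - mat_mult Q Q j k" for j k
    unfolding mat_mult_def X_def left_diff_distrib
    by (rule suminf_diff[symmetric]) (intro ell2_mult_summable e[OF P(2)] e[OF Q(2)])+
  have QX: "mat_mult Q X i k = - cnj (Y k i)" for i k
  proof -
    have "cnj (mat_mult Q X i k) = (\<Sum>l. cnj (Q i l * X l k))"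
      unfolding mat_mult_def by (rule suminf_cnj[symmetric]) (intro ell2_mult_summable e[OF Q(2)] e[OF X])
    also have "\<dots> = (\<Sum>l. X k l * Q l i)" by (simp add: Xh psd_hermitian[OF Q(1)] mult.commute)
    also have "\<dots> = - Y k i" unfolding XQ PX eq by simp
    finally show ?thesis by (metis complex_cnj_cnj complex_cnj_minus)
  qed
  define F where "F = (\<lambda>k i. X k i * Y i k)"
  have Fb: "(\<Sum>j<m. \<Sum>k<m. cmod (F j k)) \<le> (2 * B + 2 * D + B * (2 * B + 2 * D)) / 2" for m
    unfolding F_def by (rule hs_product_bound[OF X hs_le_transpose[OF Yhs]])
  define a where "a = (\<lambda>k. Re (ell2_inner (\<lambda>i. X i k) (mat_app P (\<lambda>i. X i k))))"
  define b where "b = (\<lambda>k. Re (ell2_inner (\<lambda>i. X i k) (mat_app Q (\<lambda>i. X i k))))"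
  have a_eq: "a k = Re (\<Sum>i. F k i)" for k
    unfolding a_def ell2_inner_def F_def Xh Y_def mat_app_def mat_mult_def ..
  have sF: "summable (\<lambda>i. F i k)" for k
    unfolding F_def by (intro ell2_mult_summable e[OF X] e[OF Yhs])
  have b_eq: "b k = - Re (\<Sum>i. F i k)" for k
  proof -
    have "b k = Re (\<Sum>i. X k i * mat_mult Q X i k)"
      unfolding b_def ell2_inner_def Xh mat_app_def mat_mult_def ..
    also have "(\<Sum>i. X k i * mat_mult Q X i k) = (\<Sum>i. - cnj (F i k))"
      unfolding QX F_def by (simp add: Xh)
    also have "\<dots> = - cnj (\<Sum>i. F i k)"
      using suminf_cnj[OF summable_minus[OF sF]] suminf_minus[OF sF] by simp
    finally show ?thesis by simp
  qed
  have a0: "0 \<le> a k" and b0: "0 \<le> b k" for k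
    using P(1) Q(1) e(2)[OF X] unfolding a_def b_def psd_mat_def by blast+
  have Fb': "(\<Sum>j<m. \<Sum>k<m. cmod (F k j)) \<le> (2 * B + 2 * D + B * (2 * B + 2 * D)) / 2" for m
    using Fb[of m] by (subst sum.swap)
  have sa: "summable a" unfolding a_eq[abs_def] by (intro summable_Re double_series(1)[OF Fb])
  have sb: "summable b" unfolding b_eq[abs_def] by (intro summable_minus summable_Re double_series(1)[OF Fb'])
  have "(\<Sum>k. a k) = Re (\<Sum>k. \<Sum>i. F k i)"
    unfolding a_eq by (rule suminf_Re[OF double_series(1)[OF Fb], symmetric])
  moreover have "(\<Sum>k. b k) = - Re (\<Sum>k. \<Sum>i. F i k)"
    unfolding b_eq
    using suminf_minus[OF summable_Re[OF double_series(1)[OF Fb']]] suminf_Re[OF double_series(1)[OF Fb']] by simp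
  ultimately have "(\<Sum>k. a k) + (\<Sum>k. b k) = 0" using double_series(2)[OF Fb] by simp
  moreover have "0 \<le> (\<Sum>k. a k)" "0 \<le> (\<Sum>k. b k)" using a0 b0 sa sb by (auto intro: suminf_nonneg)
  ultimately have "(\<Sum>k. a k) = 0" "(\<Sum>k. b k) = 0" by linarith+
  then have "a k = 0" "b k = 0" for k
    using suminf_eq_zero_iff[OF sa a0] suminf_eq_zero_iff[OF sb b0] by auto
  then have "mat_app P (\<lambda>i. X i k) j = 0" "mat_app Q (\<lambda>i. X i k) j = 0" for j k
    using psd_null_form[OF P(1) e(2)[OF X]] psd_null_form[OF Q(1) e(2)[OF X]] unfolding a_def b_def by blast+
  \<comment> \<open>Both P and Q annihilate the columns of X, hence so does X = P - Q. As X is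
    Hermitian, the diagonal of its square consists of the square norms of its rows.\<close>
  then have XX: "(\<Sum>i. X k i * X i k) = 0" for k
  proof -
    have "(\<Sum>i. P k i * X i k - Q k i * X i k) = (\<Sum>i. P k i * X i k) - (\<Sum>i. Q k i * X i k)"
      by (rule suminf_diff[symmetric]) (intro ell2_mult_summable e[OF P(2)] e[OF Q(2)] e[OF X])+
    then show ?thesis
      using \<open>\<And>k j. mat_app P (\<lambda>i. X i k) j = 0\<close> \<open>\<And>k j. mat_app Q (\<lambda>i. X i k) j = 0\<close>
      unfolding mat_app_def by (simp add: X_def left_diff_distrib)
  qed
  have "X k i = 0" for k i
  proof -
    have s: "summable (\<lambda>i. (cmod (X k i))\<^sup>2)" by (rule hs_le_row_sums(1)[OF X])
    have "X k i * X i k = of_real ((cmod (X k i))\<^sup>2)" for i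
      unfolding Xh[of k i, symmetric] by (rule complex_norm_square[symmetric])
    then have "of_real (\<Sum>i. (cmod (X k i))\<^sup>2) = (0::complex)"
      using XX[of k] suminf_of_real[OF s, where 'a = complex] by (simp del: of_real_power)
    then have "(\<Sum>i. (cmod (X k i))\<^sup>2) = 0" by (simp only: of_real_eq_0_iff)
    then show ?thesis using suminf_eq_zero_iff[OF s] by simp
  qed
  then show ?thesis unfolding X_def by (intro ext) simp
qed

subsection \<open>Spectral decomposition of a finite section\<close>

definition fin_inner :: "nat \<Rightarrow> (nat \<Rightarrow> complex) \<Rightarrow> (nat \<Rightarrow> complex) \<Rightarrow> complex" where
  "fin_inner m u v = (\<Sum>k<m. cnj (u k) * v k)"

definition fin_app :: "nat \<Rightarrow> (nat \<Rightarrow> nat \<Rightarrow> complex) \<Rightarrow> (nat \<Rightarrow> complex) \<Rightarrow> nat \<Rightarrow> complex" where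
  "fin_app m A v = (\<lambda>k. \<Sum>l<m. A k l * v l)"

definition fin_sq :: "nat \<Rightarrow> (nat \<Rightarrow> complex) \<Rightarrow> real" where
  "fin_sq m v = (\<Sum>k<m. (cmod (v k))\<^sup>2)"

lemma fin_inner_self: "fin_inner m v v = of_real (fin_sq m v)"
  unfolding fin_inner_def fin_sq_def of_real_sum
  by (intro sum.cong refl) (simp only: complex_norm_square mult.commute)

lemma fin_inner_add: "fin_inner m u (\<lambda>k. v k + w k) = fin_inner m u v + fin_inner m u w"
  "fin_inner m (\<lambda>k. v k + w k) u = fin_inner m v u + fin_inner m w u"
  unfolding fin_inner_def by (simp_all add: algebra_simps sum.distrib)

lemma fin_inner_diff: "fin_inner m u (\<lambda>k. v k - w k) = fin_inner m u v - fin_inner m u w"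
  unfolding fin_inner_def by (simp add: algebra_simps sum_subtractf)

lemma fin_inner_scale: "fin_inner m u (\<lambda>k. c * v k) = c * fin_inner m u v"
  "fin_inner m (\<lambda>k. c * v k) u = cnj c * fin_inner m v u"
  unfolding fin_inner_def by (simp_all add: sum_distrib_left algebra_simps)

lemma fin_inner_sum: "fin_inner m u (\<lambda>k. \<Sum>i\<in>I. v i k) = (\<Sum>i\<in>I. fin_inner m u (v i))"
  unfolding fin_inner_def by (simp add: sum_distrib_left) (rule sum.swap)

lemma cnj_fin_inner: "cnj (fin_inner m u v) = fin_inner m v u"
  unfolding fin_inner_def by (simp add: mult.commute)

lemma fin_app_add: "fin_app m A (\<lambda>k. v k + w k) = (\<lambda>k. fin_app m A v k + fin_app m A w k)"
  unfolding fin_app_def by (simp add: algebra_simps sum.distrib)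

lemma fin_app_scale: "fin_app m A (\<lambda>k. c * v k) = (\<lambda>k. c * fin_app m A v k)"
  unfolding fin_app_def by (simp add: sum_distrib_left algebra_simps)

lemma fin_sq_scale: "fin_sq m (\<lambda>k. c * v k) = (cmod c)\<^sup>2 * fin_sq m v"
  unfolding fin_sq_def by (simp add: norm_mult power_mult_distrib sum_distrib_left)

lemma fin_sq_eq_0: "fin_sq m v = 0 \<Longrightarrow> k < m \<Longrightarrow> v k = 0"
  unfolding fin_sq_def by (subst (asm) sum_nonneg_eq_0_iff) auto

lemma fin_sq_nonneg: "0 \<le> fin_sq m v"
  unfolding fin_sq_def by (intro sum_nonneg) simp

lemma fin_app_hermitian:
  assumes "\<And>j k. cnj (A j k) = A k j"
  shows "fin_inner m (fin_app m A u) v = fin_inner m u (fin_app m A v)"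
proof -
  have "fin_inner m (fin_app m A u) v = (\<Sum>k<m. \<Sum>l<m. cnj (u l) * A l k * v k)"
    unfolding fin_inner_def fin_app_def by (simp add: sum_distrib_left assms mult_ac)
  also have "\<dots> = (\<Sum>l<m. \<Sum>k<m. cnj (u l) * A l k * v k)" by (rule sum.swap)
  also have "\<dots> = fin_inner m u (fin_app m A v)"
    unfolding fin_inner_def fin_app_def by (simp add: sum_distrib_left mult_ac)
  finally show ?thesis .
qed

definition orthonormal :: "nat \<Rightarrow> nat \<Rightarrow> (nat \<Rightarrow> nat \<Rightarrow> complex) \<Rightarrow> bool" where
  "orthonormal m r u \<longleftrightarrow> (\<forall>i<r. \<forall>k\<ge>m. u i k = 0) \<and>
     (\<forall>i<r. \<forall>j<r. fin_inner m (u i) (u j) = (if i = j then 1 else 0))"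

definition residual :: "nat \<Rightarrow> (nat \<Rightarrow> nat \<Rightarrow> complex) \<Rightarrow> nat \<Rightarrow> nat \<Rightarrow> complex" where
  "residual r u k = (\<lambda>l. unit_seq k l - (\<Sum>i<r. cnj (u i k) * u i l))"

lemma fin_inner_unit: "k < m \<Longrightarrow> fin_inner m u (unit_seq k) = cnj (u k)"
  unfolding fin_inner_def unit_seq_def by (simp add: if_distrib cong: if_cong)

lemma residual_orthogonal:
  assumes o: "orthonormal m r u" and i: "i < r" and k: "k < m"
  shows "fin_inner m (u i) (residual r u k) = 0"
proof -
  have "fin_inner m (u i) (residual r u k) = cnj (u i k) - (\<Sum>j<r. cnj (u j k) * fin_inner m (u i) (u j))"
    unfolding residual_def fin_inner_diff fin_inner_sum fin_inner_scale fin_inner_unit[OF k] ..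
  also have "(\<Sum>j<r. cnj (u j k) * fin_inner m (u i) (u j)) = (\<Sum>j<r. if j = i then cnj (u j k) else 0)"
    using o i unfolding orthonormal_def by (intro sum.cong refl) auto
  also have "\<dots> = cnj (u i k)" using i by simp
  finally show ?thesis by simp
qed

lemma residual_sq:
  assumes o: "orthonormal m r u" and k: "k < m"
  shows "fin_sq m (residual r u k) = 1 - (\<Sum>i<r. (cmod (u i k))\<^sup>2)"
proof -
  let ?d = "residual r u k"
  have "fin_inner m ?d ?d = fin_inner m ?d (unit_seq k) - (\<Sum>i<r. cnj (u i k) * fin_inner m ?d (u i))"
    by (subst (2) residual_def) (simp only: fin_inner_diff fin_inner_sum fin_inner_scale)
  also have "(\<Sum>i<r. cnj (u i k) * fin_inner m ?d (u i)) = 0"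
    using residual_orthogonal[OF o _ k] cnj_fin_inner[of m _ ?d]
    by (intro sum.neutral) (metis complex_cnj_zero lessThan_iff mult_zero_right)
  also have "fin_inner m ?d (unit_seq k) = of_real (1 - (\<Sum>i<r. (cmod (u i k))\<^sup>2))"
  proof -
    have "cnj (?d k) = 1 - (\<Sum>i<r. u i k * cnj (u i k))"
      unfolding residual_def unit_seq_def by simp
    also have "(\<Sum>i<r. u i k * cnj (u i k)) = of_real (\<Sum>i<r. (cmod (u i k))\<^sup>2)"
      unfolding of_real_sum by (intro sum.cong refl) (simp only: complex_norm_square)
    finally show ?thesis unfolding fin_inner_unit[OF k] by simp
  qed
  finally have "of_real (fin_sq m ?d) = complex_of_real (1 - (\<Sum>i<r. (cmod (u i k))\<^sup>2))"
    unfolding fin_inner_self by simp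
  then show ?thesis by (simp only: of_real_eq_iff)
qed

lemma residual_sum:
  assumes o: "orthonormal m r u"
  shows "(\<Sum>k<m. fin_sq m (residual r u k)) = real m - real r"
proof -
  have "(\<Sum>k<m. \<Sum>i<r. (cmod (u i k))\<^sup>2) = (\<Sum>i<r. fin_sq m (u i))"
    unfolding fin_sq_def by (rule sum.swap)
  also have "\<dots> = (\<Sum>i<r. 1)"
  proof (intro sum.cong refl)
    fix i assume "i \<in> {..<r}"
    then have "complex_of_real (fin_sq m (u i)) = of_real 1"
      using o unfolding orthonormal_def fin_inner_self[symmetric] by simp
    then show "fin_sq m (u i) = 1" by (simp only: of_real_eq_iff)
  qed
  finally show ?thesis by (simp add: residual_sq[OF o] sum_subtractf)
qed

text \<open>The residuals of the \<open>m\<close> unit vectors have total square norm \<open>m - r\<close>: this gives both a unit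
  vector orthogonal to the \<open>u\<^sub>i\<close> if \<open>r < m\<close>, and completeness if \<open>r = m\<close>.\<close>

lemma orthonormal_complete:
  assumes o: "orthonormal m m u" and k: "k < m" and l: "l < m"
  shows "(\<Sum>i<m. cnj (u i k) * u i l) = unit_seq k l"
proof -
  have "(\<Sum>k<m. fin_sq m (residual m u k)) = 0" using residual_sum[OF o] by simp
  then have "fin_sq m (residual m u k) = 0"
    using k fin_sq_nonneg by (subst (asm) sum_nonneg_eq_0_iff) auto
  from fin_sq_eq_0[OF this l] show ?thesis unfolding residual_def by simp
qed

definition eigen_system :: "nat \<Rightarrow> (nat \<Rightarrow> nat \<Rightarrow> complex) \<Rightarrow> nat \<Rightarrow> (nat \<Rightarrow> nat \<Rightarrow> complex) \<Rightarrow> (nat \<Rightarrow> real) \<Rightarrow> bool" where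
  "eigen_system m A r u la \<longleftrightarrow> orthonormal m r u \<and>
     (\<forall>i<r. \<forall>k<m. fin_app m A (u i) k = of_real (la i) * u i k)"

definition ortho_sphere :: "nat \<Rightarrow> nat \<Rightarrow> (nat \<Rightarrow> nat \<Rightarrow> complex) \<Rightarrow> (nat \<Rightarrow> complex) set" where
  "ortho_sphere m r u = {v. (\<forall>k\<ge>m. v k = 0) \<and> fin_sq m v = 1 \<and> (\<forall>i<r. fin_inner m (u i) v = 0)}"

lemma continuous_on_coord: "continuous_on S (\<lambda>v::nat \<Rightarrow> complex. v k)"
  by (rule continuous_on_subset[OF continuous_on_product_coordinates]) simp

text \<open>Vectors are infinite sequences under the product topology. Since these vanish from m on,
  the sphere is a closed subset of a product of discs and single points, which is compact by
  Tychonoff.\<close>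

lemma compact_ortho_sphere: "compact (ortho_sphere m r u)"
proof -
  define K where "K = (\<Pi>\<^sub>E k\<in>(UNIV::nat set). if k < m then cball (0::complex) 1 else {0})"
  have "compactin (product_topology (\<lambda>_. euclidean) UNIV) K"
    unfolding K_def compactin_PiE by auto
  then have K: "compact K" by (simp add: euclidean_product_topology)
  define C where "C = {v::nat \<Rightarrow> complex. fin_sq m v = 1} \<inter> (\<Inter>i<r. {v. fin_inner m (u i) v = 0})"
  have "closed C"
    unfolding C_def fin_sq_def fin_inner_def
    by (intro closed_Int closed_INT ballI closed_Collect_eq continuous_intros continuous_on_coord)
  moreover have "ortho_sphere m r u = K \<inter> C"
  proof (intro equalityI subsetI)
    fix v assume v: "v \<in> ortho_sphere m r u"
    have "cmod (v k) \<le> 1" if "k < m" for k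
    proof (rule power2_le_imp_le)
      have "(cmod (v k))\<^sup>2 \<le> fin_sq m v" unfolding fin_sq_def using that by (intro member_le_sum) auto
      then show "(cmod (v k))\<^sup>2 \<le> 1\<^sup>2" using v unfolding ortho_sphere_def by simp
    qed simp
    then show "v \<in> K \<inter> C" using v unfolding K_def C_def ortho_sphere_def by (auto simp: PiE_iff)
  next
    fix v assume v: "v \<in> K \<inter> C"
    have "v k = 0" if "m \<le> k" for k
    proof -
      have "v k \<in> (if k < m then cball 0 1 else {0})" using v unfolding K_def by (simp add: PiE_iff)
      then show ?thesis using that by simp
    qed
    then show "v \<in> ortho_sphere m r u" using v unfolding C_def ortho_sphere_def by auto
  qed
  ultimately show ?thesis using K compact_Int_closed by metis
qed

lemma ortho_sphere_nonempty:
  assumes o: "orthonormal m r u" and r: "r < m"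
  shows "ortho_sphere m r u \<noteq> {}"
proof -
  have "\<exists>k<m. fin_sq m (residual r u k) \<noteq> 0"
  proof (rule ccontr)
    assume "\<not> ?thesis"
    then have "(\<Sum>k<m. fin_sq m (residual r u k)) = 0" by simp
    then show False using residual_sum[OF o] r by simp
  qed
  then obtain k where k: "k < m" "fin_sq m (residual r u k) \<noteq> 0" by blast
  define s where "s = fin_sq m (residual r u k)"
  have s: "0 < s" using k fin_sq_nonneg unfolding s_def by (metis less_eq_real_def)
  define v where "v = (\<lambda>l. of_real (1 / sqrt s) * residual r u k l)"
  have "fin_sq m v = 1"
    unfolding v_def fin_sq_scale s_def[symmetric] using s by (simp add: power_divide norm_divide)
  moreover have "fin_inner m (u i) v = 0" if "i < r" for i
    unfolding v_def fin_inner_scale residual_orthogonal[OF o that k(1)] by simp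
  moreover have "v l = 0" if "m \<le> l" for l
    using o that k unfolding v_def residual_def unit_seq_def orthonormal_def by auto
  ultimately have "v \<in> ortho_sphere m r u" unfolding ortho_sphere_def by simp
  then show ?thesis by blast
qed

text \<open>The next eigenvector maximises the Rayleigh form on the unit sphere orthogonal to those
  already found, and the maximum is its eigenvalue.\<close>

lemma eigen_system_step:
  assumes h: "\<And>j k. cnj (A j k) = A k j" and e: "eigen_system m A r u la" and r: "r < m"
  obtains v \<mu> where "v \<in> ortho_sphere m r u" "\<And>k. k < m \<Longrightarrow> fin_app m A v k = of_real \<mu> * v k"
proof -
  have o: "orthonormal m r u" using e unfolding eigen_system_def by blast
  define q where "q = (\<lambda>v. Re (fin_inner m v (fin_app m A v)))"
  have "continuous_on (ortho_sphere m r u) q"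
    unfolding q_def fin_inner_def fin_app_def by (intro continuous_intros continuous_on_coord)
  then obtain v where v: "v \<in> ortho_sphere m r u" and max: "\<And>w. w \<in> ortho_sphere m r u \<Longrightarrow> q w \<le> q v"
    using continuous_attains_sup[OF compact_ortho_sphere ortho_sphere_nonempty[OF o r]] by blast
  define \<mu> where "\<mu> = q v"
  have v1: "fin_sq m v = 1" and vo: "\<And>i. i < r \<Longrightarrow> fin_inner m (u i) v = 0" and vs: "\<And>k. m \<le> k \<Longrightarrow> v k = 0"
    using v unfolding ortho_sphere_def by auto
  have bound: "q w \<le> \<mu> * fin_sq m w"
    if ws: "\<And>k. m \<le> k \<Longrightarrow> w k = 0" and wo: "\<And>i. i < r \<Longrightarrow> fin_inner m (u i) w = 0" for w
  proof (cases "fin_sq m w = 0")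
    case True
    then have "q w = 0" unfolding q_def fin_inner_def using fin_sq_eq_0[OF True] by simp
    then show ?thesis using True by simp
  next
    case False
    define s where "s = fin_sq m w"
    have s: "0 < s" using False fin_sq_nonneg unfolding s_def by (metis less_eq_real_def)
    define z where "z = (\<lambda>l. of_real (1 / sqrt s) * w l)"
    have "fin_sq m z = 1"
      unfolding z_def fin_sq_scale s_def[symmetric] using s by (simp add: power_divide norm_divide)
    moreover have "fin_inner m (u i) z = 0" if "i < r" for i
      unfolding z_def fin_inner_scale wo[OF that] by simp
    moreover have "z k = 0" if "m \<le> k" for k unfolding z_def ws[OF that] by simp
    ultimately have "z \<in> ortho_sphere m r u" unfolding ortho_sphere_def by simp
    then have "q z \<le> \<mu>" using max unfolding \<mu>_def by blast
    moreover have "q z = q w / s"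
    proof -
      have "fin_inner m z (fin_app m A z) = of_real (1 / sqrt s) * of_real (1 / sqrt s) * fin_inner m w (fin_app m A w)"
        unfolding z_def fin_app_scale fin_inner_scale by simp
      also have "of_real (1 / sqrt s) * of_real (1 / sqrt s) = complex_of_real (1 / s)"
        using s by (simp flip: of_real_mult)
      finally show ?thesis unfolding q_def by simp
    qed
    ultimately show ?thesis using s unfolding s_def[symmetric] by (simp add: pos_divide_le_eq)
  qed
  \<comment> \<open>The defect A v - mu v, cut off at m. It is orthogonal to every u_i because these
    are eigenvectors of the Hermitian A, so v + s w is an admissible competitor.\<close>
  define w where "w = (\<lambda>k. if k < m then fin_app m A v k - of_real \<mu> * v k else 0)"
  have wI: "fin_inner m x w = fin_inner m x (fin_app m A v) - of_real \<mu> * fin_inner m x v" for x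
    unfolding fin_inner_scale(1)[symmetric] fin_inner_diff[symmetric] unfolding fin_inner_def w_def by simp
  have wo: "fin_inner m (u i) w = 0" if i: "i < r" for i
  proof -
    have "fin_inner m (u i) (fin_app m A v) = fin_inner m (fin_app m A (u i)) v"
      by (rule fin_app_hermitian[OF h, symmetric])
    also have "\<dots> = fin_inner m (\<lambda>k. of_real (la i) * u i k) v"
      unfolding fin_inner_def using e i unfolding eigen_system_def by simp
    also have "\<dots> = 0" unfolding fin_inner_scale using vo[OF i] by simp
    finally show ?thesis unfolding wI using vo[OF i] by simp
  qed
  define c where "c = fin_sq m w"
  define K where "K = \<mu> * c - q w"
  have c0: "0 \<le> c" unfolding c_def by (rule fin_sq_nonneg)
  have K0: "0 \<le> K" using bound[of w] wo unfolding K_def c_def w_def by simp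
  \<comment> \<open>Along v + s w the difference between the form and mu times the square norm is 2
    s c - s^2 K, which maximality makes nonpositive. The small step s = c / (K + 1) then forces c =
    0.\<close>
  have ineq: "2 * s * c \<le> s\<^sup>2 * K" for s :: real
  proof -
    define z where "z = (\<lambda>k. v k + of_real s * w k)"
    have zw: "fin_inner m w (fin_app m A v) = of_real c + of_real \<mu> * fin_inner m w v"
      using wI[of w] unfolding fin_inner_self c_def by simp
    have qz: "q z = \<mu> + 2 * s * Re (fin_inner m w (fin_app m A v)) + s\<^sup>2 * q w"
    proof -
      have "fin_inner m v (fin_app m A w) = cnj (fin_inner m w (fin_app m A v))"
        unfolding cnj_fin_inner by (rule fin_app_hermitian[OF h, symmetric])
      then show ?thesis
        unfolding q_def z_def fin_app_add fin_app_scale fin_inner_add fin_inner_scale \<mu>_def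
        by (simp add: power2_eq_square algebra_simps)
    qed
    have sz: "fin_sq m z = 1 + 2 * s * Re (fin_inner m w v) + s\<^sup>2 * c"
    proof -
      have "complex_of_real (fin_sq m z) = fin_inner m v v + of_real s * (fin_inner m v w + fin_inner m w v) + of_real (s\<^sup>2) * fin_inner m w w"
        unfolding fin_inner_self[symmetric] z_def fin_inner_add fin_inner_scale
        by (simp add: power2_eq_square algebra_simps)
      also have "fin_inner m v w = cnj (fin_inner m w v)" unfolding cnj_fin_inner ..
      finally have "Re (complex_of_real (fin_sq m z)) = Re (fin_inner m v v + of_real s * (cnj (fin_inner m w v) + fin_inner m w v) + of_real (s\<^sup>2) * fin_inner m w w)"
        by (rule arg_cong)
      then show ?thesis unfolding fin_inner_self v1 c_def by simp
    qed
    have "q z \<le> \<mu> * fin_sq m z"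
    proof (rule bound)
      show "z k = 0" if "m \<le> k" for k using that vs unfolding z_def w_def by simp
      show "fin_inner m (u i) z = 0" if "i < r" for i
        unfolding z_def fin_inner_add fin_inner_scale using vo wo that by simp
    qed
    then show ?thesis unfolding qz sz zw K_def by (simp add: algebra_simps)
  qed
  have "2 * (c / (K + 1)) * c \<le> (c / (K + 1))\<^sup>2 * K" by (rule ineq)
  also have "\<dots> = c / (K + 1) * c * (K / (K + 1))" by (simp add: power2_eq_square)
  also have "\<dots> \<le> c / (K + 1) * c * 1" using c0 K0 by (intro mult_left_mono) auto
  finally have "c / (K + 1) * c \<le> 0" by simp
  then have "c * c \<le> 0" using K0 by (simp add: divide_le_0_iff)
  then have "c = 0" using c0 by (simp add: mult_le_0_iff)
  have "fin_app m A v k = of_real \<mu> * v k" if "k < m" for k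
    using fin_sq_eq_0[of m w, OF _ that] \<open>c = 0\<close> that unfolding c_def w_def by simp
  then show ?thesis using that v by blast
qed

lemma eigen_system_exists:
  assumes h: "\<And>j k. cnj (A j k) = A k j" and "r \<le> m"
  shows "\<exists>u la. eigen_system m A r u la"
  using assms(2)
proof (induction r)
  case 0
  then show ?case unfolding eigen_system_def orthonormal_def by simp
next
  case (Suc r)
  then obtain u la where e: "eigen_system m A r u la" by auto
  then have o: "orthonormal m r u" unfolding eigen_system_def by blast
  obtain v \<mu> where v: "v \<in> ortho_sphere m r u" "\<And>k. k < m \<Longrightarrow> fin_app m A v k = of_real \<mu> * v k"
    using eigen_system_step[OF h e] Suc.prems by auto
  have vu: "fin_inner m (u i) v = 0" "fin_inner m v (u i) = 0" if "i < r" for i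
    using v(1) that cnj_fin_inner[of m "u i" v] unfolding ortho_sphere_def by auto
  have vv: "fin_inner m v v = 1" using v(1) unfolding ortho_sphere_def fin_inner_self by simp
  have "orthonormal m (Suc r) (u(r := v))"
    using o v(1) vu vv unfolding orthonormal_def ortho_sphere_def by (auto simp: less_Suc_eq)
  moreover have "\<forall>i<Suc r. \<forall>k<m. fin_app m A ((u(r := v)) i) k = of_real ((la(r := \<mu>)) i) * (u(r := v)) i k"
    using e v(2) unfolding eigen_system_def by (auto simp: less_Suc_eq)
  ultimately show ?case unfolding eigen_system_def by blast
qed

section \<open>Functional calculus for finite sections\<close>

lemma sum_rotate: "(\<Sum>l\<in>L. \<Sum>i\<in>I. \<Sum>j\<in>J. f l i j) = (\<Sum>i\<in>I. \<Sum>j\<in>J. \<Sum>l\<in>L. f l i j)"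
proof -
  have "(\<Sum>l\<in>L. \<Sum>i\<in>I. \<Sum>j\<in>J. f l i j) = (\<Sum>i\<in>I. \<Sum>l\<in>L. \<Sum>j\<in>J. f l i j)" by (rule sum.swap)
  also have "\<dots> = (\<Sum>i\<in>I. \<Sum>j\<in>J. \<Sum>l\<in>L. f l i j)" by (intro sum.cong refl sum.swap)
  finally show ?thesis .
qed

text \<open>The sum of w_i times the rank-one matrix of u_i. With an eigenbasis u, the eigenvalues
  as weights return the section, and their absolute values return its absolute value.\<close>

definition spec_sum :: "nat \<Rightarrow> (nat \<Rightarrow> nat \<Rightarrow> complex) \<Rightarrow> (nat \<Rightarrow> real) \<Rightarrow> nat \<Rightarrow> nat \<Rightarrow> complex" where
  "spec_sum m u w = (\<lambda>k l. \<Sum>i<m. of_real (w i) * (u i k * cnj (u i l)))"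

lemma eigen_system_spec_sum:
  assumes e: "eigen_system m A m u la" and k: "k < m" and l: "l < m"
  shows "A k l = spec_sum m u la k l"
proof -
  have o: "orthonormal m m u" using e unfolding eigen_system_def by blast
  have "A k l = (\<Sum>p<m. A k p * unit_seq l p)" using l unfolding unit_seq_def by (simp add: if_distrib cong: if_cong)
  also have "\<dots> = (\<Sum>p<m. A k p * (\<Sum>i<m. cnj (u i l) * u i p))"
    using orthonormal_complete[OF o l] by simp
  also have "\<dots> = (\<Sum>p<m. \<Sum>i<m. cnj (u i l) * (A k p * u i p))"
    by (simp add: sum_distrib_left mult_ac)
  also have "\<dots> = (\<Sum>i<m. cnj (u i l) * fin_app m A (u i) k)"
    unfolding fin_app_def sum_distrib_left by (rule sum.swap)
  also have "\<dots> = spec_sum m u la k l"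
    using e k unfolding eigen_system_def spec_sum_def by (intro sum.cong refl) (simp add: mult_ac)
  finally show ?thesis .
qed

lemma spec_sum_hermitian: "cnj (spec_sum m u w j k) = spec_sum m u w k j"
  unfolding spec_sum_def by (simp add: mult_ac)

lemma spec_sum_outside:
  assumes "orthonormal m r u" "r = m" "m \<le> k \<or> m \<le> l"
  shows "spec_sum m u w k l = 0"
  using assms unfolding spec_sum_def orthonormal_def by (intro sum.neutral) auto

lemma spec_sum_mult:
  assumes o: "orthonormal m m u"
  shows "(\<Sum>p<m. spec_sum m u w j p * spec_sum m u w' p k) = spec_sum m u (\<lambda>i. w i * w' i) j k"
proof -
  have "(\<Sum>p<m. spec_sum m u w j p * spec_sum m u w' p k)
      = (\<Sum>p<m. \<Sum>i<m. \<Sum>i'<m. of_real (w i * w' i') * (u i j * cnj (u i' k)) * (cnj (u i p) * u i' p))"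
    unfolding spec_sum_def sum_product by (intro sum.cong refl) (simp add: mult_ac)
  also have "\<dots> = (\<Sum>i<m. \<Sum>i'<m. of_real (w i * w' i') * (u i j * cnj (u i' k)) * fin_inner m (u i) (u i'))"
    unfolding fin_inner_def sum_distrib_left by (rule sum_rotate)
  also have "\<dots> = (\<Sum>i<m. \<Sum>i'<m. if i' = i then of_real (w i * w' i') * (u i j * cnj (u i' k)) else 0)"
    using o unfolding orthonormal_def by (intro sum.cong refl) auto
  also have "\<dots> = spec_sum m u (\<lambda>i. w i * w' i) j k" unfolding spec_sum_def by simp
  finally show ?thesis .
qed

text \<open>The Hilbert--Schmidt inner product of two spectral sums has the coefficients
  \<open>|\<langle>u\<^sub>i, v\<^sub>j\<rangle>|\<^sup>2 \<ge> 0\<close>, so it does not decrease when the eigenvalues are replaced by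
  their absolute values.\<close>

lemma spec_sum_hs_inner:
  "(\<Sum>k<p. \<Sum>l<p. cnj (spec_sum m u w k l) * spec_sum n v w' k l)
    = of_real (\<Sum>i<m. \<Sum>j<n. w i * w' j * (cmod (fin_inner p (u i) (v j)))\<^sup>2)"
proof -
  have "(\<Sum>k<p. \<Sum>l<p. cnj (spec_sum m u w k l) * spec_sum n v w' k l)
      = (\<Sum>k<p. \<Sum>l<p. \<Sum>i<m. \<Sum>j<n. of_real (w i * w' j) * ((cnj (u i k) * v j k) * (u i l * cnj (v j l))))"
    unfolding spec_sum_def cnj_sum sum_product by (intro sum.cong refl) (simp add: mult_ac)
  also have "\<dots> = (\<Sum>k<p. \<Sum>i<m. \<Sum>j<n. \<Sum>l<p. of_real (w i * w' j) * ((cnj (u i k) * v j k) * (u i l * cnj (v j l))))"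
    by (intro sum.cong refl sum_rotate)
  also have "\<dots> = (\<Sum>i<m. \<Sum>j<n. \<Sum>k<p. \<Sum>l<p. of_real (w i * w' j) * ((cnj (u i k) * v j k) * (u i l * cnj (v j l))))"
    by (rule sum_rotate)
  also have "\<dots> = (\<Sum>i<m. \<Sum>j<n. of_real (w i * w' j) * (fin_inner p (u i) (v j) * cnj (fin_inner p (u i) (v j))))"
    unfolding fin_inner_def cnj_sum sum_product unfolding sum_distrib_left by simp
  also have "\<dots> = of_real (\<Sum>i<m. \<Sum>j<n. w i * w' j * (cmod (fin_inner p (u i) (v j)))\<^sup>2)"
    unfolding complex_norm_square[symmetric] by simp
  finally show ?thesis .
qed

lemma sum_cmod_diff_sq:
  "(\<Sum>k<p. \<Sum>l<p. (cmod (B k l - C k l))\<^sup>2) = (\<Sum>k<p. \<Sum>l<p. (cmod (B k l))\<^sup>2) + (\<Sum>k<p. \<Sum>l<p. (cmod (C k l))\<^sup>2)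
    - 2 * Re (\<Sum>k<p. \<Sum>l<p. cnj (B k l) * C k l)"
proof -
  have "(cmod (b - c))\<^sup>2 = (cmod b)\<^sup>2 + (cmod c)\<^sup>2 - 2 * Re (cnj b * c)" for b c
    unfolding cmod_power2 by (simp add: power2_eq_square algebra_simps)
  then show ?thesis by (simp add: sum.distrib sum_subtractf sum_distrib_left)
qed

lemma sum_cmod_sq: "of_real (\<Sum>k<p. \<Sum>l<p. (cmod (B k l))\<^sup>2) = (\<Sum>k<p. \<Sum>l<p. cnj (B k l) * B k l)"
  unfolding of_real_sum by (intro sum.cong refl) (simp only: complex_norm_square mult.commute)

lemma spec_sum_abs_sq:
  assumes o: "orthonormal m m u" and mp: "m \<le> p"
  shows "(\<Sum>k<p. \<Sum>l<p. (cmod (spec_sum m u w k l))\<^sup>2) = (\<Sum>i<m. (w i)\<^sup>2)"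
proof -
  have ip: "fin_inner p (u i) (u j) = (if i = j then 1 else 0)" if ij: "i < m" "j < m" for i j
  proof -
    have "fin_inner p (u i) (u j) = fin_inner m (u i) (u j)"
      unfolding fin_inner_def
      by (rule sum.mono_neutral_right) (use mp o ij in \<open>auto simp: orthonormal_def\<close>)
    then show ?thesis using o ij unfolding orthonormal_def by simp
  qed
  have "of_real (\<Sum>k<p. \<Sum>l<p. (cmod (spec_sum m u w k l))\<^sup>2)
      = complex_of_real (\<Sum>i<m. \<Sum>j<m. w i * w j * (cmod (fin_inner p (u i) (u j)))\<^sup>2)"
    unfolding sum_cmod_sq by (rule spec_sum_hs_inner)
  also have "(\<Sum>i<m. \<Sum>j<m. w i * w j * (cmod (fin_inner p (u i) (u j)))\<^sup>2) = (\<Sum>i<m. \<Sum>j<m. if j = i then w i * w j else 0)"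
    by (intro sum.cong refl) (simp add: ip)
  also have "\<dots> = (\<Sum>i<m. (w i)\<^sup>2)" by (simp add: power2_eq_square)
  finally show ?thesis by (simp only: of_real_eq_iff)
qed

text \<open>Taking absolute values leaves both square norms unchanged and can only enlarge the mixed
  term. Different sizes m and n are allowed so that sections of one matrix can be compared with each
  other.\<close>

lemma spec_sum_abs_lipschitz:
  assumes o: "orthonormal m m u" "orthonormal n n v" and p: "m \<le> p" "n \<le> p"
  shows "(\<Sum>k<p. \<Sum>l<p. (cmod (spec_sum m u (\<lambda>i. \<bar>w i\<bar>) k l - spec_sum n v (\<lambda>i. \<bar>w' i\<bar>) k l))\<^sup>2)
    \<le> (\<Sum>k<p. \<Sum>l<p. (cmod (spec_sum m u w k l - spec_sum n v w' k l))\<^sup>2)"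
proof -
  have "(\<Sum>i<m. \<Sum>j<n. w i * w' j * (cmod (fin_inner p (u i) (v j)))\<^sup>2)
      \<le> (\<Sum>i<m. \<Sum>j<n. \<bar>w i\<bar> * \<bar>w' j\<bar> * (cmod (fin_inner p (u i) (v j)))\<^sup>2)"
    by (intro sum_mono mult_right_mono) (auto simp flip: abs_mult)
  then show ?thesis
    unfolding sum_cmod_diff_sq spec_sum_abs_sq[OF o(1) p(1)] spec_sum_abs_sq[OF o(2) p(2)] spec_sum_hs_inner by simp
qed

lemma fin_form_spec_sum:
  "fin_form n (spec_sum m u w) v = of_real (\<Sum>i<m. w i * (cmod (fin_inner n (u i) v))\<^sup>2)"
proof -
  have "fin_form n (spec_sum m u w) v = (\<Sum>j<n. \<Sum>k<n. \<Sum>i<m. of_real (w i) * ((cnj (u i k) * v k) * (u i j * cnj (v j))))"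
    unfolding fin_form_def spec_sum_def sum_distrib_left sum_distrib_right
    by (intro sum.cong refl) (simp add: mult_ac)
  also have "\<dots> = (\<Sum>k<n. \<Sum>j<n. \<Sum>i<m. of_real (w i) * ((cnj (u i k) * v k) * (u i j * cnj (v j))))"
    by (rule sum.swap)
  also have "\<dots> = (\<Sum>i<m. \<Sum>k<n. \<Sum>j<n. of_real (w i) * ((cnj (u i k) * v k) * (u i j * cnj (v j))))"
    by (rule sum_rotate[symmetric])
  also have "\<dots> = (\<Sum>i<m. of_real (w i) * (fin_inner n (u i) v * cnj (fin_inner n (u i) v)))"
    unfolding fin_inner_def cnj_sum sum_product unfolding sum_distrib_left by simp
  also have "\<dots> = of_real (\<Sum>i<m. w i * (cmod (fin_inner n (u i) v))\<^sup>2)"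
    unfolding complex_norm_square[symmetric] by simp
  finally show ?thesis .
qed

lemma spec_sum_trace:
  assumes o: "orthonormal m m u"
  shows "(\<Sum>k<m. spec_sum m u w k k) = of_real (\<Sum>i<m. w i)"
proof -
  have "(\<Sum>k<m. spec_sum m u w k k) = (\<Sum>i<m. of_real (w i) * fin_inner m (u i) (u i))"
    unfolding spec_sum_def fin_inner_def sum_distrib_left by (subst sum.swap) (simp add: mult_ac)
  also have "\<dots> = of_real (\<Sum>i<m. w i)" using o unfolding orthonormal_def by simp
  finally show ?thesis .
qed

lemma sum_fin_form_basis:
  assumes o: "orthonormal m m u"
  shows "(\<Sum>i<m. fin_form m M (u i)) = (\<Sum>k<m. M k k)"
proof -
  have "(\<Sum>i<m. fin_form m M (u i)) = (\<Sum>j<m. \<Sum>k<m. M j k * (\<Sum>i<m. cnj (u i j) * u i k))"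
    unfolding fin_form_def by (subst sum_rotate) (simp add: sum_distrib_left mult_ac)
  also have "\<dots> = (\<Sum>j<m. \<Sum>k<m. if k = j then M j k else 0)"
    using orthonormal_complete[OF o] by (intro sum.cong refl) (auto simp: unit_seq_def)
  also have "\<dots> = (\<Sum>k<m. M k k)" by simp
  finally show ?thesis .
qed

text \<open>The trace of \<open>|A|\<close> is \<open>\<Sum> |\<langle>u\<^sub>i, A u\<^sub>i\<rangle>|\<close> over an eigenbasis, whence it is at most the trace of \<open>M\<close>
  if \<open>-M \<le> A \<le> M\<close>.\<close>

lemma spec_sum_abs_trace_le:
  assumes e: "eigen_system m A m u la" and M: "\<And>v. \<bar>Re (fin_form m A v)\<bar> \<le> Re (fin_form m M v)"
  shows "(\<Sum>i<m. \<bar>la i\<bar>) \<le> Re (\<Sum>k<m. M k k)"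
proof -
  have o: "orthonormal m m u" using e unfolding eigen_system_def by blast
  have "\<bar>la i\<bar> \<le> Re (fin_form m M (u i))" if i: "i < m" for i
  proof -
    have "fin_form m A (u i) = fin_inner m (u i) (fin_app m A (u i))"
      unfolding fin_form_def fin_inner_def fin_app_def by (simp add: sum_distrib_left mult_ac)
    also have "\<dots> = fin_inner m (u i) (\<lambda>k. of_real (la i) * u i k)"
      unfolding fin_inner_def using e i unfolding eigen_system_def by simp
    also have "\<dots> = of_real (la i)" unfolding fin_inner_scale using o i unfolding orthonormal_def by simp
    finally show ?thesis using M[of "u i"] by simp
  qed
  then have "(\<Sum>i<m. \<bar>la i\<bar>) \<le> (\<Sum>i<m. Re (fin_form m M (u i)))" by (intro sum_mono) auto
  also have "\<dots> = Re (\<Sum>k<m. M k k)" unfolding sum_fin_form_basis[OF o, symmetric] by simp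
  finally show ?thesis .
qed

subsection \<open>The absolute value of a Hilbert--Schmidt matrix\<close>

lemma cmod_sum_mult_le:
  assumes "(\<Sum>l\<in>I. (cmod (a l))\<^sup>2) \<le> C" "(\<Sum>l\<in>I. (cmod (b l))\<^sup>2) \<le> D"
  shows "cmod (\<Sum>l\<in>I. a l * b l) \<le> sqrt (C * D)"
proof (rule real_le_rsqrt)
  have "cmod (\<Sum>l\<in>I. a l * b l) \<le> (\<Sum>l\<in>I. cmod (a l) * cmod (b l))"
    unfolding norm_mult[symmetric] by (rule norm_sum)
  then have "(cmod (\<Sum>l\<in>I. a l * b l))\<^sup>2 \<le> (\<Sum>l\<in>I. cmod (a l) * cmod (b l))\<^sup>2"
    by (intro power_mono) auto
  also have "\<dots> \<le> (\<Sum>l\<in>I. (cmod (a l))\<^sup>2) * (\<Sum>l\<in>I. (cmod (b l))\<^sup>2)" by (rule Cauchy_Schwarz_ineq_sum)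
  also have "\<dots> \<le> C * D"
  proof (rule mult_mono[OF assms])
    show "0 \<le> C" by (rule order_trans[OF _ assms(1)]) (intro sum_nonneg zero_le_power2)
    show "0 \<le> (\<Sum>l\<in>I. (cmod (b l))\<^sup>2)" by (intro sum_nonneg zero_le_power2)
  qed
  finally show "(cmod (\<Sum>l\<in>I. a l * b l))\<^sup>2 \<le> C * D" .
qed

lemma sum_row_le: "j < (K::nat) \<Longrightarrow> (\<Sum>l<n. (cmod (A j l))\<^sup>2) \<le> (\<Sum>k<K. \<Sum>l<n. (cmod (A k l))\<^sup>2)"
  by (rule member_le_sum[where f = "\<lambda>k. \<Sum>l<n. (cmod (A k l))\<^sup>2"]) (auto intro!: sum_nonneg)

lemma sum_square_mono: "K \<le> (p::nat) \<Longrightarrow> (\<Sum>k<K. \<Sum>l<K. (cmod (A k l))\<^sup>2) \<le> (\<Sum>k<p. \<Sum>l<p. (cmod (A k l))\<^sup>2)"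
  by (rule order_trans[OF sum_mono sum_mono2]) (auto intro!: sum_mono2 sum_nonneg)

text \<open>Let N m be the squared Hilbert--Schmidt norm of the m-th section and L its limit. The
  absolute values of the sections m and p differ by at most N p - N m <= L - N m in squared norm, so
  they converge entrywise, with an error bound uniform over all squares. This uniformity lets the
  products converge as well.\<close>

lemma abs_mat_exists:
  assumes h: "\<And>j k. cnj (A j k) = A k j" and A: "hs_le A B"
    and M: "\<And>m v. \<bar>Re (fin_form m A v)\<bar> \<le> Re (fin_form m M v)" "\<And>m. Re (\<Sum>k<m. M k k) \<le> \<tau>"
  obtains P where "psd_mat P" "mat_mult P P = mat_mult A A" "\<And>K. (\<Sum>k<K. Re (P k k)) \<le> \<tau>"
proof -
  have "\<forall>m. \<exists>s. eigen_system m A m (fst s) (snd s)"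
  proof
    fix m
    obtain u la where "eigen_system m A m u la" using eigen_system_exists[of A, OF h order_refl] by blast
    then show "\<exists>s. eigen_system m A m (fst s) (snd s)" by (intro exI[of _ "(u, la)"]) simp
  qed
  from choice[OF this] obtain s where s: "\<forall>m. eigen_system m A m (fst (s m)) (snd (s m))" by blast
  define u where "u = (\<lambda>m. fst (s m))"
  define la where "la = (\<lambda>m. snd (s m))"
  have e: "eigen_system m A m (u m) (la m)" for m using s unfolding u_def la_def by blast
  then have o: "orthonormal m m (u m)" for m unfolding eigen_system_def by blast
  define Pm where "Pm = (\<lambda>m. spec_sum m (u m) (\<lambda>i. \<bar>la m i\<bar>))"
  define S where "S = (\<lambda>m. spec_sum m (u m) (la m))"
  have out: "spec_sum m (u m) w k l = 0" if "m \<le> k \<or> m \<le> l" for m w k l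
    by (rule spec_sum_outside[OF o refl that])
  have S: "S m k l = (if k < m \<and> l < m then A k l else 0)" for m k l
    unfolding S_def using eigen_system_spec_sum[OF e] out by (auto simp: not_less)
  define N where "N = (\<lambda>m. \<Sum>k<m. \<Sum>l<m. (cmod (A k l))\<^sup>2)"
  have "incseq N" unfolding N_def incseq_def by (intro allI impI sum_square_mono)
  moreover have "N m \<le> B" for m unfolding N_def by (rule hs_leD[OF A])
  ultimately obtain L where L: "N \<longlonglongrightarrow> L" "\<And>m. N m \<le> L" using incseq_convergent by blast
  have B0: "0 \<le> B" by (rule hs_le_nonneg[OF A])
  have SN: "(\<Sum>k<p. \<Sum>l<p. (cmod (S m k l))\<^sup>2) = N m" if "m \<le> p" for m p
  proof -
    have "(\<Sum>k<p. \<Sum>l<p. (cmod (S m k l))\<^sup>2) = (\<Sum>k<m. \<Sum>l<p. (cmod (S m k l))\<^sup>2)"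
      by (rule sum.mono_neutral_right) (use that in \<open>auto simp: S\<close>)
    also have "\<dots> = (\<Sum>k<m. \<Sum>l<m. (cmod (S m k l))\<^sup>2)"
      by (intro sum.cong refl sum.mono_neutral_right) (use that in \<open>auto simp: S\<close>)
    finally show ?thesis unfolding N_def by (simp add: S)
  qed
  have PN: "(\<Sum>k<K. \<Sum>l<K. (cmod (Pm m k l))\<^sup>2) \<le> B" for K m
  proof -
    have "(\<Sum>k<K. \<Sum>l<K. (cmod (Pm m k l))\<^sup>2) \<le> (\<Sum>k<max K m. \<Sum>l<max K m. (cmod (Pm m k l))\<^sup>2)"
      by (rule sum_square_mono) simp
    also have "\<dots> = (\<Sum>k<max K m. \<Sum>l<max K m. (cmod (S m k l))\<^sup>2)"
      unfolding Pm_def S_def by (simp add: spec_sum_abs_sq[OF o])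
    also have "\<dots> = N m" by (rule SN) simp
    finally show ?thesis using \<open>N m \<le> B\<close> by linarith
  qed
  have lip: "(\<Sum>k<p. \<Sum>l<p. (cmod (Pm m k l - Pm p k l))\<^sup>2) \<le> L - N m" if "m \<le> p" for m p
  proof -
    have "(\<Sum>k<p. \<Sum>l<p. (cmod (Pm m k l - Pm p k l))\<^sup>2) \<le> (\<Sum>k<p. \<Sum>l<p. (cmod (S m k l - S p k l))\<^sup>2)"
      unfolding Pm_def S_def by (rule spec_sum_abs_lipschitz[OF o o that order_refl])
    \<comment> \<open>Each entry of S m is either that of S p or 0, so the square of the difference
      is the difference of the squares.\<close>
    also have "\<dots> = (\<Sum>k<p. \<Sum>l<p. (cmod (S p k l))\<^sup>2 - (cmod (S m k l))\<^sup>2)"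
      by (intro sum.cong refl) (use that in \<open>auto simp: S\<close>)
    also have "\<dots> = N p - N m" using SN[OF that] SN[of p p] by (simp add: sum_subtractf)
    finally show ?thesis using L(2)[of p] by linarith
  qed
  have lipK: "(\<Sum>k<K. \<Sum>l<K. (cmod (Pm m k l - Pm p k l))\<^sup>2) \<le> L - N m" if "m \<le> p" "K \<le> p" for K m p
    using sum_square_mono[OF that(2), of "\<lambda>k l. Pm m k l - Pm p k l"] lip[OF that(1)] by linarith
  have eps0: "(\<lambda>m. L - N m) \<longlonglongrightarrow> 0" using tendsto_diff[OF tendsto_const L(1), of L] by simp
  have "convergent (\<lambda>m. Pm m k l)" for k l
  proof (rule Cauchy_convergent, rule CauchyI')
    fix r :: real assume r: "0 < r"
    then have "\<forall>\<^sub>F m in sequentially. L - N m < r\<^sup>2" using order_tendstoD(2)[OF eps0, of "r\<^sup>2"] by simp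
    then obtain m0 where m0: "\<And>m. m0 \<le> m \<Longrightarrow> L - N m < r\<^sup>2" unfolding eventually_sequentially by blast
    show "\<exists>M. \<forall>m\<ge>M. \<forall>n>m. dist (Pm m k l) (Pm n k l) < r" unfolding dist_norm
    proof (intro exI[of _ "max m0 (Suc (max k l))"] allI impI)
      fix m n assume m: "max m0 (Suc (max k l)) \<le> m" "m < n"
      have "(cmod (Pm m k l - Pm n k l))\<^sup>2 \<le> (\<Sum>j<n. (cmod (Pm m k j - Pm n k j))\<^sup>2)"
        using m by (intro member_le_sum[where f = "\<lambda>j. (cmod (Pm m k j - Pm n k j))\<^sup>2"]) auto
      also have "\<dots> \<le> (\<Sum>i<n. \<Sum>j<n. (cmod (Pm m i j - Pm n i j))\<^sup>2)"
        using m by (intro sum_row_le[where A = "\<lambda>i j. Pm m i j - Pm n i j"]) auto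
      also have "\<dots> \<le> L - N m" using m by (intro lip) auto
      also have "\<dots> < r\<^sup>2" using m by (intro m0) auto
      finally show "cmod (Pm m k l - Pm n k l) < r" by (rule power2_less_imp_less) (use r in simp)
    qed
  qed
  then have P: "(\<lambda>m. Pm m k l) \<longlonglongrightarrow> P k l" if "P = (\<lambda>k l. lim (\<lambda>m. Pm m k l))" for k l P
    unfolding that convergent_LIMSEQ_iff .
  define P where "P = (\<lambda>k l. lim (\<lambda>m. Pm m k l))"
  note P = P[OF P_def]
  have dist: "(\<Sum>k<K. \<Sum>l<K. (cmod (Pm m k l - P k l))\<^sup>2) \<le> L - N m" for K m
  proof (rule LIMSEQ_le_const2)
    show "(\<lambda>p. \<Sum>k<K. \<Sum>l<K. (cmod (Pm m k l - Pm p k l))\<^sup>2) \<longlonglongrightarrow> (\<Sum>k<K. \<Sum>l<K. (cmod (Pm m k l - P k l))\<^sup>2)"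
      by (intro tendsto_intros P)
    show "\<exists>p0. \<forall>p\<ge>p0. (\<Sum>k<K. \<Sum>l<K. (cmod (Pm m k l - Pm p k l))\<^sup>2) \<le> L - N m"
      by (intro exI[of _ "max m K"] allI impI lipK) auto
  qed
  have hsP: "hs_le P B"
    unfolding hs_le_def
  proof
    fix K
    have "(\<lambda>m. \<Sum>k<K. \<Sum>l<K. (cmod (Pm m k l))\<^sup>2) \<longlonglongrightarrow> (\<Sum>k<K. \<Sum>l<K. (cmod (P k l))\<^sup>2)"
      by (intro tendsto_intros P)
    then show "(\<Sum>k<K. \<Sum>l<K. (cmod (P k l))\<^sup>2) \<le> B" by (rule LIMSEQ_le_const2) (use PN in auto)
  qed
  have "cnj (P k j) = P j k" for j k
  proof (rule LIMSEQ_unique)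
    show "(\<lambda>m. cnj (Pm m k j)) \<longlonglongrightarrow> cnj (P k j)" by (intro tendsto_intros P)
    show "(\<lambda>m. cnj (Pm m k j)) \<longlonglongrightarrow> P j k" unfolding Pm_def spec_sum_hermitian using P unfolding Pm_def .
  qed
  then have adj: "mat_adj P = P" unfolding mat_adj_def by (intro ext)
  have form: "0 \<le> Re (fin_form n P v)" for n v
  proof (rule LIMSEQ_le_const)
    show "(\<lambda>m. Re (fin_form n (Pm m) v)) \<longlonglongrightarrow> Re (fin_form n P v)"
      unfolding fin_form_def by (intro tendsto_intros P)
    show "\<exists>m0. \<forall>m\<ge>m0. 0 \<le> Re (fin_form n (Pm m) v)"
      unfolding Pm_def fin_form_spec_sum by (intro exI[of _ 0] allI impI) (simp add: sum_nonneg)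
  qed
  have psd: "psd_mat P" by (rule psd_mat_from_forms[OF hsP adj form])
  have diag0: "0 \<le> Re (Pm m k k)" for m k
  proof -
    have "Pm m k k = of_real (\<Sum>i<m. \<bar>la m i\<bar> * (cmod (u m i k))\<^sup>2)"
      unfolding Pm_def spec_sum_def complex_norm_square[symmetric] by simp
    then show ?thesis by (simp add: sum_nonneg)
  qed
  have trace: "(\<Sum>k<K. Re (P k k)) \<le> \<tau>" for K
  proof (rule LIMSEQ_le_const2)
    show "(\<lambda>m. \<Sum>k<K. Re (Pm m k k)) \<longlonglongrightarrow> (\<Sum>k<K. Re (P k k))" by (intro tendsto_intros P)
    show "\<exists>m0. \<forall>m\<ge>m0. (\<Sum>k<K. Re (Pm m k k)) \<le> \<tau>"
    proof (intro exI[of _ K] allI impI)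
      fix m assume m: "K \<le> m"
      have "(\<Sum>k<K. Re (Pm m k k)) \<le> (\<Sum>k<m. Re (Pm m k k))"
        using m diag0 by (intro sum_mono2) auto
      also have "\<dots> = Re (\<Sum>k<m. Pm m k k)" by simp
      also have "\<dots> = (\<Sum>i<m. \<bar>la m i\<bar>)" unfolding Pm_def spec_sum_trace[OF o] by simp
      also have "\<dots> \<le> \<tau>" using spec_sum_abs_trace_le[OF e M(1)] M(2) order_trans by blast
      finally show "(\<Sum>k<K. Re (Pm m k k)) \<le> \<tau>" .
    qed
  qed
  have "mat_mult P P j k = mat_mult A A j k" for j k
  proof (rule LIMSEQ_unique)
    show "(\<lambda>m. \<Sum>l<m. A j l * A l k) \<longlonglongrightarrow> mat_mult A A j k"
      unfolding mat_mult_def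
      by (intro summable_LIMSEQ ell2_mult_summable hs_le_ell2[OF A])
    \<comment> \<open>Squaring removes the absolute values, so on the section the square of
      \<open>Pm m\<close> is that of A cut to m. Its distance to the square of P splits as (Pm - P)
      Pm + P (Pm - P), and Cauchy-Schwarz bounds each half uniformly in n.\<close>
    have le: "cmod ((\<Sum>l<m. A j l * A l k) - mat_mult P P j k) \<le> 2 * sqrt ((L - N m) * B)"
      if m: "j < m" "k < m" for m
    proof (rule LIMSEQ_le_const2)
      show "(\<lambda>n. cmod ((\<Sum>l<m. A j l * A l k) - (\<Sum>l<n. P j l * P l k)))
          \<longlonglongrightarrow> cmod ((\<Sum>l<m. A j l * A l k) - mat_mult P P j k)"
        unfolding mat_mult_def
        by (intro tendsto_intros summable_LIMSEQ ell2_mult_summable hs_le_ell2[OF hsP])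
      show "\<exists>n0. \<forall>n\<ge>n0. cmod ((\<Sum>l<m. A j l * A l k) - (\<Sum>l<n. P j l * P l k)) \<le> 2 * sqrt ((L - N m) * B)"
      proof (intro exI[of _ m] allI impI)
        fix n assume n: "m \<le> n"
        have jk: "j < n" "k < n" using m n by auto
        have "(\<Sum>l<n. Pm m j l * Pm m l k) = (\<Sum>l<m. Pm m j l * Pm m l k)"
          by (rule sum.mono_neutral_right) (use n out in \<open>auto simp: Pm_def\<close>)
        also have "\<dots> = (\<Sum>l<m. S m j l * S m l k)"
          unfolding Pm_def S_def spec_sum_mult[OF o] by simp
        also have "\<dots> = (\<Sum>l<m. A j l * A l k)" using m by (simp add: S)
        finally have eq: "(\<Sum>l<m. A j l * A l k) - (\<Sum>l<n. P j l * P l k)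
            = (\<Sum>l<n. (Pm m j l - P j l) * Pm m l k) + (\<Sum>l<n. P j l * (Pm m l k - P l k))"
          by (simp add: sum_subtractf sum.distrib algebra_simps flip: sum.distrib)
        have "cmod ((\<Sum>l<m. A j l * A l k) - (\<Sum>l<n. P j l * P l k)) \<le> cmod (\<Sum>l<n. (Pm m j l - P j l) * Pm m l k) + cmod (\<Sum>l<n. P j l * (Pm m l k - P l k))"
          unfolding eq by (rule norm_triangle_ineq)
        also have "\<dots> \<le> sqrt ((L - N m) * B) + sqrt (B * (L - N m))"
        proof (intro add_mono cmod_sum_mult_le)
          show "(\<Sum>l<n. (cmod (Pm m j l - P j l))\<^sup>2) \<le> L - N m"
            using sum_row_le[OF jk(1), of "\<lambda>i j. Pm m i j - P i j" n] dist[of m n] by linarith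
          show "(\<Sum>l<n. (cmod (Pm m l k))\<^sup>2) \<le> B"
            using sum_row_le[OF jk(2), of "\<lambda>j i. Pm m i j" n] PN[of m n]
              sum.swap[of "\<lambda>i j. (cmod (Pm m i j))\<^sup>2" "{..<n}" "{..<n}"] by linarith
          show "(\<Sum>l<n. (cmod (P j l))\<^sup>2) \<le> B"
            using sum_row_le[OF jk(1), of P n] hs_leD[OF hsP, of n] by linarith
          show "(\<Sum>l<n. (cmod (Pm m l k - P l k))\<^sup>2) \<le> L - N m"
            using sum_row_le[OF jk(2), of "\<lambda>j i. Pm m i j - P i j" n] dist[of m n]
              sum.swap[of "\<lambda>i j. (cmod (Pm m i j - P i j))\<^sup>2" "{..<n}" "{..<n}"] by linarith
        qed
        finally show "cmod ((\<Sum>l<m. A j l * A l k) - (\<Sum>l<n. P j l * P l k)) \<le> 2 * sqrt ((L - N m) * B)"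
          by (simp add: mult.commute)
      qed
    qed
    have "(\<lambda>m. 2 * sqrt ((L - N m) * B)) \<longlonglongrightarrow> 2 * sqrt (0 * B)" by (intro tendsto_intros eps0)
    then have "(\<lambda>m. 2 * sqrt ((L - N m) * B)) \<longlonglongrightarrow> 0" by simp
    then have "(\<lambda>m. (\<Sum>l<m. A j l * A l k) - mat_mult P P j k) \<longlonglongrightarrow> 0"
      by (rule Lim_null_comparison[rotated])
        (use eventually_gt_at_top[of j] eventually_gt_at_top[of k] in eventually_elim, use le in simp)
    then show "(\<lambda>m. \<Sum>l<m. A j l * A l k) \<longlonglongrightarrow> mat_mult P P j k"
      by (simp add: LIM_zero_iff)
  qed
  then have "mat_mult P P = mat_mult A A" by (intro ext)
  then show ?thesis using that psd trace by blast
qed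

text \<open>This resolves the definite description in \<open>mat_abs\<close>: the constructed root
  is the only candidate, since any other one is Hilbert--Schmidt by \<open>psd_hs_of_square\<close>
  and so falls under uniqueness.\<close>

lemma trace_norm_le:
  assumes h: "\<And>j k. cnj (A j k) = A k j" and A: "hs_le A B"
    and M: "\<And>m v. \<bar>Re (fin_form m A v)\<bar> \<le> Re (fin_form m M v)" "\<And>m. Re (\<Sum>k<m. M k k) \<le> \<tau>"
  shows "trace_norm A \<le> ennreal \<tau>"
proof -
  obtain P where P: "psd_mat P" "mat_mult P P = mat_mult A A" "\<And>K. (\<Sum>k<K. Re (P k k)) \<le> \<tau>"
    using abs_mat_exists[OF h A M] by metis
  have adj: "mat_adj A = A" unfolding mat_adj_def using h by simp
  have "mat_abs A = P"
    unfolding mat_abs_def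
  proof (rule the_equality)
    show "psd_mat P \<and> mat_mult P P = mat_mult (mat_adj A) A" using P adj by simp
    fix Q assume Q: "psd_mat Q \<and> mat_mult Q Q = mat_mult (mat_adj A) A"
    then show "Q = P"
      using psd_sqrt_unique[of Q B P B] psd_hs_of_square[OF _ A] P adj by metis
  qed
  moreover have "(\<Sum>k<K. ennreal (Re (P k k))) \<le> ennreal \<tau>" for K
    using P(3)[of K] psd_diag_nonneg[OF P(1)] by (subst sum_ennreal) (auto intro: ennreal_leI)
  ultimately show ?thesis
    unfolding trace_norm_def by (intro suminf_le_const) auto
qed

lemma hs_norm_sq_le:
  assumes D: "hs_le D C"
  shows "hs_norm_sq D \<le> ennreal C"
proof -
  note s = hs_le_row_sums(1)[OF D]
  have "(\<Sum>k. ennreal ((cmod (D j k))\<^sup>2)) = ennreal (\<Sum>k. (cmod (D j k))\<^sup>2)" for j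
    by (rule suminf_ennreal2) (auto intro: s)
  moreover have "(\<Sum>j<J. ennreal (\<Sum>k. (cmod (D j k))\<^sup>2)) \<le> ennreal C" for J
    using hs_le_row_sums(2)[OF D, of J] s
    by (subst sum_ennreal) (auto intro!: ennreal_leI suminf_nonneg)
  ultimately show ?thesis unfolding hs_norm_sq_def by (intro suminf_le_const) auto
qed

subsection \<open>Truncating a density matrix\<close>

lemma psd_fin_form:
  assumes P: "psd_mat P"
  shows "0 \<le> Re (fin_form m P v)"
proof -
  define w where "w = (\<lambda>k. if k < m then v k else 0)"
  have w: "w \<in> ell2" by (rule ell2_finite[of m]) (simp add: w_def)
  have app: "mat_app P w j = (\<Sum>k<m. P j k * v k)" for j
  proof -
    have "mat_app P w j = (\<Sum>k<m. P j k * w k)"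
      unfolding mat_app_def by (rule suminf_finite) (auto simp: w_def)
    then show ?thesis by (simp add: w_def)
  qed
  have "ell2_inner w (mat_app P w) = (\<Sum>j<m. cnj (w j) * mat_app P w j)"
    unfolding ell2_inner_def by (rule suminf_finite) (auto simp: w_def)
  also have "\<dots> = fin_form m P v"
    unfolding app fin_form_def by (simp add: w_def sum_distrib_left mult_ac)
  finally show ?thesis using P w unfolding psd_mat_def by metis
qed

text \<open>Nonnegativity of a 2 x 2 principal minor. The phase s makes the off-diagonal term real;
  the form is then tested at (z, p), or at (q + 1, z) when p = 0.\<close>

lemma psd_entry_le:
  assumes P: "psd_mat P"
  shows "(cmod (P j k))\<^sup>2 \<le> Re (P j j) * Re (P k k)"
proof (cases "j = k")
  case True
  have "Im (P k k) = 0" using psd_hermitian[OF P, of k k] by (metis cnj.simps(2) equal_neg_zero)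
  then show ?thesis unfolding True cmod_power2 by (simp add: power2_eq_square)
next
  case False
  define z where "z = cmod (P j k)"
  define p where "p = Re (P j j)"
  define q where "q = Re (P k k)"
  have p: "0 \<le> p" and q: "0 \<le> q" unfolding p_def q_def by (rule psd_diag_nonneg[OF P])+
  obtain s where s: "cmod s = 1" "P j k * s = of_real z"
  proof (cases "P j k = 0")
    case True
    then show ?thesis using that[of 1] by (simp add: z_def)
  next
    case False
    then have z: "z \<noteq> 0" by (simp add: z_def)
    have "P j k * cnj (P j k) = of_real z * of_real z"
      using complex_norm_square[of "P j k"] by (simp add: z_def power2_eq_square)
    then have "P j k * (cnj (P j k) / of_real z) = of_real z" using z by (simp add: times_divide_eq_right)
    moreover have "cmod (cnj (P j k) / of_real z) = 1" using z by (simp add: norm_divide z_def)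
    ultimately show ?thesis using that by blast
  qed
  have key: "0 \<le> a\<^sup>2 * p + b\<^sup>2 * q - 2 * a * b * z" for a b :: real
  proof -
    define v where "v = (\<lambda>i. if i = j then of_real a else if i = k then - of_real b * s else 0)"
    define m where "m = Suc (max j k)"
    have "fin_form m P v = (\<Sum>i\<in>{j, k}. \<Sum>l<m. cnj (v i) * P i l * v l)"
      unfolding fin_form_def by (rule sum.mono_neutral_right) (auto simp: m_def v_def)
    also have "\<dots> = (\<Sum>i\<in>{j, k}. \<Sum>l\<in>{j, k}. cnj (v i) * P i l * v l)"
      by (intro sum.cong refl sum.mono_neutral_right) (auto simp: m_def v_def)
    also have "\<dots> = of_real (a\<^sup>2) * P j j + of_real (b\<^sup>2) * (cnj s * s) * P k k
        - of_real (a * b) * (P j k * s + cnj (P j k * s))"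
      using False unfolding v_def by (simp add: psd_hermitian[OF P] power2_eq_square algebra_simps)
    also have "cnj s * s = 1" using s(1) complex_norm_square[of s] by (simp add: mult.commute)
    finally have "Re (fin_form m P v) = a\<^sup>2 * p + b\<^sup>2 * q - 2 * a * b * z"
      unfolding s(2) p_def q_def by simp
    then show ?thesis using psd_fin_form[OF P, of m v] by simp
  qed
  have "z\<^sup>2 \<le> p * q"
  proof (cases "p = 0")
    case True
    have "0 \<le> z\<^sup>2 * q - 2 * (q + 1) * z * z" using key[of "q + 1" z] True by simp
    then have "(q + 2) * z\<^sup>2 \<le> 0" by (simp add: power2_eq_square algebra_simps)
    then have "z\<^sup>2 \<le> 0" using q by (simp add: mult_le_0_iff)
    then show ?thesis using True by simp
  next
    case False
    have "0 \<le> p * (p * q - z\<^sup>2)" using key[of z p] by (simp add: power2_eq_square algebra_simps)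
    then show ?thesis using False p by (simp add: zero_le_mult_iff)
  qed
  then show ?thesis unfolding z_def p_def q_def .
qed

definition trace_tail :: "(nat \<Rightarrow> nat \<Rightarrow> complex) \<Rightarrow> nat \<Rightarrow> real" where
  "trace_tail \<rho> N = 1 - (\<Sum>k<N. Re (\<rho> k k))"

lemma density_trace:
  assumes \<rho>: "density_matrix \<rho>"
  shows "(\<Sum>k<m. Re (\<rho> k k)) \<le> 1" "0 \<le> trace_tail \<rho> N" "trace_tail \<rho> \<longlonglongrightarrow> 0"
    "(\<Sum>k<m. if k < N then 0 else Re (\<rho> k k)) \<le> trace_tail \<rho> N"
proof -
  have P: "psd_mat \<rho>" using \<rho> unfolding density_matrix_def by blast
  have s: "(\<lambda>k. Re (\<rho> k k)) sums 1"
    using \<rho> sums_Re[of "\<lambda>k. \<rho> k k" 1] unfolding density_matrix_def by simp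
  show le: "(\<Sum>k<m. Re (\<rho> k k)) \<le> 1" for m
    using sum_le_suminf[OF sums_summable[OF s], of "{..<m}"] sums_unique[OF s] psd_diag_nonneg[OF P] by simp
  then show "0 \<le> trace_tail \<rho> N" unfolding trace_tail_def by simp
  have "(\<lambda>N. 1 - (\<Sum>k<N. Re (\<rho> k k))) \<longlonglongrightarrow> 1 - 1"
    using s unfolding sums_def by (intro tendsto_intros)
  then show "trace_tail \<rho> \<longlonglongrightarrow> 0" unfolding trace_tail_def[abs_def] by simp
  have "(\<Sum>k<m. if k < N then 0 else Re (\<rho> k k)) \<le> (\<Sum>k<max m N. if k < N then 0 else Re (\<rho> k k))"
    using psd_diag_nonneg[OF P] by (intro sum_mono2) auto
  also have "\<dots> = (\<Sum>k<max m N. Re (\<rho> k k)) - (\<Sum>k<max m N. if k < N then Re (\<rho> k k) else 0)"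
    by (simp flip: sum_subtractf) (intro sum.cong refl, simp)
  also have "(\<Sum>k<max m N. if k < N then Re (\<rho> k k) else 0) = (\<Sum>k<N. Re (\<rho> k k))"
    by (rule sum.mono_neutral_cong_right) auto
  finally show "(\<Sum>k<m. if k < N then 0 else Re (\<rho> k k)) \<le> trace_tail \<rho> N"
    using le[of "max m N"] unfolding trace_tail_def by linarith
qed

text \<open>Outside the block |rho_jk|^2 <= r_j r_k <= t_j r_k + r_j t_k, where t is the diagonal r
  cut to indices from N on. Summing, each product contributes at most the trace tail times the full
  trace 1.\<close>

lemma truncated_hs_le:
  assumes \<rho>: "density_matrix \<rho>" and D: "\<And>j k. \<not> (j < N \<and> k < N) \<Longrightarrow> cmod (D j k) = cmod (\<rho> j k)"
  shows "hs_le D ((\<Sum>j<N. \<Sum>k<N. (cmod (D j k))\<^sup>2) + 2 * trace_tail \<rho> N)"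
  unfolding hs_le_def
proof
  fix m
  have P: "psd_mat \<rho>" using \<rho> unfolding density_matrix_def by blast
  define r where "r = (\<lambda>k. Re (\<rho> k k))"
  define t where "t = (\<lambda>k. if k < N then 0 else r k)"
  have r: "0 \<le> r k" for k unfolding r_def by (rule psd_diag_nonneg[OF P])
  then have t: "0 \<le> t k" for k unfolding t_def by simp
  have "(cmod (D j k))\<^sup>2 \<le> (if j < N \<and> k < N then (cmod (D j k))\<^sup>2 else 0) + t j * r k + r j * t k" for j k
  proof (cases "j < N \<and> k < N")
    case True
    then show ?thesis using t r by simp
  next
    case False
    have "(cmod (\<rho> j k))\<^sup>2 \<le> r j * r k" unfolding r_def by (rule psd_entry_le[OF P])
    moreover have "r j * r k \<le> t j * r k + r j * t k"
      using False mult_nonneg_nonneg[OF r r, of j k] unfolding t_def by auto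
    ultimately show ?thesis unfolding if_not_P[OF False] D[OF False] by linarith
  qed
  then have "(\<Sum>j<m. \<Sum>k<m. (cmod (D j k))\<^sup>2)
      \<le> (\<Sum>j<m. \<Sum>k<m. (if j < N \<and> k < N then (cmod (D j k))\<^sup>2 else 0) + t j * r k + r j * t k)"
    by (intro sum_mono)
  also have "\<dots> = (\<Sum>j<m. \<Sum>k<m. if j < N \<and> k < N then (cmod (D j k))\<^sup>2 else 0)
      + (\<Sum>j<m. t j) * (\<Sum>k<m. r k) + (\<Sum>j<m. r j) * (\<Sum>k<m. t k)"
    by (simp add: sum.distrib sum_product)
  also have "\<dots> \<le> (\<Sum>j<N. \<Sum>k<N. (cmod (D j k))\<^sup>2) + trace_tail \<rho> N * 1 + 1 * trace_tail \<rho> N"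
  proof (intro add_mono mult_mono)
    have "(\<Sum>j<m. \<Sum>k<m. if j < N \<and> k < N then (cmod (D j k))\<^sup>2 else 0)
        \<le> (\<Sum>j<max m N. \<Sum>k<max m N. if j < N \<and> k < N then (cmod (D j k))\<^sup>2 else 0)"
      using sum_square_mono[of m "max m N" "\<lambda>j k. if j < N \<and> k < N then D j k else 0"]
      by (simp add: if_distrib[of "\<lambda>z. (cmod z)\<^sup>2"] cong: if_cong)
    also have "\<dots> = (\<Sum>j<N. \<Sum>k<max m N. if j < N \<and> k < N then (cmod (D j k))\<^sup>2 else 0)"
      by (rule sum.mono_neutral_right) auto
    also have "\<dots> = (\<Sum>j<N. \<Sum>k<N. (cmod (D j k))\<^sup>2)"
      by (intro sum.cong refl sum.mono_neutral_cong_right) auto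
    finally show "(\<Sum>j<m. \<Sum>k<m. if j < N \<and> k < N then (cmod (D j k))\<^sup>2 else 0) \<le> (\<Sum>j<N. \<Sum>k<N. (cmod (D j k))\<^sup>2)" .
    show "(\<Sum>j<m. t j) \<le> trace_tail \<rho> N"
      using density_trace(4)[OF \<rho>] unfolding t_def r_def .
    then show "(\<Sum>j<m. t j) \<le> trace_tail \<rho> N" .
  qed (use density_trace[OF \<rho>] r t in \<open>auto simp: r_def intro!: sum_nonneg\<close>)
  finally show "(\<Sum>j<m. \<Sum>k<m. (cmod (D j k))\<^sup>2) \<le> (\<Sum>j<N. \<Sum>k<N. (cmod (D j k))\<^sup>2) + 2 * trace_tail \<rho> N"
    by simp
qed

lemma fin_form_add: "fin_form m (\<lambda>j k. A j k + C j k) v = fin_form m A v + fin_form m C v"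
  unfolding fin_form_def by (simp add: algebra_simps sum.distrib)

text \<open>M is half of t times the block projection plus R^2 / t, and the form bound is the
  arithmetic-geometric inequality in each coordinate. Confining t to the block keeps its share of
  the trace at t N / 2 however large the section m is.\<close>

lemma block_form_le:
  fixes t :: real
  assumes t: "0 < t" and h: "\<And>j k. cnj (R j k) = R k j" and out: "\<forall>j k. \<not> (j < N \<and> k < N) \<longrightarrow> R j k = 0"
  defines "M \<equiv> \<lambda>j k. \<Sum>p<N. of_real (t / 2) * (unit_seq p j * unit_seq p k) + of_real (1 / (2 * t)) * (R j p * R p k)"
  shows "\<bar>Re (fin_form m R v)\<bar> \<le> Re (fin_form m M v)"
    and "Re (\<Sum>k<m. M k k) \<le> t / 2 * real N + (\<Sum>j<N. \<Sum>k<N. (cmod (R j k))\<^sup>2) / (2 * t)"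
proof -
  define x where "x = (\<lambda>p. if p < m then v p else 0)"
  define w where "w = fin_app m R v"
  have unit: "(\<Sum>j<m. unit_seq p j * c j) = (if p < m then c p else 0)" for p c
    unfolding unit_seq_def by (simp add: if_distrib if_distribR cong: if_cong)
  have x1: "(\<Sum>k<m. unit_seq p k * v k) = x p" "(\<Sum>j<m. unit_seq p j * cnj (v j)) = cnj (x p)" for p
    unfolding unit x_def by auto
  have w1: "(\<Sum>k<m. R p k * v k) = w p" "(\<Sum>j<m. R j p * cnj (v j)) = cnj (w p)" for p
    unfolding w_def fin_app_def by (simp_all add: h)
  have w0: "w p = 0" if "\<not> p < N" for p unfolding w_def fin_app_def using out that by simp
  have form: "fin_form m R v = (\<Sum>p<N. cnj (x p) * w p)"
  proof -
    have "fin_form m R v = (\<Sum>p<m. cnj (v p) * w p)"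
      unfolding fin_form_def w_def fin_app_def by (simp add: sum_distrib_left mult_ac)
    also have "\<dots> = (\<Sum>p<max m N. cnj (x p) * w p)"
      by (rule sum.mono_neutral_cong_left) (auto simp: x_def)
    also have "\<dots> = (\<Sum>p<N. cnj (x p) * w p)"
      by (rule sum.mono_neutral_right) (auto simp: w0)
    finally show ?thesis .
  qed
  have formM: "fin_form m M v = (\<Sum>p<N. of_real (t / 2 * (cmod (x p))\<^sup>2 + (cmod (w p))\<^sup>2 / (2 * t)))"
  proof -
    have "fin_form m M v = (\<Sum>j<m. \<Sum>k<m. \<Sum>p<N. of_real (t / 2) * ((unit_seq p j * cnj (v j)) * (unit_seq p k * v k))
        + of_real (1 / (2 * t)) * ((R j p * cnj (v j)) * (R p k * v k)))"
      unfolding fin_form_def M_def sum_distrib_left sum_distrib_right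
      by (intro sum.cong refl) (simp add: algebra_simps)
    also have "\<dots> = (\<Sum>p<N. \<Sum>j<m. \<Sum>k<m. of_real (t / 2) * ((unit_seq p j * cnj (v j)) * (unit_seq p k * v k))
        + of_real (1 / (2 * t)) * ((R j p * cnj (v j)) * (R p k * v k)))"
      by (rule sum_rotate[symmetric])
    also have "\<dots> = (\<Sum>p<N. of_real (t / 2) * ((\<Sum>j<m. unit_seq p j * cnj (v j)) * (\<Sum>k<m. unit_seq p k * v k))
        + of_real (1 / (2 * t)) * ((\<Sum>j<m. R j p * cnj (v j)) * (\<Sum>k<m. R p k * v k)))"
      unfolding sum_product unfolding sum_distrib_left sum.distrib ..
    also have "\<dots> = (\<Sum>p<N. of_real (t / 2) * (cnj (x p) * x p) + of_real (1 / (2 * t)) * (cnj (w p) * w p))"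
      by (simp only: x1 w1)
    also have "\<dots> = (\<Sum>p<N. of_real (t / 2 * (cmod (x p))\<^sup>2 + (cmod (w p))\<^sup>2 / (2 * t)))"
    proof (intro sum.cong refl)
      fix p
      have "cnj z * z = of_real ((cmod z)\<^sup>2)" for z using complex_norm_square[of z] by (simp add: mult.commute)
      then show "of_real (t / 2) * (cnj (x p) * x p) + of_real (1 / (2 * t)) * (cnj (w p) * w p)
          = complex_of_real (t / 2 * (cmod (x p))\<^sup>2 + (cmod (w p))\<^sup>2 / (2 * t))" by simp
    qed
    finally show ?thesis .
  qed
  have "\<bar>Re (fin_form m R v)\<bar> \<le> (\<Sum>p<N. \<bar>Re (cnj (x p) * w p)\<bar>)"
    unfolding form Re_sum by (rule sum_abs)
  also have "\<dots> \<le> (\<Sum>p<N. t / 2 * (cmod (x p))\<^sup>2 + (cmod (w p))\<^sup>2 / (2 * t))"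
  proof (rule sum_mono)
    fix p
    have "\<bar>Re (cnj (x p) * w p)\<bar> \<le> cmod (x p) * cmod (w p)"
      using abs_Re_le_cmod[of "cnj (x p) * w p"] by (simp add: norm_mult)
    also have "\<dots> \<le> t / 2 * (cmod (x p))\<^sup>2 + (cmod (w p))\<^sup>2 / (2 * t)"
    proof -
      have "0 \<le> (t * cmod (x p) - cmod (w p))\<^sup>2" by simp
      then have "2 * t * (cmod (x p) * cmod (w p)) \<le> t\<^sup>2 * (cmod (x p))\<^sup>2 + (cmod (w p))\<^sup>2"
        by (simp add: power2_diff power_mult_distrib)
      then show ?thesis using t by (simp add: field_simps power2_eq_square)
    qed
    finally show "\<bar>Re (cnj (x p) * w p)\<bar> \<le> t / 2 * (cmod (x p))\<^sup>2 + (cmod (w p))\<^sup>2 / (2 * t)" .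
  qed
  also have "\<dots> = Re (fin_form m M v)" unfolding formM by simp
  finally show "\<bar>Re (fin_form m R v)\<bar> \<le> Re (fin_form m M v)" .
  have "(\<Sum>k<m. M k k) = (\<Sum>p<N. of_real (t / 2) * (\<Sum>k<m. unit_seq p k * unit_seq p k)
      + of_real (1 / (2 * t)) * (\<Sum>k<m. R k p * R p k))"
    unfolding M_def by (subst sum.swap) (simp add: sum.distrib sum_distrib_left)
  also have "\<dots> = (\<Sum>p<N. of_real (t / 2 * (if p < m then 1 else 0) + (\<Sum>k<m. (cmod (R p k))\<^sup>2) / (2 * t)))"
  proof (intro sum.cong refl)
    fix p
    have "(\<Sum>k<m. unit_seq p k * unit_seq p k) = of_real (if p < m then 1 else 0)"
      unfolding unit by (simp add: unit_seq_def)
    moreover have "(\<Sum>k<m. R k p * R p k) = of_real (\<Sum>k<m. (cmod (R p k))\<^sup>2)"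
      unfolding of_real_sum complex_norm_square h by (simp add: mult.commute)
    ultimately show "of_real (t / 2) * (\<Sum>k<m. unit_seq p k * unit_seq p k) + of_real (1 / (2 * t)) * (\<Sum>k<m. R k p * R p k)
        = complex_of_real (t / 2 * (if p < m then 1 else 0) + (\<Sum>k<m. (cmod (R p k))\<^sup>2) / (2 * t))" by simp
  qed
  finally have "Re (\<Sum>k<m. M k k) = (\<Sum>p<N. t / 2 * (if p < m then 1 else 0) + (\<Sum>k<m. (cmod (R p k))\<^sup>2) / (2 * t))"
    by (simp only: Re_sum Re_complex_of_real)
  also have "\<dots> \<le> (\<Sum>p<N. t / 2 * 1 + (\<Sum>k<N. (cmod (R p k))\<^sup>2) / (2 * t))"
  proof (intro sum_mono add_mono divide_right_mono)
    fix p
    have "(\<Sum>k<m. (cmod (R p k))\<^sup>2) \<le> (\<Sum>k<max m N. (cmod (R p k))\<^sup>2)" by (intro sum_mono2) auto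
    also have "\<dots> = (\<Sum>k<N. (cmod (R p k))\<^sup>2)"
      by (rule sum.mono_neutral_right) (use out in auto)
    finally show "(\<Sum>k<m. (cmod (R p k))\<^sup>2) \<le> (\<Sum>k<N. (cmod (R p k))\<^sup>2)" .
  qed (use t in auto)
  also have "\<dots> = t / 2 * real N + (\<Sum>j<N. \<Sum>k<N. (cmod (R j k))\<^sup>2) / (2 * t)"
    by (simp add: sum.distrib sum_divide_distrib)
  finally show "Re (\<Sum>k<m. M k k) \<le> t / 2 * real N + (\<Sum>j<N. \<Sum>k<N. (cmod (R j k))\<^sup>2) / (2 * t)" .
qed

text \<open>With \<open>\<Pi>\<close> the projection to the block, \<open>\<plusminus>(\<rho> - \<Pi> \<rho> \<Pi>) \<le> \<epsilon> \<Pi> \<rho> \<Pi> + (1 + 1 / \<epsilon>) (1 - \<Pi>) \<rho> (1 - \<Pi>)\<close>.\<close>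

lemma tail_form_le:
  fixes \<epsilon> :: real and N :: nat
  assumes e: "0 < \<epsilon>" and \<rho>: "density_matrix \<rho>"
  defines "T \<equiv> \<lambda>j k. if j < N \<and> k < N then 0 else - \<rho> j k"
    and "M \<equiv> \<lambda>j k. if j < N \<and> k < N then of_real \<epsilon> * \<rho> j k
      else if j < N \<or> k < N then 0 else of_real (1 + 1 / \<epsilon>) * \<rho> j k"
  shows "\<bar>Re (fin_form m T v)\<bar> \<le> Re (fin_form m M v)"
    and "Re (\<Sum>k<m. M k k) \<le> \<epsilon> + (1 + 1 / \<epsilon>) * trace_tail \<rho> N"
proof -
  have P: "psd_mat \<rho>" using \<rho> unfolding density_matrix_def by blast
  define x where "x = (\<lambda>k. if k < N then v k else 0)"
  define y where "y = (\<lambda>k. if k < N then 0 else v k)"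
  define X Y V where "X = Re (fin_form m \<rho> x)" and "Y = Re (fin_form m \<rho> y)" and "V = Re (fin_form m \<rho> v)"
  have Y: "0 \<le> Y" unfolding Y_def by (rule psd_fin_form[OF P])
  have comb: "0 \<le> a\<^sup>2 * X + b\<^sup>2 * Y + a * b * (V - X - Y)" for a b :: real
  proof -
    have "fin_form m \<rho> (\<lambda>k. of_real a * x k + of_real b * y k)
        = of_real (a\<^sup>2) * fin_form m \<rho> x + of_real (b\<^sup>2) * fin_form m \<rho> y
          + of_real (a * b) * (fin_form m \<rho> v - fin_form m \<rho> x - fin_form m \<rho> y)"
      unfolding fin_form_def sum_distrib_left sum_subtractf[symmetric] sum.distrib[symmetric]
      by (intro sum.cong refl) (auto simp: x_def y_def power2_eq_square algebra_simps)
    then have "Re (fin_form m \<rho> (\<lambda>k. of_real a * x k + of_real b * y k)) = a\<^sup>2 * X + b\<^sup>2 * Y + a * b * (V - X - Y)"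
      unfolding X_def Y_def V_def by simp
    then show ?thesis using psd_fin_form[OF P] by metis
  qed
  \<comment> \<open>V - X - Y is the mixed term between the parts of v inside and outside the block.
    The weights a and b have product 1 or -1, giving both signs.\<close>
  have cross: "\<bar>V - X - Y\<bar> \<le> \<epsilon> * X + 1 / \<epsilon> * Y"
    using comb[of "sqrt \<epsilon>" "1 / sqrt \<epsilon>"] comb[of "sqrt \<epsilon>" "- (1 / sqrt \<epsilon>)"] e
    by (simp add: power_divide)
  have fT: "fin_form m T v = fin_form m \<rho> x - fin_form m \<rho> v"
    unfolding fin_form_def sum_subtractf[symmetric] T_def x_def by (intro sum.cong refl) auto
  have fM: "fin_form m M v = of_real \<epsilon> * fin_form m \<rho> x + of_real (1 + 1 / \<epsilon>) * fin_form m \<rho> y"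
    unfolding fin_form_def sum_distrib_left sum.distrib[symmetric] M_def x_def y_def
    by (intro sum.cong refl) auto
  have "\<bar>X - V\<bar> \<le> \<epsilon> * X + (1 + 1 / \<epsilon>) * Y"
    using cross Y unfolding distrib_right by linarith
  moreover have "Re (fin_form m T v) = X - V" unfolding fT X_def V_def by simp
  moreover have "Re (fin_form m M v) = \<epsilon> * X + (1 + 1 / \<epsilon>) * Y"
    unfolding fM X_def Y_def by (simp only: plus_complex.sel Re_complex_of_real times_complex.sel Im_complex_of_real)
  ultimately show "\<bar>Re (fin_form m T v)\<bar> \<le> Re (fin_form m M v)" by simp
  have "Re (\<Sum>k<m. M k k) = (\<Sum>k<m. \<epsilon> * (if k < N then Re (\<rho> k k) else 0) + (1 + 1 / \<epsilon>) * (if k < N then 0 else Re (\<rho> k k)))"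
    unfolding Re_sum M_def
  proof (intro sum.cong refl)
    fix k
    have rc: "Re (of_real c * z) = c * Re z" for c z by simp
    show "Re (if k < N \<and> k < N then of_real \<epsilon> * \<rho> k k
          else if k < N \<or> k < N then 0 else of_real (1 + 1 / \<epsilon>) * \<rho> k k)
        = \<epsilon> * (if k < N then Re (\<rho> k k) else 0) + (1 + 1 / \<epsilon>) * (if k < N then 0 else Re (\<rho> k k))"
      by (cases "k < N") (simp_all only: simp_thms if_True if_False rc mult_zero_right add_0_left add_0_right)
  qed
  also have "\<dots> = \<epsilon> * (\<Sum>k<m. if k < N then Re (\<rho> k k) else 0) + (1 + 1 / \<epsilon>) * (\<Sum>k<m. if k < N then 0 else Re (\<rho> k k))"
    by (simp add: sum.distrib sum_distrib_left)
  also have "\<dots> \<le> \<epsilon> * 1 + (1 + 1 / \<epsilon>) * trace_tail \<rho> N"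
  proof (intro add_mono mult_left_mono density_trace[OF \<rho>])
    have "(\<Sum>k<m. if k < N then Re (\<rho> k k) else 0) \<le> (\<Sum>k<m. Re (\<rho> k k))"
      using psd_diag_nonneg[OF P] by (intro sum_mono) auto
    then show "(\<Sum>k<m. if k < N then Re (\<rho> k k) else 0) \<le> 1" using density_trace(1)[OF \<rho>, of m] by linarith
  qed (use e in auto)
  finally show "Re (\<Sum>k<m. M k k) \<le> \<epsilon> + (1 + 1 / \<epsilon>) * trace_tail \<rho> N" by simp
qed

lemma truncated_trace_norm_le:
  fixes t \<epsilon> :: real
  assumes \<rho>: "density_matrix \<rho>" and h: "\<And>j k. cnj (D j k) = D k j"
    and D: "\<And>j k. \<not> (j < N \<and> k < N) \<Longrightarrow> D j k = - \<rho> j k" and t: "0 < t" and e: "0 < \<epsilon>"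
  shows "trace_norm D \<le> ennreal (t / 2 * real N + (\<Sum>j<N. \<Sum>k<N. (cmod (D j k))\<^sup>2) / (2 * t)
    + (\<epsilon> + (1 + 1 / \<epsilon>) * trace_tail \<rho> N))"
proof -
  define R where "R = (\<lambda>j k. if j < N \<and> k < N then D j k else 0)"
  define T where "T = (\<lambda>j k. if j < N \<and> k < N then 0 else - \<rho> j k)"
  define M1 where "M1 = (\<lambda>j k. \<Sum>p<N. of_real (t / 2) * (unit_seq p j * unit_seq p k) + of_real (1 / (2 * t)) * (R j p * R p k))"
  define M2 where "M2 = (\<lambda>j k. if j < N \<and> k < N then of_real \<epsilon> * \<rho> j k
      else if j < N \<or> k < N then 0 else of_real (1 + 1 / \<epsilon>) * \<rho> j k)"
  have Rh: "cnj (R j k) = R k j" for j k unfolding R_def using h by auto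
  have Ro: "\<forall>j k. \<not> (j < N \<and> k < N) \<longrightarrow> R j k = 0" unfolding R_def by auto
  have RD: "(\<Sum>j<N. \<Sum>k<N. (cmod (R j k))\<^sup>2) = (\<Sum>j<N. \<Sum>k<N. (cmod (D j k))\<^sup>2)" unfolding R_def by simp
  note 1 = block_form_le(1)[where t = t and R = R and N = N, OF t Rh Ro, folded M1_def]
  note 2 = tail_form_le(1)[where N = N, OF e \<rho>, folded T_def M2_def]
  have DRT: "D = (\<lambda>j k. R j k + T j k)" unfolding R_def T_def using D by (intro ext) auto
  have hs: "hs_le D ((\<Sum>j<N. \<Sum>k<N. (cmod (D j k))\<^sup>2) + 2 * trace_tail \<rho> N)"
    by (rule truncated_hs_le[OF \<rho>]) (use D in simp)
  show ?thesis
  proof (rule trace_norm_le[OF h hs, where M = "\<lambda>j k. M1 j k + M2 j k"])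
    show "\<bar>Re (fin_form m D v)\<bar> \<le> Re (fin_form m (\<lambda>j k. M1 j k + M2 j k) v)" for m v
      unfolding DRT fin_form_add plus_complex.sel using 1[where m = m and v = v] 2[where m = m and v = v] by linarith
    have "Re (\<Sum>k<m. M1 k k) \<le> t / 2 * real N + (\<Sum>j<N. \<Sum>k<N. (cmod (R j k))\<^sup>2) / (2 * t)" for m
      unfolding M1_def by (rule block_form_le(2)[OF t Rh Ro])
    moreover have "Re (\<Sum>k<m. M2 k k) \<le> \<epsilon> + (1 + 1 / \<epsilon>) * trace_tail \<rho> N" for m
      unfolding M2_def by (rule tail_form_le(2)[OF e \<rho>])
    ultimately show "Re (\<Sum>k<m. M1 k k + M2 k k) \<le> t / 2 * real N + (\<Sum>j<N. \<Sum>k<N. (cmod (D j k))\<^sup>2) / (2 * t)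
        + (\<epsilon> + (1 + 1 / \<epsilon>) * trace_tail \<rho> N)" for m
      unfolding sum.distrib plus_complex.sel RD by (simp only: add_mono)
  qed
qed

subsection \<open>Consistency\<close>

text \<open>Up to 1 / pi the partial sum is the quadratic form of rho at the vector with entries
  psi_k(x) exp (i k t).\<close>

lemma density_partial_nonneg:
  assumes \<rho>: "density_matrix \<rho>"
  shows "0 \<le> Re (density_partial \<rho> m z)"
proof -
  obtain x t where z: "z = (x, t)" by fastforce
  define v where "v = (\<lambda>k. of_real (psi k x) * cis (real k * t))"
  have eq: "cnj (v j) * \<rho> j k * v k = \<rho> j k * of_real (psi k x * psi j x) * cis (- (real j - real k) * t)" for j k
  proof -
    have "cis (- (real j - real k) * t) = cnj (cis (real j * t)) * cis (real k * t)"
      by (simp add: cis_cnj cis_mult algebra_simps)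
    then show ?thesis unfolding v_def by (simp only: complex_cnj_mult complex_cnj_complex_of_real of_real_mult mult_ac)
  qed
  have "density_partial \<rho> m z = of_real (1 / pi) * fin_form m \<rho> v"
    unfolding z density_partial_def fin_form_def prod.case eq ..
  then have "Re (density_partial \<rho> m z) = 1 / pi * Re (fin_form m \<rho> v)" by simp
  then show ?thesis using \<rho> psd_fin_form[of \<rho> m v] unfolding density_matrix_def by simp
qed

text \<open>A version of the density may be negative on a null set; its positive part is again a version.\<close>

lemma homodyne_density_max:
  assumes \<rho>: "density_matrix \<rho>" and p: "homodyne_density \<rho> p"
  shows "homodyne_density \<rho> (\<lambda>z. max 0 (p z))"
proof -
  have [measurable]: "p \<in> borel_measurable obs_space" using p unfolding homodyne_density_def by blast
  have le: "cmod (d - of_real (max 0 q)) \<le> cmod (d - of_real q)" if "0 \<le> Re d" for d q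
  proof (cases "0 \<le> q")
    case False
    have "(Re d)\<^sup>2 \<le> (Re d - q)\<^sup>2" using that False by (intro power_mono) auto
    then show ?thesis using False by (simp add: cmod_def)
  qed simp
  have "(\<lambda>m. \<integral>\<^sup>+ z. ennreal (cmod (density_partial \<rho> m z - of_real (max 0 (p z)))) \<partial>obs_space) \<longlonglongrightarrow> 0"
  proof (rule tendsto_sandwich[OF _ _ tendsto_const])
    show "(\<lambda>m. \<integral>\<^sup>+ z. ennreal (cmod (density_partial \<rho> m z - of_real (p z))) \<partial>obs_space) \<longlonglongrightarrow> 0"
      using p unfolding homodyne_density_def by blast
    show "\<forall>\<^sub>F m in sequentially. (\<integral>\<^sup>+ z. ennreal (cmod (density_partial \<rho> m z - of_real (max 0 (p z)))) \<partial>obs_space)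
        \<le> (\<integral>\<^sup>+ z. ennreal (cmod (density_partial \<rho> m z - of_real (p z))) \<partial>obs_space)"
      by (intro always_eventually allI nn_integral_mono ennreal_leI le density_partial_nonneg[OF \<rho>])
  qed simp
  then show ?thesis unfolding homodyne_density_def by simp
qed

lemma cmod_pattern_F: "cmod (pattern_F k j z) = \<bar>pattern_fun k j (fst z)\<bar>"
  by (simp add: pattern_F_def case_prod_beta' norm_mult)

lemma cnj_pattern_F: "cnj (pattern_F k j z) = pattern_F j k z"
proof -
  have "- (real k - real j) * t = - (- (real j - real k) * t)" for t by (simp add: algebra_simps)
  then show ?thesis
    by (simp only: pattern_F_def case_prod_beta' pattern_fun_commute[of k j] complex_cnj_mult
        complex_cnj_complex_of_real cis_cnj)
qed

lemma integral_double_sum: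
  fixes f :: "'i \<Rightarrow> 'j \<Rightarrow> 'a \<Rightarrow> real"
  assumes "\<And>i j. i \<in> I \<Longrightarrow> j \<in> J \<Longrightarrow> integrable M (f i j)"
  shows "(\<integral>x. (\<Sum>i\<in>I. \<Sum>j\<in>J. f i j x) \<partial>M) = (\<Sum>i\<in>I. \<Sum>j\<in>J. \<integral>x. f i j x \<partial>M)"
proof -
  have "(\<integral>x. (\<Sum>i\<in>I. \<Sum>j\<in>J. f i j x) \<partial>M) = (\<Sum>i\<in>I. \<integral>x. (\<Sum>j\<in>J. f i j x) \<partial>M)"
    by (intro Bochner_Integration.integral_sum Bochner_Integration.integrable_sum assms)
  also have "\<dots> = (\<Sum>i\<in>I. \<Sum>j\<in>J. \<integral>x. f i j x \<partial>M)"
    by (intro sum.cong refl Bochner_Integration.integral_sum assms)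
  finally show ?thesis .
qed

text \<open>Real and imaginary parts are averaged separately, and their second moments add up to
  that of the pattern function. The sum over entries is taken inside the expectation before it is
  estimated: \<open>pattern_double_sum_le\<close> is uniform in x, so nothing about the law of X is
  required.\<close>

lemma (in prob_space) estimator_mean_square:
  fixes Z :: "nat \<Rightarrow> 'a \<Rightarrow> real \<times> real" and p :: "real \<times> real \<Rightarrow> real" and N n :: nat
  assumes \<rho>: "density_matrix \<rho>" and p: "homodyne_density \<rho> p"
    and ind: "indep_vars (\<lambda>_. obs_space) Z UNIV"
    and dist: "\<And>l. distributed M obs_space (Z l) (\<lambda>z. ennreal (p z))" and n: "0 < n"
  defines "R \<equiv> \<lambda>\<omega>. \<Sum>k<N. \<Sum>j<N. (cmod (pattern_estimator N n (\<lambda>l. Z l \<omega>) k j - \<rho> k j))\<^sup>2"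
  shows "integrable M R" "expectation R \<le> 1152 * (real N powr (9 / 4)) / real n"
proof -
  define p' where "p' = (\<lambda>z. max 0 (p z))"
  have p': "homodyne_density \<rho> p'" unfolding p'_def by (rule homodyne_density_max[OF \<rho> p])
  have [measurable]: "p' \<in> borel_measurable obs_space" using p' unfolding homodyne_density_def by blast
  \<comment> \<open>\<open>ennreal\<close> sends negative values to 0, so p and its positive part
    describe the same law.\<close>
  have "ennreal (p' z) = ennreal (p z)" for z unfolding p'_def by (simp add: max_def ennreal_neg)
  then have dist': "distributed M obs_space (Z l) (\<lambda>z. ennreal (p' z))" for l using dist by simp
  have p0: "0 \<le> p' z" for z unfolding p'_def by simp
  have [measurable]: "Z l \<in> M \<rightarrow>\<^sub>M obs_space" for l using dist unfolding distributed_def by blast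
  have p'_int: "integrable obs_space p'"
    using distributed_integrable[OF dist'[of 0], of "\<lambda>_. 1"] p0 by simp
  note [measurable] = borel_measurable_obs[OF pattern_F_measurable]
  define e where "e = (\<lambda>k j \<omega>. (cmod (pattern_estimator N n (\<lambda>l. Z l \<omega>) k j - \<rho> k j))\<^sup>2)"
  have E: "integrable M (e k j) \<and> expectation (e k j) \<le> expectation (\<lambda>\<omega>. (pattern_fun k j (fst (Z 0 \<omega>)))\<^sup>2) / real n
      \<and> integrable M (\<lambda>\<omega>. (pattern_fun k j (fst (Z 0 \<omega>)))\<^sup>2)" if kj: "k < N" "j < N" for k j
  proof -
    obtain B where B: "0 \<le> B" "\<And>z. cmod (pattern_F k j z) \<le> B" using pattern_F_bounded by blast
    note Fp = pattern_density_integrable[OF p'_int, of k j]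
    have part: "integrable M (\<lambda>\<omega>. ((\<Sum>l<n. g (Z l \<omega>)) / real n - \<mu>)\<^sup>2) \<and>
        expectation (\<lambda>\<omega>. ((\<Sum>l<n. g (Z l \<omega>)) / real n - \<mu>)\<^sup>2) \<le> expectation (\<lambda>\<omega>. (g (Z 0 \<omega>))\<^sup>2) / real n
        \<and> integrable M (\<lambda>\<omega>. (g (Z 0 \<omega>))\<^sup>2)"
      if g[measurable]: "g \<in> borel_measurable obs_space" and gB: "\<And>z. \<bar>g z\<bar> \<le> cmod (pattern_F k j z)"
        and mean: "(LINT z|obs_space. p' z * g z) = \<mu>" for g \<mu>
    proof -
      have b: "\<bar>g z\<bar> \<le> B" for z using gB[of z] B(2)[of z] by linarith
      have 1: "expectation (\<lambda>\<omega>. g (Z l \<omega>)) = \<mu>" for l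
        using distributed_integral[OF dist'[of l] g] p0 mean by simp
      have g2[measurable]: "(\<lambda>z. (g z)\<^sup>2) \<in> borel_measurable obs_space" by measurable
      have 2: "expectation (\<lambda>\<omega>. (g (Z l \<omega>))\<^sup>2) = expectation (\<lambda>\<omega>. (g (Z 0 \<omega>))\<^sup>2)" for l
        using distributed_integral[OF dist'[of l] g2] distributed_integral[OF dist'[of 0] g2] p0 by simp
      have "integrable M (\<lambda>\<omega>. (g (Z 0 \<omega>))\<^sup>2)"
        by (rule integrable_const_bound[of _ "B\<^sup>2"])
          (use b B in \<open>auto simp: abs_le_square_iff[symmetric] intro!: order_trans[OF b]\<close>)
      then show ?thesis using iid_mean_square[OF ind g b 1 2 n] by blast
    qed
    have reF: "(LINT z|obs_space. p' z * Re (pattern_F k j z)) = Re (\<rho> k j)"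
      using integral_Re[OF Fp] pattern_density_integral[OF p' p'_int, of k j] by (simp add: mult.commute)
    have imF: "(LINT z|obs_space. p' z * Im (pattern_F k j z)) = Im (\<rho> k j)"
      using integral_Im[OF Fp] pattern_density_integral[OF p' p'_int, of k j] by (simp add: mult.commute)
    note re = part[OF _ abs_Re_le_cmod reF] and im = part[OF _ abs_Im_le_cmod imF]
    have sq: "(Re (pattern_F k j z))\<^sup>2 + (Im (pattern_F k j z))\<^sup>2 = (pattern_fun k j (fst z))\<^sup>2" for z
      using cmod_power2[of "pattern_F k j z"] unfolding cmod_pattern_F by simp
    have e_eq: "e k j \<omega> = ((\<Sum>l<n. Re (pattern_F k j (Z l \<omega>))) / real n - Re (\<rho> k j))\<^sup>2
        + ((\<Sum>l<n. Im (pattern_F k j (Z l \<omega>))) / real n - Im (\<rho> k j))\<^sup>2" for \<omega>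
      unfolding e_def cmod_power2 pattern_estimator_def using kj by simp
    have "integrable M (e k j)" unfolding e_eq[abs_def] using re im by simp
    moreover have "expectation (e k j) \<le> expectation (\<lambda>\<omega>. (Re (pattern_F k j (Z 0 \<omega>)))\<^sup>2) / real n
        + expectation (\<lambda>\<omega>. (Im (pattern_F k j (Z 0 \<omega>)))\<^sup>2) / real n"
      unfolding e_eq[abs_def] using re im by simp
    moreover have "expectation (\<lambda>\<omega>. (Re (pattern_F k j (Z 0 \<omega>)))\<^sup>2) + expectation (\<lambda>\<omega>. (Im (pattern_F k j (Z 0 \<omega>)))\<^sup>2)
        = expectation (\<lambda>\<omega>. (pattern_fun k j (fst (Z 0 \<omega>)))\<^sup>2)"
      unfolding sq[symmetric] using re im by simp
    moreover have "integrable M (\<lambda>\<omega>. (pattern_fun k j (fst (Z 0 \<omega>)))\<^sup>2)"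
      unfolding sq[symmetric] using re im by simp
    ultimately show ?thesis by (simp add: add_divide_distrib[symmetric])
  qed
  have R_eq: "R = (\<lambda>\<omega>. \<Sum>k<N. \<Sum>j<N. e k j \<omega>)" unfolding R_def e_def ..
  show "integrable M R" unfolding R_eq using E by (intro Bochner_Integration.integrable_sum) auto
  have "expectation R = (\<Sum>k<N. \<Sum>j<N. expectation (e k j))"
    unfolding R_eq using E by (intro integral_double_sum) auto
  also have "\<dots> \<le> (\<Sum>k<N. \<Sum>j<N. expectation (\<lambda>\<omega>. (pattern_fun k j (fst (Z 0 \<omega>)))\<^sup>2) / real n)"
    using E by (intro sum_mono) auto
  also have "\<dots> = expectation (\<lambda>\<omega>. \<Sum>k<N. \<Sum>j<N. (pattern_fun k j (fst (Z 0 \<omega>)))\<^sup>2) / real n"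
    unfolding sum_divide_distrib[symmetric] using E by (subst integral_double_sum) auto
  also have "\<dots> \<le> 1152 * (real N powr (9 / 4)) / real n"
  proof (rule divide_right_mono)
    have "expectation (\<lambda>\<omega>. \<Sum>k<N. \<Sum>j<N. (pattern_fun k j (fst (Z 0 \<omega>)))\<^sup>2) \<le> expectation (\<lambda>\<omega>. 1152 * (real N powr (9 / 4)))"
      using E pattern_double_sum_le
      by (intro integral_mono Bochner_Integration.integrable_sum) auto
    then show "expectation (\<lambda>\<omega>. \<Sum>k<N. \<Sum>j<N. (pattern_fun k j (fst (Z 0 \<omega>)))\<^sup>2) \<le> 1152 * (real N powr (9 / 4))"
      by (simp add: prob_space)
  qed simp
  finally show "expectation R \<le> 1152 * (real N powr (9 / 4)) / real n" .
qed

lemma (in prob_space) nn_integral_affine_le: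
  assumes R: "integrable M R" "\<And>\<omega>. 0 \<le> R \<omega>" "expectation R \<le> c" and ab: "0 \<le> a" "0 \<le> b"
  shows "(\<integral>\<^sup>+ \<omega>. ennreal (a + b * R \<omega>) \<partial>M) \<le> ennreal (a + b * c)"
proof -
  have "(\<integral>\<^sup>+ \<omega>. ennreal (a + b * R \<omega>) \<partial>M) = ennreal (expectation (\<lambda>\<omega>. a + b * R \<omega>))"
    using R ab by (intro nn_integral_eq_integral) auto
  also have "expectation (\<lambda>\<omega>. a + b * R \<omega>) = a + b * expectation R" using R by (simp add: prob_space)
  also have "ennreal \<dots> \<le> ennreal (a + b * c)" using R ab by (intro ennreal_leI add_left_mono mult_left_mono)
  finally show ?thesis .
qed

text \<open>As N n >= 1 and b <= 1 / a, the quotient is at most N^(1/a) / n, which is (N /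
  n^a)^(1/a).\<close>

lemma powr_smallo_tendsto:
  fixes N :: "nat \<Rightarrow> nat"
  assumes o: "(\<lambda>n. real (N n)) \<in> o(\<lambda>n. real n powr a)" and a: "0 < a" and b: "b * a \<le> 1" "0 < b" and N: "\<And>n. 0 < N n"
  shows "(\<lambda>n. real (N n) powr b / real n) \<longlonglongrightarrow> 0"
proof -
  have "(\<lambda>n. real (N n) / real n powr a) \<longlonglongrightarrow> 0" by (rule smalloD_tendsto[OF o])
  then have lim: "(\<lambda>n. (real (N n) / real n powr a) powr (1 / a)) \<longlonglongrightarrow> 0"
    by (rule tendsto_zero_powrI[OF _ tendsto_const]) (use a in auto)
  show ?thesis
  proof (rule tendsto_sandwich[OF _ _ tendsto_const lim])
    show "\<forall>\<^sub>F n in sequentially. real (N n) powr b / real n \<le> (real (N n) / real n powr a) powr (1 / a)"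
      using eventually_gt_at_top[of 0]
    proof eventually_elim
      fix n :: nat assume n: "0 < n"
      have "b \<le> 1 / a" using a b by (simp add: pos_le_divide_eq)
      moreover have "1 \<le> real (N n)" using N[of n] by simp
      ultimately have "real (N n) powr b \<le> real (N n) powr (1 / a)" by (intro powr_mono) auto
      then show "real (N n) powr b / real n \<le> (real (N n) / real n powr a) powr (1 / a)"
        using n a by (simp add: powr_divide powr_powr divide_right_mono)
    qed
  qed simp
qed

theorem theorem1:
  fixes M :: "'a measure"
    and \<rho> :: "nat \<Rightarrow> nat \<Rightarrow> complex"
    and p :: "real \<times> real \<Rightarrow> real"
    and X \<Phi> :: "nat \<Rightarrow> 'a \<Rightarrow> real"
    and N :: "nat \<Rightarrow> nat"
  assumes "prob_space M"
    and "density_matrix \<rho>"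
    and "homodyne_density \<rho> p"
    and "prob_space.indep_vars M (\<lambda>_. obs_space) (\<lambda>l \<omega>. (X l \<omega>, \<Phi> l \<omega>)) UNIV"
    and "\<And>l. distributed M obs_space (\<lambda>\<omega>. (X l \<omega>, \<Phi> l \<omega>)) (\<lambda>z. ennreal (p z))"
    and "\<And>n. 0 < N n"
    and "filterlim N at_top sequentially"
  shows "((\<lambda>n. real (N n)) \<in> o(\<lambda>n. real n powr (3 / 7)) \<longrightarrow>
      (\<lambda>n. \<integral>\<^sup>+ \<omega>. hs_norm_sq
          (\<lambda>k j. pattern_estimator (N n) n (\<lambda>l. (X l \<omega>, \<Phi> l \<omega>)) k j - \<rho> k j) \<partial>M)
        \<longlonglongrightarrow> 0) \<and>
    ((\<lambda>n. real (N n)) \<in> o(\<lambda>n. real n powr (3 / 10)) \<longrightarrow>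
      (\<lambda>n. \<integral>\<^sup>+ \<omega>. trace_norm
          (\<lambda>k j. pattern_estimator (N n) n (\<lambda>l. (X l \<omega>, \<Phi> l \<omega>)) k j - \<rho> k j) \<partial>M)
        \<longlonglongrightarrow> 0)"
proof -
  interpret prob_space M by fact
  note \<rho> = assms(2) and N = assms(6)
  define D where "D = (\<lambda>n \<omega> k j. pattern_estimator (N n) n (\<lambda>l. (X l \<omega>, \<Phi> l \<omega>)) k j - \<rho> k j)"
  define R where "R = (\<lambda>n \<omega>. \<Sum>k<N n. \<Sum>j<N n. (cmod (D n \<omega> k j))\<^sup>2)"
  define c where "c = (\<lambda>n. 1152 * (real (N n) powr (9 / 4)) / real n)"
  define \<delta> where "\<delta> = (\<lambda>n. trace_tail \<rho> (N n))"
  have R0: "0 \<le> R n \<omega>" for n \<omega> unfolding R_def by (intro sum_nonneg) auto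
  have R: "integrable M (R n)" "expectation (R n) \<le> c n" if "0 < n" for n
    using estimator_mean_square[OF \<rho> assms(3-5) that, of "N n"] unfolding R_def D_def c_def by auto
  have c0: "0 \<le> c n" for n unfolding c_def by simp
  have d0: "0 \<le> \<delta> n" for n unfolding \<delta>_def by (rule density_trace(2)[OF \<rho>])
  have d_lim: "\<delta> \<longlonglongrightarrow> 0"
    unfolding \<delta>_def by (rule filterlim_compose[OF density_trace(3)[OF \<rho>] assms(7)])
  have Dout: "D n \<omega> k j = - \<rho> k j" if "\<not> (k < N n \<and> j < N n)" for n \<omega> k j
    using that unfolding D_def pattern_estimator_def by auto
  have Dh: "cnj (D n \<omega> j k) = D n \<omega> k j" for n \<omega> j k
    using \<rho> psd_hermitian[of \<rho>] cnj_pattern_F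
    unfolding D_def pattern_estimator_def density_matrix_def by simp
  have hs: "hs_norm_sq (D n \<omega>) \<le> ennreal (2 * \<delta> n + 1 * R n \<omega>)" for n \<omega>
  proof (rule hs_norm_sq_le)
    have "hs_le (D n \<omega>) ((\<Sum>j<N n. \<Sum>k<N n. (cmod (D n \<omega> j k))\<^sup>2) + 2 * trace_tail \<rho> (N n))"
      by (rule truncated_hs_le[OF \<rho>]) (subst Dout, assumption, rule norm_minus_cancel)
    then show "hs_le (D n \<omega>) (2 * \<delta> n + 1 * R n \<omega>)" unfolding R_def \<delta>_def by (simp add: add.commute)
  qed
  have one: "(\<lambda>n. \<integral>\<^sup>+ \<omega>. hs_norm_sq (D n \<omega>) \<partial>M) \<longlonglongrightarrow> 0"
    if o: "(\<lambda>n. real (N n)) \<in> o(\<lambda>n. real n powr (3 / 7))"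
  proof (rule tendsto_sandwich[OF _ _ tendsto_const])
    \<comment> \<open>The condition on the exponents is (9/4) (3/7) = 27/28 <= 1.\<close>
    have "(\<lambda>n. real (N n) powr (9 / 4) / real n) \<longlonglongrightarrow> 0"
      by (rule powr_smallo_tendsto[OF o]) (use N in auto)
    then have "(\<lambda>n. 2 * \<delta> n + 1 * (1152 * (real (N n) powr (9 / 4) / real n))) \<longlonglongrightarrow> 2 * 0 + 1 * (1152 * 0)"
      by (intro tendsto_intros d_lim)
    then have "(\<lambda>n. 2 * \<delta> n + 1 * c n) \<longlonglongrightarrow> 0" unfolding c_def by simp
    from tendsto_ennrealI[OF this] show "(\<lambda>n. ennreal (2 * \<delta> n + 1 * c n)) \<longlonglongrightarrow> 0" by simp
    show "\<forall>\<^sub>F n in sequentially. (\<integral>\<^sup>+ \<omega>. hs_norm_sq (D n \<omega>) \<partial>M) \<le> ennreal (2 * \<delta> n + 1 * c n)"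
      using eventually_gt_at_top[of 0]
    proof eventually_elim
      fix n :: nat assume n: "0 < n"
      have "(\<integral>\<^sup>+ \<omega>. hs_norm_sq (D n \<omega>) \<partial>M) \<le> (\<integral>\<^sup>+ \<omega>. ennreal (2 * \<delta> n + 1 * R n \<omega>) \<partial>M)"
        by (intro nn_integral_mono hs)
      also have "\<dots> \<le> ennreal (2 * \<delta> n + 1 * c n)"
        using R[OF n] R0 d0[of n] by (intro nn_integral_affine_le) auto
      finally show "(\<integral>\<^sup>+ \<omega>. hs_norm_sq (D n \<omega>) \<partial>M) \<le> ennreal (2 * \<delta> n + 1 * c n)" .
    qed
  qed simp
  \<comment> \<open>The root of the trace tail makes both epsilon and delta / epsilon tend to 0; the
    summand 1 / n keeps it positive when the tail vanishes.\<close>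
  define \<epsilon> where "\<epsilon> = (\<lambda>n. sqrt (\<delta> n + 1 / real n))"
  have two: "(\<lambda>n. \<integral>\<^sup>+ \<omega>. trace_norm (D n \<omega>) \<partial>M) \<longlonglongrightarrow> 0"
    if o: "(\<lambda>n. real (N n)) \<in> o(\<lambda>n. real n powr (3 / 10))"
  proof (rule tendsto_sandwich[OF _ _ tendsto_const])
    have Nc: "c n * real (N n) = 1152 * (real (N n) powr (13 / 4) / real n)" for n
    proof -
      have "real (N n) powr (9 / 4) * real (N n) powr 1 = real (N n) powr (13 / 4)"
        by (simp only: powr_add[symmetric]) simp
      then show ?thesis using N[of n] unfolding c_def by simp
    qed
    \<comment> \<open>Here (13/4) (3/10) = 39/40 <= 1.\<close>
    have "(\<lambda>n. real (N n) powr (13 / 4) / real n) \<longlonglongrightarrow> 0"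
      by (rule powr_smallo_tendsto[OF o]) (use N in auto)
    then have "(\<lambda>n. sqrt (1152 * (real (N n) powr (13 / 4) / real n)) + (2 * \<epsilon> n + \<delta> n)) \<longlonglongrightarrow> sqrt (1152 * 0) + (2 * sqrt (0 + 0) + 0)"
      unfolding \<epsilon>_def by (intro tendsto_intros d_lim lim_inverse_n'[unfolded inverse_eq_divide])
    then have "(\<lambda>n. sqrt (c n * real (N n)) + (2 * \<epsilon> n + \<delta> n)) \<longlonglongrightarrow> 0" unfolding Nc by simp
    from tendsto_ennrealI[OF this]
    show "(\<lambda>n. ennreal (sqrt (c n * real (N n)) + (2 * \<epsilon> n + \<delta> n))) \<longlonglongrightarrow> 0" by simp
    show "\<forall>\<^sub>F n in sequentially. (\<integral>\<^sup>+ \<omega>. trace_norm (D n \<omega>) \<partial>M) \<le> ennreal (sqrt (c n * real (N n)) + (2 * \<epsilon> n + \<delta> n))"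
      using eventually_gt_at_top[of 0]
    proof eventually_elim
      fix n :: nat assume n: "0 < n"
      have cp: "0 < c n" using n N[of n] unfolding c_def by simp
      \<comment> \<open>This t minimises t N / 2 + c / (2 t); both terms then equal half of sqrt (c
        N).\<close>
      define t where "t = sqrt (c n / real (N n))"
      have t: "0 < t" unfolding t_def using cp N[of n] by simp
      have tN: "t * real (N n) = sqrt (c n * real (N n))"
      proof -
        have "sqrt (c n / real (N n)) * sqrt (real (N n) * real (N n)) = sqrt (c n * real (N n))"
          unfolding real_sqrt_mult[symmetric] using N[of n] by simp
        then show ?thesis unfolding t_def by simp
      qed
      have ct: "c n / t = sqrt (c n * real (N n))"
      proof -
        have "t * t = c n / real (N n)" unfolding t_def using cp by simp
        then have "c n = t * (t * real (N n))" using N[of n] by (simp add: field_simps)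
        then show ?thesis using t tN by (simp add: field_simps)
      qed
      have e: "0 < \<epsilon> n" unfolding \<epsilon>_def using d0[of n] n by (simp add: add_nonneg_pos)
      have "\<delta> n \<le> \<epsilon> n * \<epsilon> n" unfolding \<epsilon>_def using d0[of n] by simp
      then have de: "1 / \<epsilon> n * \<delta> n \<le> \<epsilon> n" using e by (simp add: field_simps)
      define a where "a = t / 2 * real (N n) + (\<epsilon> n + (1 + 1 / \<epsilon> n) * \<delta> n)"
      have a: "0 \<le> a" unfolding a_def using t e d0[of n] by simp
      have "trace_norm (D n \<omega>) \<le> ennreal (a + 1 / (2 * t) * R n \<omega>)" for \<omega>
        using truncated_trace_norm_le[OF \<rho> Dh[of n \<omega>] Dout t e]
        unfolding a_def R_def \<delta>_def by (simp add: algebra_simps)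
      then have "(\<integral>\<^sup>+ \<omega>. trace_norm (D n \<omega>) \<partial>M) \<le> (\<integral>\<^sup>+ \<omega>. ennreal (a + 1 / (2 * t) * R n \<omega>) \<partial>M)"
        by (intro nn_integral_mono)
      also have "\<dots> \<le> ennreal (a + 1 / (2 * t) * c n)"
        using R[OF n] R0 a t by (intro nn_integral_affine_le) auto
      also have "\<dots> \<le> ennreal (sqrt (c n * real (N n)) + (2 * \<epsilon> n + \<delta> n))"
      proof (rule ennreal_leI)
        have "1 / (2 * t) * c n = sqrt (c n * real (N n)) / 2" unfolding ct[symmetric] by simp
        moreover have "t / 2 * real (N n) = sqrt (c n * real (N n)) / 2" unfolding tN[symmetric] by simp
        ultimately show "a + 1 / (2 * t) * c n \<le> sqrt (c n * real (N n)) + (2 * \<epsilon> n + \<delta> n)"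
          unfolding a_def distrib_right using de by simp
      qed
      finally show "(\<integral>\<^sup>+ \<omega>. trace_norm (D n \<omega>) \<partial>M) \<le> ennreal (sqrt (c n * real (N n)) + (2 * \<epsilon> n + \<delta> n))" .
    qed
  qed simp
  show ?thesis using one two unfolding D_def by blast
qed

end
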